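(* Let $T>0$, $s\in(1/2,1)$, let $\omega\subset(-1,1)$ have nonempty interior, let $\sigma\in W^{1,\infty}(0,T)$ with $\sigma(T)\neq 0$, let $f\in L^2(-1,1)$, and let $u$ be the finite-energy solution of $$\begin{cases}\partial_t u+(-\partial_x^2)^s u=f(x)\sigma(t) & \text{in }(-1,1)\times(0,T),\\ u=0 & \text{in }(\mathbb{R}\setminus(-1,1))\times(0,T),\\ u(\cdot,0)=0 & \text{in }(-1,1).\end{cases}$$ Let $\{\lambda_n\}_{n\in\mathbb{N}}$ and $\{\varphi_n\}_{n\in\mathbb{N}}$ be the eigenvalues and the orthonormal basis of eigenfunctions of the fractional Laplacian $(-\partial_x^2)^s$ in $(-1,1)$ with homogeneous Dirichlet exterior condition. Fix $n\in\mathbb{N}$. For each $0<\tau\le T$, let $h^{(\tau)}\in L^2(0,\tau;L^2(\omega))$ be a null control for the datum $\varphi_n$, i.e. the solution $\phi$ of $$\begin{cases}-\partial_t\phi+(-\partial_x^2)^s\phi=h^{(\tau)}\chi_{\omega\times(0,\tau)} & \text{in }(-1,1)\times(0,\tau),\\ \phi=0 & \text{in }(\mathbb{R}\setminus(-1,1))\times(0,\tau),\\ \phi(\cdot,\tau)=\varphi_n & \text{in }(-1,1)\end{cases}$$ satisfies $\phi(\cdot,0)=0$ in $(-1,1)$; extend $h^{(\tau)}$ by zero to $(\tau,T]$. Let $\theta^{(\tau)}\in H^1(0,\tau;L^2(-1,1))$ be the solution of the Volterra integral equation $$\begin{cases}h^{(\tau)}(x,t)=\sigma(0)\,\theta^{(\tau)}_t(x,t)+\displaystyle\int_t^{\tau}\Big(\sigma(r-t)\,\theta^{(\tau)}(x,r)+\sigma'(r-t)\,\theta^{(\tau)}_t(x,r)\Big)dr,\quad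 0<t<\tau,\\ \theta^{(\tau)}(x,\tau)=0,\end{cases}$$ also extended by zero to $(\tau,T]$. Then $$(f,\varphi_n)_{L^2(-1,1)}=\frac{1}{\sigma(T)}\Big(-\sigma(0)\langle u,\theta^{(T)}\rangle_{H^1(0,T;L^2(\omega))}-\int_0^T\sigma'(T-\tau)\langle u,\theta^{(\tau)}\rangle_{H^1(0,T;L^2(\omega))}\,d\tau-\lambda_n\int_0^T\sigma(T-\tau)\langle u,\theta^{(\tau)}\rangle_{H^1(0,T;L^2(\omega))}\,d\tau\Big).$$
   Context: All functions are real-valued. For $0<s<1$, $(-\partial_x^2)^s u(x)=C_s\,\mathrm{P.V.}\int_{\mathbb{R}}\frac{u(x)-u(y)}{|x-y|^{1+2s}}\,dy$ with $C_s=\frac{s2^{2s}\Gamma((2s+1)/2)}{\pi^{1/2}\Gamma(1-s)}$. $H_0^s(-1,1)$ is the space of $u\in H^s(\mathbb{R})$ with $u=0$ a.e. in $\mathbb{R}\setminus(-1,1)$, and $H^{-s}(-1,1)$ is its dual with pivot space $L^2(-1,1)$. Set $\mathcal{F}(u,v)=\frac{C_s}{2}\int_{\mathbb{R}}\int_{\mathbb{R}}\frac{(u(x)-u(y))(v(x)-v(y))}{|x-y|^{1+2s}}\,dx\,dy$ for $u,v\in H_0^s(-1,1)$. The fractional Laplacian with homogeneous Dirichlet exterior condition is the selfadjoint operator in $L^2(-1,1)$ associated with $\mathcal{F}$; it has compact resolvent, eigenvalues $0<\lambda_1\le\lambda_2\le\cdots\to\infty$, and an orthonormal basis $\{\varphi_n\}$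 of $L^2(-1,1)$ of eigenfunctions: $(-\partial_x^2)^s\varphi_n=\lambda_n\varphi_n$ in $(-1,1)$, $\varphi_n=0$ in $\mathbb{R}\setminus(-1,1)$. A finite-energy solution of $\partial_t u+(-\partial_x^2)^su=F$, $u=0$ outside $(-1,1)$, with given initial datum in $L^2(-1,1)$, where $F\in L^2(0,T;H^{-s}(-1,1))$, is a function $u\in L^2(0,T;H_0^s(-1,1))$ with $u_t\in L^2(0,T;H^{-s}(-1,1))$ (hence $u\in C([0,T];L^2(-1,1))$) attaining the initial datum and satisfying $\int_0^T\langle u_t,w\rangle\,dt+\int_0^T\mathcal{F}(u,w)\,dt=\int_0^T\langle F,w\rangle\,dt$ for all $w\in L^2(0,T;H_0^s(-1,1))$, with $\langle\cdot,\cdot\rangle$ the $H^{-s}$–$H_0^s$ duality. Solutions of backward problems (with a datum at time $\tau$) are understood in the same sense after time reversal. For $F=f(x)\sigma(t)$ as in the claim and zero initial datum, one has $u_t\in L^2((-1,1)\times(0,T))$. $\langle v,\theta\rangle_{H^1(0,T;L^2(\omega))}=\int_0^T\int_\omega(v\theta+v_t\theta_t)\,dx\,dt$. $\sigma$ is identified with its continuous representative on $[0,T]$. $h^{(\tau)}$ is regarded as zero for $x\notin\omega$. Known fact: for $s\in(1/2,1)$ a null control $h^{(\tau)}$ exists for every datum in $L^2(-1,1)$ and every $\tau\in(0,T]$. *)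

theory Defs
  imports "HOL-Analysis.Analysis"
begin

text \<open>
  Elements of Lebesgue and Sobolev spaces are represented by Lebesgue measurable functions; no
  condition below distinguishes two representatives that agree almost everywhere.  A function of
  time and space is written \<open>u t x\<close>, the time argument first.
\<close>

abbreviation Dom :: "real set" where
  "Dom \<equiv> {-1<..<1}"


subsection \<open>Lebesgue and fractional Sobolev spaces\<close>

definition L2 :: "real set \<Rightarrow> (real \<Rightarrow> real) set" where
  "L2 X = {f. set_borel_measurable lebesgue X f \<and> set_integrable lebesgue X (\<lambda>x. (f x)\<^sup>2)}"

definition ip :: "(real \<Rightarrow> real) \<Rightarrow> (real \<Rightarrow> real) \<Rightarrow> real" where
  "ip f g = (LINT x:Dom|lebesgue. f x * g x)"

definition L2_norm :: "(real \<Rightarrow> real) \<Rightarrow> real" where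
  "L2_norm f = sqrt (ip f f)"

text \<open>For \<open>0 < s < 1\<close>, $H^s(\mathbb{R})$ with its Gagliardo norm.\<close>

definition gagliardo :: "real \<Rightarrow> (real \<Rightarrow> real) \<Rightarrow> (real \<Rightarrow> real) \<Rightarrow> real \<times> real \<Rightarrow> real" where
  "gagliardo s u v = (\<lambda>(x, y). (u x - u y) * (v x - v y) / \<bar>x - y\<bar> powr (1 + 2 * s))"

definition Hs :: "real \<Rightarrow> (real \<Rightarrow> real) set" where
  "Hs s = {u \<in> L2 UNIV. integrable lebesgue (gagliardo s u u)}"

definition Hs_norm :: "real \<Rightarrow> (real \<Rightarrow> real) \<Rightarrow> real" where
  "Hs_norm s u = sqrt ((LINT x|lebesgue. (u x)\<^sup>2) + (LINT p|lebesgue. gagliardo s u u p))"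

definition H0s :: "real \<Rightarrow> (real \<Rightarrow> real) set" where
  "H0s s = {u \<in> Hs s. AE x in lebesgue. x \<notin> Dom \<longrightarrow> u x = 0}"

definition C_frac :: "real \<Rightarrow> real" where
  "C_frac s = s * 2 powr (2 * s) * Gamma ((2 * s + 1) / 2) / (pi powr (1 / 2) * Gamma (1 - s))"

definition form :: "real \<Rightarrow> (real \<Rightarrow> real) \<Rightarrow> (real \<Rightarrow> real) \<Rightarrow> real" where
  "form s u v = C_frac s / 2 * (LINT p|lebesgue. gagliardo s u v p)"

text \<open>$H^{-s}(-1,1)$: bounded linear functionals on \<open>H0s s\<close>, compared only through their values
  on \<open>H0s s\<close>.\<close>

definition Hminus :: "real \<Rightarrow> ((real \<Rightarrow> real) \<Rightarrow> real) set" where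
  "Hminus s = {l.
     (\<forall>v\<in>H0s s. \<forall>w\<in>H0s s. l (\<lambda>x. v x + w x) = l v + l w) \<and>
     (\<forall>c. \<forall>v\<in>H0s s. l (\<lambda>x. c * v x) = c * l v) \<and>
     (\<exists>C. \<forall>v\<in>H0s s. \<bar>l v\<bar> \<le> C * Hs_norm s v)}"

definition Hminus_norm :: "real \<Rightarrow> ((real \<Rightarrow> real) \<Rightarrow> real) \<Rightarrow> real" where
  "Hminus_norm s l = (SUP v\<in>{v \<in> H0s s. Hs_norm s v \<le> 1}. \<bar>l v\<bar>)"

text \<open>The embedding of $L^2(-1,1)$ into $H^{-s}(-1,1)$ given by the pivot space.\<close>

definition pivot :: "(real \<Rightarrow> real) \<Rightarrow> (real \<Rightarrow> real) \<Rightarrow> real" where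
  "pivot g = (\<lambda>w. ip g w)"

text \<open>\<open>frac_lap s u g\<close>: \<open>u\<close> is in the domain of the selfadjoint operator in $L^2(-1,1)$
  associated with \<open>form s\<close>, and is mapped to \<open>g\<close>.\<close>

definition frac_lap :: "real \<Rightarrow> (real \<Rightarrow> real) \<Rightarrow> (real \<Rightarrow> real) \<Rightarrow> bool" where
  "frac_lap s u g \<longleftrightarrow> u \<in> H0s s \<and> g \<in> L2 Dom \<and> (\<forall>v\<in>H0s s. form s u v = ip g v)"

definition eigensystem :: "real \<Rightarrow> (nat \<Rightarrow> real) \<Rightarrow> (nat \<Rightarrow> real \<Rightarrow> real) \<Rightarrow> bool" where
  "eigensystem s lam \<phi> \<longleftrightarrow>
     incseq lam \<and>
     (\<forall>k. frac_lap s (\<phi> k) (\<lambda>x. lam k * \<phi> k x)) \<and>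
     (\<forall>j k. ip (\<phi> j) (\<phi> k) = (if j = k then 1 else 0)) \<and>
     (\<forall>g\<in>L2 Dom. (\<lambda>N. L2_norm (\<lambda>x. g x - (\<Sum>k<N. ip g (\<phi> k) * \<phi> k x))) \<longlonglongrightarrow> 0)"


subsection \<open>Weak derivatives in time\<close>

text \<open>Test functions are of class $C^1$ with compact support in \<open>(0,T)\<close>; they determine the same weak
  derivatives as $C_c^\infty(0,T)$.\<close>

definition test_fun :: "real \<Rightarrow> (real \<Rightarrow> real) \<Rightarrow> bool" where
  "test_fun T \<psi> \<longleftrightarrow> (\<forall>t. \<psi> differentiable at t) \<and> continuous_on UNIV (deriv \<psi>) \<and>
     (\<exists>a b. 0 < a \<and> b < T \<and> (\<forall>t. t \<notin> {a..b} \<longrightarrow> \<psi> t = 0))"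

definition weak_deriv :: "real \<Rightarrow> (real \<Rightarrow> real) \<Rightarrow> (real \<Rightarrow> real) \<Rightarrow> bool" where
  "weak_deriv T a b \<longleftrightarrow> (\<forall>\<psi>. test_fun T \<psi> \<longrightarrow>
     (LINT t:{0<..<T}|lebesgue. a t * deriv \<psi> t) = - (LINT t:{0<..<T}|lebesgue. b t * \<psi> t))"

definition Linf :: "real \<Rightarrow> (real \<Rightarrow> real) set" where
  "Linf T = {d. set_borel_measurable lebesgue {0<..<T} d \<and>
     (\<exists>C. AE t in lebesgue. t \<in> {0<..<T} \<longrightarrow> \<bar>d t\<bar> \<le> C)}"

text \<open>$W^{1,\infty}(0,T)$, each element being given by its continuous representative on \<open>[0,T]\<close>.\<close>

definition W1inf :: "real \<Rightarrow> (real \<Rightarrow> real) set" where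
  "W1inf T = {\<sigma>. continuous_on {0..T} \<sigma> \<and> (\<exists>d\<in>Linf T. weak_deriv T \<sigma> d)}"

definition wderiv :: "real \<Rightarrow> (real \<Rightarrow> real) \<Rightarrow> real \<Rightarrow> real" where
  "wderiv T \<sigma> = (SOME d. d \<in> Linf T \<and> weak_deriv T \<sigma> d)"


subsection \<open>Spaces of functions of time\<close>

text \<open>\<open>L2Q T X\<close> is $L^2(0,T;L^2(X))$, as $L^2((0,T)\times X)$.\<close>

definition L2Q :: "real \<Rightarrow> real set \<Rightarrow> (real \<Rightarrow> real \<Rightarrow> real) set" where
  "L2Q T X = {u. set_borel_measurable lebesgue ({0<..<T} \<times> X) (\<lambda>(t, x). u t x) \<and>
     set_integrable lebesgue ({0<..<T} \<times> X) (\<lambda>(t, x). (u t x)\<^sup>2)}"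

text \<open>An equality of Bochner integrals in $L^2$ (or, in \<open>Hminus_deriv\<close>, in $H^{-s}$) is expressed by
  pairing both sides with every element of $L^2$ (of $H_0^s$).\<close>

definition L2_deriv :: "real \<Rightarrow> (real \<Rightarrow> real \<Rightarrow> real) \<Rightarrow> (real \<Rightarrow> real \<Rightarrow> real) \<Rightarrow> bool" where
  "L2_deriv T u g \<longleftrightarrow> g \<in> L2Q T Dom \<and>
     (\<forall>v\<in>L2 Dom. weak_deriv T (\<lambda>t. ip (u t) v) (\<lambda>t. ip (g t) v))"

text \<open>$H^1(0,T;L^2(-1,1))$, and the time derivative, which is unique up to null sets.\<close>

definition H1L2 :: "real \<Rightarrow> (real \<Rightarrow> real \<Rightarrow> real) set" where
  "H1L2 T = {u \<in> L2Q T Dom. \<exists>g. L2_deriv T u g}"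

definition dt :: "real \<Rightarrow> (real \<Rightarrow> real \<Rightarrow> real) \<Rightarrow> real \<Rightarrow> real \<Rightarrow> real" where
  "dt T u = (SOME g. L2_deriv T u g)"

definition H1_pairing ::
  "real \<Rightarrow> real set \<Rightarrow> (real \<Rightarrow> real \<Rightarrow> real) \<Rightarrow> (real \<Rightarrow> real \<Rightarrow> real) \<Rightarrow> real" where
  "H1_pairing T \<omega> v \<theta> = (LINT t:{0<..<T}|lebesgue. (LINT x:\<omega>|lebesgue.
     v t x * \<theta> t x + dt T v t x * dt T \<theta> t x))"

text \<open>\<open>L2_value_at T u a v\<close>: \<open>u\<close> has a representative \<open>U\<close> in $C([0,T];L^2(-1,1))$, and
  \<open>U a = v\<close> in $L^2(-1,1)$.\<close>

definition L2_value_at :: "real \<Rightarrow> (real \<Rightarrow> real \<Rightarrow> real) \<Rightarrow> real \<Rightarrow> (real \<Rightarrow> real) \<Rightarrow> bool" where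
  "L2_value_at T u a v \<longleftrightarrow> (\<exists>U.
     (\<forall>t\<in>{0..T}. U t \<in> L2 Dom) \<and>
     (\<forall>t\<in>{0..T}. ((\<lambda>r. L2_norm (\<lambda>x. U r x - U t x)) \<longlongrightarrow> 0) (at t within {0..T})) \<and>
     (AE t in lebesgue. t \<in> {0<..<T} \<longrightarrow> (AE x in lebesgue. x \<in> Dom \<longrightarrow> U t x = u t x)) \<and>
     (AE x in lebesgue. x \<in> Dom \<longrightarrow> U a x = v x))"

text \<open>$L^2(0,T;H_0^s(-1,1))$ and $L^2(0,T;H^{-s}(-1,1))$.  Both spaces of values are separable
  Hilbert spaces, so joint measurability in the first case and weak-* measurability in the second
  amount to strong measurability.\<close>

definition L2H0s :: "real \<Rightarrow> real \<Rightarrow> (real \<Rightarrow> real \<Rightarrow> real) set" where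
  "L2H0s T s = {u. set_borel_measurable lebesgue ({0<..<T} \<times> UNIV) (\<lambda>(t, x). u t x) \<and>
     (AE t in lebesgue. t \<in> {0<..<T} \<longrightarrow> u t \<in> H0s s) \<and>
     set_integrable lebesgue {0<..<T} (\<lambda>t. (Hs_norm s (u t))\<^sup>2)}"

definition L2Hminus :: "real \<Rightarrow> real \<Rightarrow> (real \<Rightarrow> (real \<Rightarrow> real) \<Rightarrow> real) set" where
  "L2Hminus T s = {G. (\<forall>v\<in>H0s s. set_borel_measurable lebesgue {0<..<T} (\<lambda>t. G t v)) \<and>
     (AE t in lebesgue. t \<in> {0<..<T} \<longrightarrow> G t \<in> Hminus s) \<and>
     set_integrable lebesgue {0<..<T} (\<lambda>t. (Hminus_norm s (G t))\<^sup>2)}"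

definition Hminus_deriv ::
  "real \<Rightarrow> real \<Rightarrow> (real \<Rightarrow> real \<Rightarrow> real) \<Rightarrow> (real \<Rightarrow> (real \<Rightarrow> real) \<Rightarrow> real) \<Rightarrow> bool" where
  "Hminus_deriv T s u G \<longleftrightarrow> G \<in> L2Hminus T s \<and>
     (\<forall>v\<in>H0s s. weak_deriv T (\<lambda>t. pivot (u t) v) (\<lambda>t. G t v))"


subsection \<open>Solutions\<close>

definition finite_energy_solution ::
  "real \<Rightarrow> real \<Rightarrow> (real \<Rightarrow> real \<Rightarrow> real) \<Rightarrow> (real \<Rightarrow> (real \<Rightarrow> real) \<Rightarrow> real) \<Rightarrow> (real \<Rightarrow> real) \<Rightarrow> bool"
where
  "finite_energy_solution T s u F u0 \<longleftrightarrow>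
     F \<in> L2Hminus T s \<and>
     u \<in> L2H0s T s \<and>
     (\<exists>G. Hminus_deriv T s u G \<and>
        (\<forall>w\<in>L2H0s T s.
           (LINT t:{0<..<T}|lebesgue. G t (w t)) + (LINT t:{0<..<T}|lebesgue. form s (u t) (w t))
             = (LINT t:{0<..<T}|lebesgue. F t (w t)))) \<and>
     L2_value_at T u 0 u0"

definition backward_solution ::
  "real \<Rightarrow> real \<Rightarrow> (real \<Rightarrow> real \<Rightarrow> real) \<Rightarrow> (real \<Rightarrow> (real \<Rightarrow> real) \<Rightarrow> real) \<Rightarrow> (real \<Rightarrow> real) \<Rightarrow> bool"
where
  "backward_solution \<tau> s p F p0 \<longleftrightarrow>
     finite_energy_solution \<tau> s (\<lambda>t. p (\<tau> - t)) (\<lambda>t. F (\<tau> - t)) p0"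

text \<open>Extension by zero of a function on \<open>\<omega>\<close>, respectively of a function on \<open>(0,\<tau>)\<close>.\<close>

definition zero_outside :: "real set \<Rightarrow> (real \<Rightarrow> real \<Rightarrow> real) \<Rightarrow> real \<Rightarrow> real \<Rightarrow> real" where
  "zero_outside \<omega> h = (\<lambda>t x. if x \<in> \<omega> then h t x else 0)"

definition zero_after :: "real \<Rightarrow> (real \<Rightarrow> real \<Rightarrow> real) \<Rightarrow> real \<Rightarrow> real \<Rightarrow> real" where
  "zero_after \<tau> g = (\<lambda>t x. if t \<le> \<tau> then g t x else 0)"

definition null_control ::
  "real \<Rightarrow> real \<Rightarrow> real set \<Rightarrow> (real \<Rightarrow> real) \<Rightarrow> (real \<Rightarrow> real \<Rightarrow> real) \<Rightarrow> bool" where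
  "null_control \<tau> s \<omega> p0 h \<longleftrightarrow> h \<in> L2Q \<tau> \<omega> \<and>
     (\<exists>p. backward_solution \<tau> s p (\<lambda>t. pivot (zero_outside \<omega> h t)) p0 \<and>
          L2_value_at \<tau> p 0 (\<lambda>x. 0))"

definition volterra_solution ::
  "real \<Rightarrow> (real \<Rightarrow> real) \<Rightarrow> (real \<Rightarrow> real) \<Rightarrow> (real \<Rightarrow> real \<Rightarrow> real) \<Rightarrow> (real \<Rightarrow> real \<Rightarrow> real) \<Rightarrow> bool"
where
  "volterra_solution \<tau> \<sigma> \<sigma>' h \<theta> \<longleftrightarrow> \<theta> \<in> H1L2 \<tau> \<and>
     (AE t in lebesgue. t \<in> {0<..<\<tau>} \<longrightarrow> (AE x in lebesgue. x \<in> Dom \<longrightarrow>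
        h t x = \<sigma> 0 * dt \<tau> \<theta> t x +
          (LINT r:{t<..<\<tau>}|lebesgue. \<sigma> (r - t) * \<theta> r x + \<sigma>' (r - t) * dt \<tau> \<theta> r x))) \<and>
     L2_value_at \<tau> \<theta> \<tau> (\<lambda>x. 0)"

end

theory Submission
  imports Defs
begin


text \<open>
  Let $f_k$ and $u_k(t)$ be the coefficients of \<open>f\<close> and \<open>u t\<close> in the eigenbasis.  Testing the equation
  with $\psi(t)\varphi_k(x)$ gives $u_k' = -\lambda_k u_k + f_k\sigma$ with $u_k(0)=0$
  (\<open>finite_energy_modes\<close>), hence $u_k = f_k R_k$ and $u_k' = f_k R_k'$ with
  $R_k(t)=\int_0^t e^{-\lambda_k r}\sigma(t-r)\,dr$ and
  $R_k'(t)=\sigma(0)e^{-\lambda_k t}+\int_0^t e^{-\lambda_k r}\sigma'(t-r)\,dr$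
  (\<open>forward_modes\<close>, \<open>rate_eq\<close>, \<open>dt_u_modes\<close>).  In other words \<open>u\<close> is the convolution in time of
  \<open>\<sigma>\<close> with the free evolution $q$ of the initial datum \<open>f\<close>; since only the coefficients
  $f_k e^{-\lambda_k t}$ of $q$ enter, $q$ itself is never constructed.

  The controlled backward solution satisfies the same modal equations.  As it starts from $\varphi_n$
  at time $\tau$ and vanishes at time $0$, solving them yields the moments of the control
  (\<open>null_control_moments\<close>):
  $\int_0^\tau e^{-\lambda_k t}(h^{(\tau)}(t),\varphi_k)\,dt$ equals $-e^{-\lambda_n\tau}$ for $k=n$ and
  $0$ otherwise.

  The operator in the Volterra equation is the adjoint of the map $q\mapsto u=\sigma*q$ from $L^2$ to
  $H^1$ in time.  Exchanging the order of integration over the triangle $0<r<t<\tau$ therefore turns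
  the pairing of \<open>u\<close> with $\theta^{(\tau)}$ into the pairing of $q$ with $h^{(\tau)}$, mode by mode
  (\<open>convolution_Fubini\<close>, \<open>Volterra_moment\<close>), and Parseval's identity sums the modes:
  the pairing equals $\sum_k f_k\int_0^\tau e^{-\lambda_k t}(h^{(\tau)},\varphi_k)\,dt=-f_n e^{-\lambda_n\tau}$
  (\<open>pairing_value\<close>).  The right-hand side of the formula thus becomes
  $f_n\,(R_n'(T)+\lambda_n R_n(T))/\sigma(T)$, which is $f_n$ by the differential equation for $R_n$.

  Two points of analysis lie behind this computation.  The time derivative of \<open>u\<close> has to be a function:
  since $\lambda_k\ge 0$, the $R_k'$ are bounded uniformly in $k$, and the series
  $\sum_k f_k R_k'(t)\varphi_k(x)$ converges in $L^2((0,T)\times(-1,1))$ by the Riesz--Fischer theorem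
  (\<open>mode_series\<close>, \<open>time_derivative_exists\<close>).  And the weak derivatives must be identified: weak
  derivatives are unique, a continuous function with an integrable weak derivative is its primitive
  (\<open>weak_deriv_primitive\<close>), and extending $\theta^{(\tau)}$ by zero creates no jump because it
  vanishes at time $\tau$ (\<open>zero_after_derivative\<close>).
\<close>

section \<open>Lebesgue integration on the line and in the plane\<close>

text \<open>
  Because Lebesgue measure is complete, measurability transfers along equality almost everywhere.
\<close>

lemma lebesgue_cong_AE:
  fixes f g :: "'a::euclidean_space \<Rightarrow> real"
  assumes "AE x in lebesgue. f x = g x"
  shows "f \<in> borel_measurable lebesgue \<longleftrightarrow> g \<in> borel_measurable lebesgue"
    and "integrable lebesgue f \<longleftrightarrow> integrable lebesgue g"
    and "integral\<^sup>L lebesgue f = integral\<^sup>L lebesgue g"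
proof -
  have sym: "AE x in lebesgue. g x = f x" using assms by (auto elim: AE_mp)
  show m: "f \<in> borel_measurable lebesgue \<longleftrightarrow> g \<in> borel_measurable lebesgue"
    using borel_measurable_AE[OF _ assms] borel_measurable_AE[OF _ sym] by blast
  show "integrable lebesgue f \<longleftrightarrow> integrable lebesgue g"
    using m assms by (metis borel_measurable_integrable integrable_cong_AE)
  show "integral\<^sup>L lebesgue f = integral\<^sup>L lebesgue g"
    using m assms by (metis borel_measurable_integrable integral_cong_AE not_integrable_integral_eq)
qed

lemma set_lebesgue_cong_AE:
  fixes f g :: "'a::euclidean_space \<Rightarrow> real"
  assumes "AE x in lebesgue. x \<in> A \<longrightarrow> f x = g x"
  shows "set_borel_measurable lebesgue A f \<longleftrightarrow> set_borel_measurable lebesgue A g"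
    and "set_integrable lebesgue A f \<longleftrightarrow> set_integrable lebesgue A g"
    and "(LINT x:A|lebesgue. f x) = (LINT x:A|lebesgue. g x)"
proof -
  have *: "AE x in lebesgue. indicator A x *\<^sub>R f x = indicator A x *\<^sub>R g x"
    using assms by (auto elim!: eventually_mono simp: indicator_def)
  show "set_borel_measurable lebesgue A f \<longleftrightarrow> set_borel_measurable lebesgue A g"
     "set_integrable lebesgue A f \<longleftrightarrow> set_integrable lebesgue A g"
     "(LINT x:A|lebesgue. f x) = (LINT x:A|lebesgue. g x)"
    unfolding set_borel_measurable_def set_integrable_def set_lebesgue_integral_def
    using lebesgue_cong_AE[OF *] by auto
qed

lemma set_LINT_sum:
  fixes f :: "'i \<Rightarrow> 'a \<Rightarrow> real"
  assumes "\<And>k. k \<in> I \<Longrightarrow> set_integrable M A (f k)"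
  shows "(LINT x:A|M. \<Sum>k\<in>I. f k x) = (\<Sum>k\<in>I. LINT x:A|M. f k x)"
  unfolding set_lebesgue_integral_def scaleR_sum_right
  by (rule Bochner_Integration.integral_sum) (use assms in \<open>simp add: set_integrable_def\<close>)

text \<open>
  Lebesgue measure on the plane is the completion of a product measure, not itself a product.  Null sets,
  measurability and Fubini's theorem are therefore carried over from \<open>lborel\<close> in this and the
  following lemmas, by passing to Borel representatives.
\<close>

lemma AE_lebesgue_fst:
  assumes "AE x in lebesgue. P (x::real)"
  shows "AE p in lebesgue. P (fst (p::real\<times>real))"
proof -
  from assms have "AE x in lborel. P x" by (simp add: AE_completion_iff)
  then obtain N where N: "{x\<in>space lborel. \<not> P x} \<subseteq> N" "emeasure lborel N = 0" "N \<in> sets lborel"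
    by (rule AE_E)
  have "emeasure (lborel \<Otimes>\<^sub>M lborel) (N \<times> (UNIV::real set)) = emeasure lborel N * emeasure lborel (UNIV::real set)"
    using N by (intro lborel.emeasure_pair_measure_Times) auto
  then have "emeasure (lborel :: (real\<times>real) measure) (N \<times> UNIV) = 0" using N by (simp add: lborel_prod)
  moreover have "N \<times> (UNIV::real set) \<in> sets (lborel :: (real\<times>real) measure)"
    using N by (subst lborel_prod[symmetric]) auto
  ultimately have "N \<times> (UNIV::real set) \<in> null_sets (lborel :: (real\<times>real) measure)" by auto
  then have "AE p in (lborel :: (real\<times>real) measure). p \<notin> N \<times> UNIV" by (rule AE_not_in)
  then have "AE p in (lborel :: (real\<times>real) measure). P (fst p)" using N(1) by (auto elim!: eventually_mono)
  then show ?thesis by (rule AE_completion)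
qed

lemma AE_lebesgue_swap:
  assumes "AE p in lebesgue. P (p::real\<times>real)"
  shows "AE p in lebesgue. P (snd p, fst p)"
proof -
  from assms have "AE p in (lborel \<Otimes>\<^sub>M lborel). P p" unfolding lborel_prod by (simp add: AE_completion_iff)
  then obtain N where N: "{x\<in>space (lborel \<Otimes>\<^sub>M lborel). \<not> P x} \<subseteq> N" "emeasure (lborel \<Otimes>\<^sub>M lborel) N = 0" "N \<in> sets (lborel \<Otimes>\<^sub>M lborel)"
    by (rule AE_E)
  then have "AE p in (lborel \<Otimes>\<^sub>M lborel). p \<notin> N" by (intro AE_not_in) auto
  then have "AE p in distr (lborel \<Otimes>\<^sub>M lborel) (lborel \<Otimes>\<^sub>M lborel) (\<lambda>(x, y). (y, x)). p \<notin> N"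
    using lborel_pair.distr_pair_swap[where 'a=real and 'b=real] by metis
  then have "AE p in (lborel \<Otimes>\<^sub>M lborel). (case p of (x, y) \<Rightarrow> (y, x)) \<notin> N"
    by (subst (asm) AE_distr_iff) (use sets.compl_sets[OF N(3)] in \<open>auto simp: set_diff_eq\<close>)
  then have "AE p in (lborel \<Otimes>\<^sub>M lborel). P (snd p, fst p)" using N(1)
    by (auto elim!: eventually_mono simp: space_pair_measure)
  then show ?thesis using AE_completion by (metis lborel_prod)
qed

lemma AE_lebesgue_snd:
  assumes "AE x in lebesgue. P (x::real)"
  shows "AE p in lebesgue. P (snd (p::real\<times>real))"
  using AE_lebesgue_swap[OF AE_lebesgue_fst[OF assms]] by simp

lemma AE_lebesgue_sections:
  assumes "AE p in lebesgue. P (p::real\<times>real)"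
  shows "AE x in lebesgue. AE y in lebesgue. P (x, y)"
proof -
  from assms have "AE p in (lborel \<Otimes>\<^sub>M lborel). P p" unfolding lborel_prod by (simp add: AE_completion_iff)
  then have "AE x in lborel. AE y in lborel. P (x, y)" by (rule lborel_pair.AE_pair)
  then show ?thesis by (simp add: AE_completion_iff)
qed

lemma borel_measurable_product_maps:
  shows "(\<lambda>p::real\<times>real. fst p) \<in> borel_measurable borel"
    and "(\<lambda>p::real\<times>real. snd p) \<in> borel_measurable borel"
    and "(\<lambda>p::real\<times>real. (snd p, fst p)) \<in> borel_measurable borel"
    and "(\<lambda>y::real. (x::real, y)) \<in> borel_measurable borel"
  by (intro borel_measurable_continuous_onI continuous_intros)+

lemma lebesgue_measurable_fst:
  fixes f :: "real \<Rightarrow> real"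
  assumes "f \<in> borel_measurable lebesgue"
  shows "(\<lambda>p::real\<times>real. f (fst p)) \<in> borel_measurable lebesgue"
proof -
  obtain g where g: "g \<in> borel_measurable lborel" "AE x in lborel. f x = g x"
    using completion_ex_borel_measurable_real[OF assms] by auto
  have m: "(\<lambda>p::real\<times>real. g (fst p)) \<in> borel_measurable lebesgue"
    by (rule measurable_completion[OF measurable_compose[OF _ g(1)]]) (simp add: borel_measurable_product_maps)
  have "AE p in lebesgue. f (fst p) = g (fst (p::real\<times>real))"
    by (rule AE_lebesgue_fst) (rule AE_completion[OF g(2)])
  from lebesgue_cong_AE(1)[OF this] m show ?thesis by blast
qed

lemma lebesgue_measurable_snd:
  fixes f :: "real \<Rightarrow> real"
  assumes "f \<in> borel_measurable lebesgue"
  shows "(\<lambda>p::real\<times>real. f (snd p)) \<in> borel_measurable lebesgue"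
proof -
  obtain g where g: "g \<in> borel_measurable lborel" "AE x in lborel. f x = g x"
    using completion_ex_borel_measurable_real[OF assms] by auto
  have m: "(\<lambda>p::real\<times>real. g (snd p)) \<in> borel_measurable lebesgue"
    by (rule measurable_completion[OF measurable_compose[OF _ g(1)]]) (simp add: borel_measurable_product_maps)
  have "AE p in lebesgue. f (snd p) = g (snd (p::real\<times>real))"
    by (rule AE_lebesgue_snd) (rule AE_completion[OF g(2)])
  from lebesgue_cong_AE(1)[OF this] m show ?thesis by blast
qed

lemma lebesgue_section_measurable:
  fixes f :: "real\<times>real \<Rightarrow> real"
  assumes "f \<in> borel_measurable lebesgue"
  shows "AE x in lebesgue. (\<lambda>y. f (x, y)) \<in> borel_measurable lebesgue"
proof -
  obtain g where g: "g \<in> borel_measurable lborel" "AE p in lborel. f p = g p"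
    using completion_ex_borel_measurable_real[OF assms] by auto
  have gm: "(\<lambda>y. g (x, y)) \<in> borel_measurable lebesgue" for x
    by (rule measurable_completion[OF measurable_compose[OF _ g(1)]]) (simp add: borel_measurable_product_maps)
  have "AE x in lebesgue. AE y in lebesgue. f (x, y) = g (x, y)"
    using AE_completion[OF g(2)] by (rule AE_lebesgue_sections)
  then show ?thesis
  proof (rule eventually_mono)
    fix x assume "AE y in lebesgue. f (x, y) = g (x, y)"
    from lebesgue_cong_AE(1)[OF this] gm show "(\<lambda>y. f (x, y)) \<in> borel_measurable lebesgue" by blast
  qed
qed

text \<open>
  A Borel representative agrees with \<open>f\<close> on almost every vertical line almost everywhere, so Fubini's
  theorem for \<open>lborel\<close> applies to it and all three conclusions pass back to \<open>f\<close>.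
\<close>

lemma lebesgue_Fubini:
  fixes f :: "real\<times>real \<Rightarrow> real"
  assumes "integrable lebesgue f"
  shows "AE x in lebesgue. integrable lebesgue (\<lambda>y. f (x, y))"
    and "integrable lebesgue (\<lambda>x. LINT y|lebesgue. f (x, y))"
    and "(LINT x|lebesgue. LINT y|lebesgue. f (x, y)) = integral\<^sup>L lebesgue f"
proof -
  obtain g where g: "g \<in> borel_measurable lborel" "AE p in lborel. f p = g p"
    using completion_ex_borel_measurable_real[OF borel_measurable_integrable[OF assms]] by auto
  have fg: "AE p in lebesgue. f p = g p" using g(2) by (rule AE_completion)
  have gi: "integrable (lborel \<Otimes>\<^sub>M lborel) g"
    using assms lebesgue_cong_AE(2)[OF fg] g(1) by (simp add: integrable_completion lborel_prod)
  have gm: "(\<lambda>y. g (x, y)) \<in> borel_measurable lborel" for x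
    by (rule measurable_compose[OF _ g(1)]) (simp add: borel_measurable_product_maps)
  have gM: "(\<lambda>x. LINT y|lborel. g (x, y)) \<in> borel_measurable lborel"
    using borel_measurable_integrable[OF lborel_pair.integrable_fst'[OF gi]] .
  have sec: "AE x in lebesgue. AE y in lebesgue. f (x, y) = g (x, y)" using fg by (rule AE_lebesgue_sections)
  have "AE x in lborel. integrable lborel (\<lambda>y. g (x, y))" by (rule lborel_pair.AE_integrable_fst'[OF gi])
  then have "AE x in lebesgue. integrable lborel (\<lambda>y. g (x, y))" by (rule AE_completion)
  with sec show "AE x in lebesgue. integrable lebesgue (\<lambda>y. f (x, y))"
  proof eventually_elim
    case (elim x)
    then show ?case using lebesgue_cong_AE(2)[OF elim(1)] integrable_completion[OF gm] by blast
  qed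
  have in_eq: "AE x in lebesgue. (LINT y|lebesgue. f (x, y)) = (LINT y|lborel. g (x, y))"
    using sec
  proof eventually_elim
    case (elim x)
    then show ?case using lebesgue_cong_AE(3)[OF elim] integral_completion[OF gm] by simp
  qed
  have "integrable lborel (\<lambda>x. LINT y|lborel. g (x, y))" by (rule lborel_pair.integrable_fst'[OF gi])
  then show "integrable lebesgue (\<lambda>x. LINT y|lebesgue. f (x, y))"
    using lebesgue_cong_AE(2)[OF in_eq] by (simp add: integrable_completion gM)
  have "(LINT x|lebesgue. LINT y|lebesgue. f (x, y)) = (LINT x|lborel. LINT y|lborel. g (x, y))"
    using lebesgue_cong_AE(3)[OF in_eq] using integral_completion[OF gM] by simp
  also have "\<dots> = integral\<^sup>L lborel g" using lborel_pair.integral_fst'[OF gi] by (simp add: lborel_prod)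
  also have "\<dots> = integral\<^sup>L lebesgue f" using lebesgue_cong_AE(3)[OF fg] g(1) by (simp add: integral_completion)
  finally show "(LINT x|lebesgue. LINT y|lebesgue. f (x, y)) = integral\<^sup>L lebesgue f" .
qed

lemma lebesgue_integrable_swap:
  fixes f :: "real\<times>real \<Rightarrow> real"
  assumes "integrable lebesgue f"
  shows "integrable lebesgue (\<lambda>p. f (snd p, fst p))"
    and "(LINT p|lebesgue. f (snd p, fst p)) = integral\<^sup>L lebesgue f"
proof -
  obtain g where g: "g \<in> borel_measurable lborel" "AE p in lborel. f p = g p"
    using completion_ex_borel_measurable_real[OF borel_measurable_integrable[OF assms]] by auto
  have fg: "AE p in lebesgue. f p = g p" using g(2) by (rule AE_completion)
  have fgs: "AE p in lebesgue. f (snd p, fst p) = g (snd p, fst p)" using AE_lebesgue_swap[OF fg] .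
  have gi: "integrable (lborel \<Otimes>\<^sub>M lborel) g"
    using assms lebesgue_cong_AE(2)[OF fg] g(1) by (simp add: integrable_completion lborel_prod)
  have gs: "(\<lambda>p. g (snd p, fst p)) \<in> borel_measurable lborel"
    by (rule measurable_compose[OF _ g(1)]) (simp add: borel_measurable_product_maps)
  have "integrable lborel (\<lambda>p. g (snd p, fst p))"
    using lborel_pair.integrable_product_swap[OF gi] by (simp add: lborel_prod split_beta')
  then show "integrable lebesgue (\<lambda>p. f (snd p, fst p))"
    using lebesgue_cong_AE(2)[OF fgs] gs by (simp add: integrable_completion)
  have "(LINT p|lborel. g (snd p, fst p)) = integral\<^sup>L lborel g"
    using lborel_pair.integral_product_swap[of g] g(1) by (simp add: lborel_prod split_beta')
  then show "(LINT p|lebesgue. f (snd p, fst p)) = integral\<^sup>L lebesgue f"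
    using lebesgue_cong_AE(3)[OF fgs] lebesgue_cong_AE(3)[OF fg] g(1) gs
    by (simp add: integral_completion)
qed

lemma lebesgue_Fubini_swap:
  fixes f :: "real\<times>real \<Rightarrow> real"
  assumes "integrable lebesgue f"
  shows "AE y in lebesgue. integrable lebesgue (\<lambda>x. f (x, y))"
    and "integrable lebesgue (\<lambda>y. LINT x|lebesgue. f (x, y))"
    and "(LINT y|lebesgue. LINT x|lebesgue. f (x, y)) = integral\<^sup>L lebesgue f"
  using lebesgue_Fubini[OF lebesgue_integrable_swap(1)[OF assms]] lebesgue_integrable_swap(2)[OF assms]
  by auto

lemma lebesgue_integrable_tensor:
  fixes f g :: "real \<Rightarrow> real"
  assumes f: "integrable lebesgue f" and g: "integrable lebesgue g"
  shows "integrable lebesgue (\<lambda>p. f (fst p) * g (snd p))"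
proof -
  obtain f' where f': "f' \<in> borel_measurable lborel" "AE x in lborel. f x = f' x"
    using completion_ex_borel_measurable_real[OF borel_measurable_integrable[OF f]] by auto
  obtain g' where g': "g' \<in> borel_measurable lborel" "AE x in lborel. g x = g' x"
    using completion_ex_borel_measurable_real[OF borel_measurable_integrable[OF g]] by auto
  have fi: "integrable lborel f'"
    using f lebesgue_cong_AE(2)[OF AE_completion[OF f'(2)]] f'(1) by (simp add: integrable_completion)
  have gi: "integrable lborel g'"
    using g lebesgue_cong_AE(2)[OF AE_completion[OF g'(2)]] g'(1) by (simp add: integrable_completion)
  have m: "(\<lambda>p. f' (fst p) * g' (snd p)) \<in> borel_measurable lborel"
    using measurable_compose[OF borel_measurable_product_maps(1), of f' borel]
      measurable_compose[OF borel_measurable_product_maps(2), of g' borel] f'(1) g'(1) by simp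
  have "integrable (lborel \<Otimes>\<^sub>M lborel) (\<lambda>p. f' (fst p) * g' (snd p))"
  proof (rule lborel_pair.Fubini_integrable)
    show "(\<lambda>p. f' (fst p) * g' (snd p)) \<in> borel_measurable (lborel \<Otimes>\<^sub>M lborel)" using m by (simp add: lborel_prod)
    show "integrable lborel (\<lambda>x. LINT y|lborel. norm (f' (fst (x, y)) * g' (snd (x, y))))"
      using fi by (simp add: abs_mult)
    show "AE x in lborel. integrable lborel (\<lambda>y. f' (fst (x, y)) * g' (snd (x, y)))"
      using gi by simp
  qed
  then have i: "integrable lebesgue (\<lambda>p. f' (fst p) * g' (snd p))"
    using m by (simp add: lborel_prod integrable_completion)
  have "AE p in lebesgue. f (fst p) * g (snd p) = f' (fst p) * g' (snd (p::real\<times>real))"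
    using AE_lebesgue_fst[OF AE_completion[OF f'(2)]] AE_lebesgue_snd[OF AE_completion[OF g'(2)]] by eventually_elim simp
  from lebesgue_cong_AE(2)[OF this] i show ?thesis by blast
qed

section \<open>Square-integrable functions\<close>

lemma abs_mult_le_squares: "\<bar>a * b\<bar> \<le> a\<^sup>2 + (b::real)\<^sup>2"
proof -
  have "0 \<le> (\<bar>a\<bar> - \<bar>b\<bar>)\<^sup>2" by simp
  then have "2 * (\<bar>a\<bar> * \<bar>b\<bar>) \<le> a\<^sup>2 + b\<^sup>2" by (simp add: power2_eq_square algebra_simps)
  moreover have "0 \<le> \<bar>a\<bar> * \<bar>b\<bar>" by simp
  ultimately show ?thesis unfolding abs_mult by linarith
qed

lemma integrable_mult_of_squares:
  fixes f g :: "'a \<Rightarrow> real"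
  assumes [measurable]: "f \<in> borel_measurable M" "g \<in> borel_measurable M"
    and "integrable M (\<lambda>x. (f x)\<^sup>2)" "integrable M (\<lambda>x. (g x)\<^sup>2)"
  shows "integrable M (\<lambda>x. f x * g x)"
proof (rule Bochner_Integration.integrable_bound)
  show "integrable M (\<lambda>x. (f x)\<^sup>2 + (g x)\<^sup>2)" using assms by auto
  show "AE x in M. norm (f x * g x) \<le> norm ((f x)\<^sup>2 + (g x)\<^sup>2)"
    using abs_mult_le_squares by (auto intro!: AE_I2)
qed simp

text \<open>
  The quadratic polynomial $k\mapsto\int(f+kg)^2$ is nonnegative, so its discriminant is not
  positive.
\<close>

lemma integral_Cauchy_Schwarz:
  fixes f g :: "'a \<Rightarrow> real"
  assumes f: "f \<in> borel_measurable M" and g: "g \<in> borel_measurable M"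
    and f2: "integrable M (\<lambda>x. (f x)\<^sup>2)" and g2: "integrable M (\<lambda>x. (g x)\<^sup>2)"
  shows "(LINT x|M. f x * g x)\<^sup>2 \<le> (LINT x|M. (f x)\<^sup>2) * (LINT x|M. (g x)\<^sup>2)"
proof -
  define a b c where "a = (LINT x|M. (f x)\<^sup>2)" and "b = (LINT x|M. f x * g x)" and "c = (LINT x|M. (g x)\<^sup>2)"
  have fg: "integrable M (\<lambda>x. f x * g x)" by (rule integrable_mult_of_squares[OF f g f2 g2])
  have q: "0 \<le> a + 2 * k * b + k\<^sup>2 * c" for k
  proof -
    have "0 \<le> (LINT x|M. (f x + k * g x)\<^sup>2)" by simp
    also have "(\<lambda>x. (f x + k * g x)\<^sup>2) = (\<lambda>x. (f x)\<^sup>2 + 2 * k * (f x * g x) + k\<^sup>2 * (g x)\<^sup>2)"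
      by (auto simp: power2_eq_square algebra_simps)
    also have "(LINT x|M. (f x)\<^sup>2 + 2 * k * (f x * g x) + k\<^sup>2 * (g x)\<^sup>2) = a + 2 * k * b + k\<^sup>2 * c"
      using fg f2 g2 by (simp add: a_def b_def c_def)
    finally show ?thesis .
  qed
  have "b\<^sup>2 \<le> a * c"
  proof (cases "c = 0")
    case True
    have "b = 0"
    proof (rule ccontr)
      assume n: "b \<noteq> 0"
      have "0 \<le> a + 2 * (- (a + 1) / (2 * b)) * b" using q[of "- (a + 1) / (2 * b)"] True by simp
      also have "\<dots> = -1" using n by (simp add: field_simps)
      finally show False by simp
    qed
    then show ?thesis using True by simp
  next
    case False
    moreover have "0 \<le> c" unfolding c_def by (rule Bochner_Integration.integral_nonneg) simp
    ultimately have p: "c > 0" by simp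
    have "0 \<le> a - b\<^sup>2 / c" using q[of "- b / c"] p by (simp add: power2_eq_square field_simps)
    then show ?thesis using p by (simp add: field_simps)
  qed
  then show ?thesis by (simp add: a_def b_def c_def)
qed

lemma integrable_square_lincomb:
  fixes f g :: "'a \<Rightarrow> real"
  assumes f: "f \<in> borel_measurable M" and g: "g \<in> borel_measurable M"
    and f2: "integrable M (\<lambda>x. (f x)\<^sup>2)" and g2: "integrable M (\<lambda>x. (g x)\<^sup>2)"
  shows "integrable M (\<lambda>x. (f x + c * g x)\<^sup>2)"
proof -
  have "(\<lambda>x. (f x + c * g x)\<^sup>2) = (\<lambda>x. (f x)\<^sup>2 + 2 * c * (f x * g x) + c\<^sup>2 * (g x)\<^sup>2)"
    by (auto simp: power2_eq_square algebra_simps)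
  then show ?thesis using integrable_mult_of_squares[OF assms] f2 g2 by simp
qed

text \<open>
  A Cauchy sequence is thinned out so that consecutive differences $d_j$ satisfy $\int d_j^2\le 4^{-j}$.
  Then $\sum_j 2^j d_j^2$ is integrable, hence finite almost everywhere, and
  $2|d_j|\le 2^{-j}+2^j d_j^2$ makes the thinned sequence converge there.  Fatou's lemma shows that the
  pointwise limit is also the limit in mean square.
\<close>

lemma Riesz_Fischer_L2:
  fixes g :: "nat \<Rightarrow> 'a \<Rightarrow> real"
  assumes meas [measurable]: "\<And>n. g n \<in> borel_measurable M"
    and int: "\<And>n. integrable M (\<lambda>x. (g n x)\<^sup>2)"
    and cauchy: "\<And>e. e > 0 \<Longrightarrow> \<exists>N. \<forall>m\<ge>N. \<forall>n\<ge>N. (LINT x|M. (g m x - g n x)\<^sup>2) \<le> e"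
  obtains G where "G \<in> borel_measurable M" "integrable M (\<lambda>x. (G x)\<^sup>2)"
    and "(\<lambda>n. LINT x|M. (G x - g n x)\<^sup>2) \<longlonglongrightarrow> 0"
proof -
  have diff_int: "integrable M (\<lambda>x. (f x - h x)\<^sup>2)"
    if "f \<in> borel_measurable M" "h \<in> borel_measurable M"
      "integrable M (\<lambda>x. (f x)\<^sup>2)" "integrable M (\<lambda>x. (h x)\<^sup>2)" for f h :: "'a \<Rightarrow> real"
    using integrable_square_lincomb[OF that, of "-1"] by simp
  have "\<forall>j. \<exists>N. \<forall>m\<ge>N. \<forall>n\<ge>N. (LINT x|M. (g m x - g n x)\<^sup>2) \<le> (1/4)^j"
    using cauchy by simp
  then obtain N where N: "\<And>j m n. m \<ge> N j \<Longrightarrow> n \<ge> N j \<Longrightarrow> (LINT x|M. (g m x - g n x)\<^sup>2) \<le> (1/4::real)^j"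
    by metis
  \<comment> \<open>Summation makes the index sequence monotone while keeping \<open>r j\<close> above \<open>N j\<close>.\<close>
  define r where "r j = (\<Sum>i\<le>j. N i)" for j
  have r_ge: "r j \<ge> N i" if "i \<le> j" for i j
    unfolding r_def using that by (intro member_le_sum) auto
  define d where "d j x = g (r (Suc j)) x - g (r j) x" for j x
  have [measurable]: "d j \<in> borel_measurable M" for j unfolding d_def by measurable
  have d_int: "integrable M (\<lambda>x. (d j x)\<^sup>2)" for j
    unfolding d_def by (intro diff_int meas int)
  have d_le: "(LINT x|M. (d j x)\<^sup>2) \<le> (1/4)^j" for j
    unfolding d_def by (intro N r_ge) auto
  have "(\<integral>\<^sup>+x. (\<Sum>j. ennreal (2^j * (d j x)\<^sup>2)) \<partial>M) = (\<Sum>j. \<integral>\<^sup>+x. ennreal (2^j * (d j x)\<^sup>2) \<partial>M)"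
    by (intro nn_integral_suminf) measurable
  also have "\<dots> \<le> (\<Sum>j. ennreal ((1/2)^j))"
  proof (rule suminf_le)
    fix j
    have "(\<integral>\<^sup>+x. ennreal (2^j * (d j x)\<^sup>2) \<partial>M) = ennreal (LINT x|M. 2^j * (d j x)\<^sup>2)"
      using d_int by (intro nn_integral_eq_integral) auto
    also have "\<dots> \<le> ennreal (2^j * (1/4)^j)"
      using d_le by (intro ennreal_leI) simp
    also have "(2::real)^j * (1/4)^j = (1/2)^j" by (simp add: power_mult_distrib[symmetric])
    finally show "(\<integral>\<^sup>+x. ennreal (2^j * (d j x)\<^sup>2) \<partial>M) \<le> ennreal ((1/2)^j)" .
  qed auto
  also have "\<dots> = ennreal (\<Sum>j. (1/2)^j)" by (intro suminf_ennreal2) auto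
  finally have fin: "(\<integral>\<^sup>+x. (\<Sum>j. ennreal (2^j * (d j x)\<^sup>2)) \<partial>M) \<noteq> \<infinity>"
    by (auto simp: top_unique)
  have "AE x in M. (\<Sum>j. ennreal (2^j * (d j x)\<^sup>2)) \<noteq> \<infinity>"
    by (rule nn_integral_PInf_AE[OF _ fin]) measurable
  then have conv: "AE x in M. (\<lambda>j. g (r j) x) \<longlonglongrightarrow> lim (\<lambda>j. g (r j) x)"
  proof eventually_elim
    case (elim x)
    then have s: "summable (\<lambda>j. 2^j * (d j x)\<^sup>2)" by (intro summable_suminf_not_top) auto
    have "summable (\<lambda>j. (1/2)^j + 2^j * (d j x)\<^sup>2)" using s by (intro summable_add) auto
    then have "summable (\<lambda>j. d j x)"
    proof (rule summable_comparison_test'[where N=0])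
      fix j
      have "0 \<le> (1 - 2^j * \<bar>d j x\<bar>)\<^sup>2" by simp
      then have "2 * (2^j * \<bar>d j x\<bar>) \<le> 1 + 2^j * (2^j * (d j x)\<^sup>2)"
        by (simp add: power2_eq_square algebra_simps)
      then have "(1/2)^j * (2 * (2^j * \<bar>d j x\<bar>)) \<le> (1/2)^j * (1 + 2^j * (2^j * (d j x)\<^sup>2))"
        by (intro mult_left_mono) auto
      then have "2 * \<bar>d j x\<bar> \<le> (1/2)^j + 2^j * (d j x)\<^sup>2"
        by (simp add: algebra_simps power_one_over)
      then show "norm (d j x) \<le> (1/2)^j + 2^j * (d j x)\<^sup>2" by simp
    qed
    then have "(\<lambda>n. \<Sum>j<n. d j x) \<longlonglongrightarrow> (\<Sum>j. d j x)" by (rule summable_LIMSEQ)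
    moreover have "(\<Sum>j<n. d j x) = g (r n) x - g (r 0) x" for n
      unfolding d_def by (rule sum_lessThan_telescope)
    ultimately have "(\<lambda>n. g (r n) x - g (r 0) x + g (r 0) x) \<longlonglongrightarrow> (\<Sum>j. d j x) + g (r 0) x"
      by (intro tendsto_add) auto
    then have "convergent (\<lambda>n. g (r n) x)" by (auto simp: convergent_def)
    then show ?case by (simp add: convergent_LIMSEQ_iff)
  qed
  define G where "G x = lim (\<lambda>j. g (r j) x)" for x
  have [measurable]: "G \<in> borel_measurable M" unfolding G_def by measurable
  have bound: "(\<integral>\<^sup>+x. ennreal ((G x - g n x)\<^sup>2) \<partial>M) \<le> ennreal ((1/4)^i)" if n: "n \<ge> N i" for n i
  proof -
    have "(\<integral>\<^sup>+x. ennreal ((G x - g n x)\<^sup>2) \<partial>M) = (\<integral>\<^sup>+x. liminf (\<lambda>j. ennreal ((g (r j) x - g n x)\<^sup>2)) \<partial>M)"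
    proof (rule nn_integral_cong_AE, use conv in eventually_elim)
      case (elim x)
      then have "(\<lambda>j. ennreal ((g (r j) x - g n x)\<^sup>2)) \<longlonglongrightarrow> ennreal ((G x - g n x)\<^sup>2)"
        unfolding G_def by (intro tendsto_ennrealI tendsto_intros)
      from lim_imp_Liminf[OF sequentially_bot this] show ?case by simp
    qed
    also have "\<dots> \<le> liminf (\<lambda>j. \<integral>\<^sup>+x. ennreal ((g (r j) x - g n x)\<^sup>2) \<partial>M)"
      by (rule nn_integral_liminf) measurable
    also have "\<dots> \<le> ennreal ((1/4)^i)"
    proof (rule Liminf_le)
      show "\<forall>\<^sub>F j in sequentially. (\<integral>\<^sup>+x. ennreal ((g (r j) x - g n x)\<^sup>2) \<partial>M) \<le> ennreal ((1/4)^i)"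
        using eventually_ge_at_top[of i]
      proof eventually_elim
        case (elim j)
        have "(\<integral>\<^sup>+x. ennreal ((g (r j) x - g n x)\<^sup>2) \<partial>M) = ennreal (LINT x|M. (g (r j) x - g n x)\<^sup>2)"
          using diff_int[OF meas meas int int] by (intro nn_integral_eq_integral) auto
        also have "\<dots> \<le> ennreal ((1/4)^i)" using N[OF r_ge[OF elim] n] by (rule ennreal_leI)
        finally show ?case .
      qed
    qed simp
    finally show ?thesis .
  qed
  have dG: "integrable M (\<lambda>x. (G x - g n x)\<^sup>2)" if n: "n \<ge> N i" for n i
    using bound[OF n] by (intro integrableI_bounded) (auto simp: less_top[symmetric] top_unique le_less_trans)
  have "integrable M (\<lambda>x. ((G x - g (N 0) x) - (- g (N 0) x))\<^sup>2)"
    by (rule diff_int) (use dG[of 0 "N 0"] int in auto)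
  then have Gint: "integrable M (\<lambda>x. (G x)\<^sup>2)" by simp
  have "(\<lambda>n. LINT x|M. (G x - g n x)\<^sup>2) \<longlonglongrightarrow> 0"
  proof (rule LIMSEQ_I)
    fix e :: real assume "e > 0"
    then obtain i where i: "(1/4::real)^i < e" using real_arch_pow_inv[of e "1/4"] by auto
    have "norm ((LINT x|M. (G x - g n x)\<^sup>2) - 0) < e" if n: "n \<ge> N i" for n
    proof -
      have "ennreal (LINT x|M. (G x - g n x)\<^sup>2) \<le> ennreal ((1/4)^i)"
        using bound[OF n] nn_integral_eq_integral[OF dG[OF n]] by simp
      then have "(LINT x|M. (G x - g n x)\<^sup>2) \<le> (1/4)^i" by (simp add: ennreal_le_iff)
      then show ?thesis using i by simp
    qed
    then show "\<exists>no. \<forall>n\<ge>no. norm ((LINT x|M. (G x - g n x)\<^sup>2) - 0) < e" by blast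
  qed
  with Gint show thesis using that \<open>G \<in> borel_measurable M\<close> by blast
qed

text \<open>
  In this form, with the function cut off to \<open>X\<close>, membership in \<open>L2 X\<close> reduces to statements on the
  whole line.
\<close>

lemma L2_iff:
  "f \<in> L2 X \<longleftrightarrow> (\<lambda>x. indicator X x * f x) \<in> borel_measurable lebesgue \<and>
     integrable lebesgue (\<lambda>x. (indicator X x * f x)\<^sup>2)"
proof -
  have "(\<lambda>x. (indicator X x * f x)\<^sup>2) = (\<lambda>x. indicator X x * (f x)\<^sup>2)"
    by (auto simp: indicator_def)
  then show ?thesis by (simp add: L2_def set_borel_measurable_def set_integrable_def)
qed

lemma L2_integrable_mult:
  assumes "f \<in> L2 X" "g \<in> L2 X"
  shows "set_integrable lebesgue X (\<lambda>x. f x * g x)"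
proof -
  have "integrable lebesgue (\<lambda>x. (indicator X x * f x) * (indicator X x * g x))"
    using assms by (intro integrable_mult_of_squares) (auto simp: L2_iff)
  moreover have "(\<lambda>x. (indicator X x * f x) * (indicator X x * g x)) = (\<lambda>x. indicator X x * (f x * g x))"
    by (auto simp: indicator_def)
  ultimately show ?thesis by (simp add: set_integrable_def)
qed

lemma L2_scale: "f \<in> L2 X \<Longrightarrow> (\<lambda>x. c * f x) \<in> L2 X"
proof -
  assume "f \<in> L2 X"
  moreover have "(\<lambda>x. indicator X x * (c * f x)) = (\<lambda>x. c * (indicator X x * f x))"
    "(\<lambda>x. (indicator X x * (c * f x))\<^sup>2) = (\<lambda>x. c\<^sup>2 * (indicator X x * f x)\<^sup>2)"
    by (auto simp: power_mult_distrib)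
  ultimately show ?thesis unfolding L2_iff by (simp only: borel_measurable_times borel_measurable_const integrable_mult_right)
qed

lemma L2_add: assumes f: "f \<in> L2 X" and g: "g \<in> L2 X" shows "(\<lambda>x. f x + g x) \<in> L2 X"
proof -
  have "(\<lambda>x. indicator X x *\<^sub>R (f x + g x)) = (\<lambda>x. indicator X x *\<^sub>R f x + indicator X x *\<^sub>R g x)"
    by (auto simp: algebra_simps)
  then have "set_borel_measurable lebesgue X (\<lambda>x. f x + g x)"
    using f g unfolding L2_def set_borel_measurable_def by auto
  moreover have "set_integrable lebesgue X (\<lambda>x. (f x)\<^sup>2 + (g x)\<^sup>2 + 2 * (f x * g x))"
    using f g L2_integrable_mult[OF f g] by (intro set_integral_add set_integrable_mult_right) (auto simp: L2_def)
  ultimately show ?thesis by (simp add: L2_def power2_sum mult.assoc)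
qed

lemma L2_zero [simp]: "(\<lambda>x. 0) \<in> L2 X"
  by (simp add: L2_iff)

lemma L2_diff: "f \<in> L2 X \<Longrightarrow> g \<in> L2 X \<Longrightarrow> (\<lambda>x. f x - g x) \<in> L2 X"
  using L2_add[of f X "\<lambda>x. -1 * g x"] L2_scale[of g X "-1"] by simp

lemma L2_sum: "(\<And>i. i \<in> I \<Longrightarrow> f i \<in> L2 X) \<Longrightarrow> (\<lambda>x. \<Sum>i\<in>I. c i * f i x) \<in> L2 X"
proof (induction I rule: infinite_finite_induct)
  case (insert i I)
  have "(\<lambda>x. c i * f i x + (\<Sum>i\<in>I. c i * f i x)) \<in> L2 X"
    by (rule L2_add) (use insert in \<open>auto intro: L2_scale\<close>)
  then show ?case using insert by simp
qed auto

lemma L2_subset: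
  assumes "f \<in> L2 X" "Y \<subseteq> X" "Y \<in> sets lebesgue" shows "f \<in> L2 Y"
proof -
  have "(\<lambda>x. indicator Y x * f x) = (\<lambda>x. indicator Y x * (indicator X x * f x))"
    using assms(2) by (intro ext) (auto simp: indicator_def)
  then have "(\<lambda>x. indicator Y x * f x) \<in> borel_measurable lebesgue"
    using assms by (auto simp: L2_iff)
  then show ?thesis using assms set_integrable_subset[of lebesgue X _ Y]
    by (auto simp: L2_def set_borel_measurable_def)
qed

lemma L2_indicator:
  assumes "f \<in> L2 X" "Y \<in> sets lebesgue" shows "(\<lambda>x. indicator Y x * f x) \<in> L2 X"
proof -
  have eq: "(\<lambda>x. indicator X x * (indicator Y x * f x)) = (\<lambda>x. indicator Y x * (indicator X x * f x))"
    by auto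
  have "integrable lebesgue (\<lambda>x. indicator Y x *\<^sub>R (indicator X x * f x)\<^sup>2)"
    using assms by (intro integrable_mult_indicator) (auto simp: L2_iff)
  moreover have "(\<lambda>x. indicator Y x *\<^sub>R (indicator X x * f x)\<^sup>2) = (\<lambda>x. (indicator Y x * (indicator X x * f x))\<^sup>2)"
    by (auto simp: indicator_def)
  ultimately have i: "integrable lebesgue (\<lambda>x. (indicator X x * (indicator Y x * f x))\<^sup>2)"
    by (simp add: mult.left_commute)
  have m: "(\<lambda>x. indicator X x * (indicator Y x * f x)) \<in> borel_measurable lebesgue"
    using assms unfolding eq by (auto simp: L2_iff)
  show ?thesis using i m unfolding L2_iff by blast
qed

lemma ip_cong_AE:
  assumes "AE x in lebesgue. x \<in> Dom \<longrightarrow> f x = g x" shows "ip f h = ip g h"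
  unfolding ip_def by (rule set_lebesgue_cong_AE(3)) (use assms in \<open>auto elim: eventually_mono\<close>)

lemma ip_commute: "ip f g = ip g f"
  by (simp add: ip_def mult.commute)

lemma ip_scale: "ip (\<lambda>x. c * f x) g = c * ip f g"
  by (simp add: ip_def mult.assoc)

lemma ip_add: "f \<in> L2 Dom \<Longrightarrow> g \<in> L2 Dom \<Longrightarrow> h \<in> L2 Dom \<Longrightarrow> ip (\<lambda>x. f x + g x) h = ip f h + ip g h"
  unfolding ip_def by (simp add: distrib_right L2_integrable_mult set_integral_add)

lemma ip_diff: "f \<in> L2 Dom \<Longrightarrow> g \<in> L2 Dom \<Longrightarrow> h \<in> L2 Dom \<Longrightarrow> ip (\<lambda>x. f x - g x) h = ip f h - ip g h"
  unfolding ip_def by (simp add: left_diff_distrib L2_integrable_mult set_integral_diff)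

lemma ip_zero [simp]: "ip (\<lambda>x. 0) g = 0"
  by (simp add: ip_def)

lemma ip_sum:
  "(\<And>i. i \<in> I \<Longrightarrow> f i \<in> L2 Dom) \<Longrightarrow> h \<in> L2 Dom \<Longrightarrow>
     ip (\<lambda>x. \<Sum>i\<in>I. c i * f i x) h = (\<Sum>i\<in>I. c i * ip (f i) h)"
  by (induction I rule: infinite_finite_induct) (auto simp: ip_add L2_sum L2_scale ip_scale)

lemma ip_self_nonneg: "0 \<le> ip f f"
  unfolding ip_def set_lebesgue_integral_def by (intro Bochner_Integration.integral_nonneg) (auto simp: indicator_def)

lemma ip_Cauchy_Schwarz:
  assumes f: "f \<in> L2 Dom" and g: "g \<in> L2 Dom"
  shows "(ip f g)\<^sup>2 \<le> ip f f * ip g g"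
proof -
  have eq: "ip v w = (LINT x|lebesgue. (indicator Dom x * v x) * (indicator Dom x * w x))" for v w
    unfolding ip_def set_lebesgue_integral_def by (rule Bochner_Integration.integral_cong) (auto simp: indicator_def)
  show ?thesis
    using integral_Cauchy_Schwarz[of "\<lambda>x. indicator Dom x * f x" lebesgue "\<lambda>x. indicator Dom x * g x"] f g
    unfolding eq[of f g] eq[of f f] eq[of g g] L2_iff by (simp only: power2_eq_square)
qed

lemma ip_le_L2_norm:
  assumes "f \<in> L2 Dom" "g \<in> L2 Dom" shows "\<bar>ip f g\<bar> \<le> L2_norm f * L2_norm g"
proof -
  have "\<bar>ip f g\<bar> = sqrt ((ip f g)\<^sup>2)" by simp
  also have "\<dots> \<le> sqrt (ip f f * ip g g)" using ip_Cauchy_Schwarz[OF assms] by (rule real_sqrt_le_mono)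
  finally show ?thesis by (simp add: L2_norm_def real_sqrt_mult)
qed

lemma ip_indicator_le:
  assumes w: "w \<in> L2 Dom" and \<omega>: "\<omega> \<in> sets lebesgue"
  shows "ip (\<lambda>x. indicator \<omega> x * w x) (\<lambda>x. indicator \<omega> x * w x) \<le> ip w w"
  unfolding ip_def
proof (rule set_integral_mono)
  show "set_integrable lebesgue Dom (\<lambda>x. indicator \<omega> x * w x * (indicator \<omega> x * w x))"
    by (intro L2_integrable_mult L2_indicator w \<omega>)
  show "set_integrable lebesgue Dom (\<lambda>x. w x * w x)" by (intro L2_integrable_mult w)
qed (auto simp: indicator_def)

lemma LINT_subset_ip:
  assumes "\<omega> \<subseteq> Dom"
  shows "(LINT x:\<omega>|lebesgue. a x * b x) = ip a (\<lambda>x. indicator \<omega> x * b x)"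
  unfolding ip_def set_lebesgue_integral_def
  by (rule Bochner_Integration.integral_cong) (use assms in \<open>auto simp: indicator_def\<close>)

lemma ip_indicator_swap: "ip (\<lambda>x. indicator \<omega> x * w x) v = ip w (\<lambda>x. indicator \<omega> x * v x)"
  by (simp add: ip_def mult_ac)

lemma L2Q_iff:
  "u \<in> L2Q T X \<longleftrightarrow> (\<lambda>p. indicator {0<..<T} (fst p) * indicator X (snd p) * u (fst p) (snd p)) \<in> borel_measurable lebesgue \<and>
     integrable lebesgue (\<lambda>p. (indicator {0<..<T} (fst p) * indicator X (snd p) * u (fst p) (snd p))\<^sup>2)"
proof -
  have eq: "(\<lambda>p. indicator ({0<..<T} \<times> X) p *\<^sub>R (case p of (t, x) \<Rightarrow> u t x)) =
     (\<lambda>p. indicator {0<..<T} (fst p) * indicator X (snd p) * u (fst p) (snd p))"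
   "(\<lambda>p. indicator ({0<..<T} \<times> X) p *\<^sub>R (case p of (t, x) \<Rightarrow> (u t x)\<^sup>2)) =
     (\<lambda>p. (indicator {0<..<T} (fst p) * indicator X (snd p) * u (fst p) (snd p))\<^sup>2)"
    by (auto simp: indicator_def)
  show ?thesis unfolding L2Q_def mem_Collect_eq set_borel_measurable_def set_integrable_def eq ..
qed

lemma L2Q_sections:
  assumes "u \<in> L2Q T X"
  shows "AE t in lebesgue. t \<in> {0<..<T} \<longrightarrow> u t \<in> L2 X"
proof -
  let ?v = "\<lambda>p. indicator {0<..<T} (fst p) * indicator X (snd p) * u (fst p) (snd p)"
  have "AE t in lebesgue. (\<lambda>x. ?v (t, x)) \<in> borel_measurable lebesgue"
    by (rule lebesgue_section_measurable) (use assms L2Q_iff in blast)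
  moreover have "AE t in lebesgue. integrable lebesgue (\<lambda>x. (?v (t, x))\<^sup>2)"
    by (rule lebesgue_Fubini(1)[of "\<lambda>p. (?v p)\<^sup>2"]) (use assms L2Q_iff in blast)
  ultimately show ?thesis
  proof eventually_elim
    case (elim t)
    show ?case
    proof
      assume "t \<in> {0<..<T}"
      then have *: "?v (t, x) = indicator X x * u t x" for x by simp
      show "u t \<in> L2 X" using elim unfolding L2_iff * by simp
    qed
  qed
qed

lemma L2Q_product:
  assumes u: "u \<in> L2Q T X" and v: "v \<in> L2Q T X"
  shows "integrable lebesgue (\<lambda>p. indicator {0<..<T} (fst p) * (indicator X (snd p) * (u (fst p) (snd p) * v (fst p) (snd p))))"
    and "set_integrable lebesgue {0<..<T} (\<lambda>t. LINT x:X|lebesgue. u t x * v t x)"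
proof -
  let ?F = "\<lambda>p. indicator {0<..<T} (fst p) * (indicator X (snd p) * (u (fst p) (snd p) * v (fst p) (snd p)))"
  let ?u = "\<lambda>u p. indicator {0<..<T} (fst p) * indicator X (snd p) * u (fst p) (snd p)"
  have "integrable lebesgue (\<lambda>p. ?u u p * ?u v p)"
    using u v by (intro integrable_mult_of_squares) (auto simp: L2Q_iff)
  moreover have "(\<lambda>p. ?u u p * ?u v p) = ?F" by (auto simp: indicator_def)
  ultimately show F: "integrable lebesgue ?F" by simp
  show "set_integrable lebesgue {0<..<T} (\<lambda>t. LINT x:X|lebesgue. u t x * v t x)"
    using lebesgue_Fubini(2)[OF F] by (simp add: set_integrable_def set_lebesgue_integral_def)
qed

lemma L2Q_tensor:
  assumes a: "a \<in> L2 {0<..<T}" and v: "v \<in> L2 X"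
  shows "(\<lambda>t x. a t * v x) \<in> L2Q T X"
proof -
  let ?a = "\<lambda>t. indicator {0<..<T} t * a t" and ?v = "\<lambda>x. indicator X x * v x"
  have "?a \<in> borel_measurable lebesgue" "?v \<in> borel_measurable lebesgue"
    using a v by (simp_all only: L2_iff)
  from borel_measurable_times[OF lebesgue_measurable_fst[OF this(1)] lebesgue_measurable_snd[OF this(2)]]
  have "(\<lambda>p. ?a (fst p) * ?v (snd p)) \<in> borel_measurable lebesgue" .
  moreover have "integrable lebesgue (\<lambda>p. (?a (fst p))\<^sup>2 * (?v (snd p))\<^sup>2)"
    using lebesgue_integrable_tensor[of "\<lambda>t. (?a t)\<^sup>2" "\<lambda>x. (?v x)\<^sup>2"] a v by (simp only: L2_iff)
  ultimately show ?thesis unfolding L2Q_iff by (simp add: power_mult_distrib algebra_simps)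
qed

lemma L2Q_add_scale:
  assumes u: "u \<in> L2Q T X" and v: "v \<in> L2Q T X"
  shows "(\<lambda>t x. u t x + c * v t x) \<in> L2Q T X"
proof -
  let ?r = "\<lambda>u p. indicator {0<..<T} (fst p) * indicator X (snd p) * u (fst p) (snd p)"
  have eq: "?r (\<lambda>t x. u t x + c * v t x) p = ?r u p + c * ?r v p" for p by (simp add: distrib_left mult_ac)
  have m: "?r u \<in> borel_measurable lebesgue" "?r v \<in> borel_measurable lebesgue"
    "integrable lebesgue (\<lambda>p. (?r u p)\<^sup>2)" "integrable lebesgue (\<lambda>p. (?r v p)\<^sup>2)"
    using u v by (simp_all only: L2Q_iff)
  show ?thesis unfolding L2Q_iff eq
    by (rule conjI[OF borel_measurable_add[OF m(1) borel_measurable_times[OF borel_measurable_const m(2)]]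
         integrable_square_lincomb[OF m]])
qed

lemma L2Q_sum:
  "finite I \<Longrightarrow> (\<And>i. i \<in> I \<Longrightarrow> u i \<in> L2Q T X) \<Longrightarrow> (\<lambda>t x. \<Sum>i\<in>I. u i t x) \<in> L2Q T X"
proof (induction I rule: finite_induct)
  case empty then show ?case by (simp add: L2Q_iff)
next
  case (insert i I)
  have "(\<lambda>t x. (\<Sum>i\<in>I. u i t x) + 1 * u i t x) \<in> L2Q T X" by (rule L2Q_add_scale) (use insert in auto)
  then show ?case using insert by (simp add: add.commute)
qed

lemma L2_bounded:
  assumes "set_borel_measurable lebesgue {a<..<b::real} f"
    and "AE t in lebesgue. t \<in> {a<..<b} \<longrightarrow> \<bar>f t\<bar> \<le> C"
  shows "f \<in> L2 {a<..<b}"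
proof -
  let ?f = "\<lambda>x. indicator {a<..<b} x * f x"
  have m: "?f \<in> borel_measurable lebesgue" using assms(1) by (simp add: set_borel_measurable_def)
  have "integrable lebesgue (\<lambda>x. (?f x)\<^sup>2)"
  proof (rule Bochner_Integration.integrable_bound)
    show "integrable lebesgue (\<lambda>x. indicator {a<..<b} x *\<^sub>R C\<^sup>2)"
      using lmeasurable_interval(2)[of a b] by (intro integrable_real_indicator integrable_scaleR_left) (auto simp: fmeasurable_def)
    show "AE x in lebesgue. norm ((?f x)\<^sup>2) \<le> norm (indicator {a<..<b} x *\<^sub>R C\<^sup>2)"
      using assms(2)
    proof eventually_elim
      case (elim x)
      then show ?case using power_mono[of "\<bar>f x\<bar>" C 2] by (auto simp: indicator_def)
    qed
  qed (use m in simp)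
  with m show ?thesis by (simp add: L2_iff)
qed

lemma L2_const_Ioo: "(\<lambda>t. c) \<in> L2 {a<..<b}"
proof -
  have "set_borel_measurable lebesgue {a<..<b} (\<lambda>t. c)"
    unfolding set_borel_measurable_def by (intro borel_measurable_scaleR borel_measurable_indicator borel_measurable_const) simp
  then show ?thesis by (rule L2_bounded[where C="\<bar>c\<bar>"]) auto
qed

text \<open>
  The coefficient of a space-time function in a fixed direction \<open>v\<close> is the inner integral of the product
  with the function $(t,x)\mapsto v(x)$, which is square integrable because the time interval is bounded.
\<close>

lemma L2Q_ip_integrable:
  assumes u: "u \<in> L2Q T Dom" and v: "v \<in> L2 Dom"
  shows "set_integrable lebesgue {0<..<T} (\<lambda>t. ip (u t) v)"
proof -
  have "(\<lambda>t::real. 1) \<in> L2 {0<..<T}" by (rule L2_bounded[where C=1]) (auto simp: set_borel_measurable_def intro!: borel_measurable_indicator)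
  from L2Q_product(2)[OF u L2Q_tensor[OF this v]] show ?thesis by (simp add: ip_def)
qed

section \<open>Primitives of integrable functions\<close>

lemma set_integrable_Ioo_sub:
  fixes f :: "real \<Rightarrow> real"
  assumes "set_integrable lebesgue {a<..<b} f" "a \<le> c" "d \<le> b"
  shows "set_integrable lebesgue {c<..<d} f"
  by (rule set_integrable_subset[OF assms(1)]) (use assms in auto)

lemma LINT_reflect:
  fixes f :: "real \<Rightarrow> real"
  shows "(LINT r:{0<..<t}|lebesgue. f (t - r)) = (LINT r:{0<..<t}|lebesgue. f r)"
    and "set_integrable lebesgue {0<..<t} (\<lambda>r. f (t - r)) \<longleftrightarrow> set_integrable lebesgue {0<..<t} f"
proof -
  have eq: "indicator {0<..<t} (t + (-1) * r) *\<^sub>R f (t + (-1) * r) = indicator {0<..<t} r *\<^sub>R f (t - r)" for r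
    by (auto simp: indicator_def)
  show "(LINT r:{0<..<t}|lebesgue. f (t - r)) = (LINT r:{0<..<t}|lebesgue. f r)"
    using lebesgue_integral_real_affine[of "-1" "\<lambda>r. indicator {0<..<t} r *\<^sub>R f r" t]
    unfolding set_lebesgue_integral_def eq by simp
  show "set_integrable lebesgue {0<..<t} (\<lambda>r. f (t - r)) \<longleftrightarrow> set_integrable lebesgue {0<..<t} f"
    using lebesgue_integrable_real_affine_iff[of "-1" "\<lambda>r. indicator {0<..<t} r *\<^sub>R f r" t]
    unfolding set_integrable_def eq by simp
qed

lemma AE_lebesgue_reflect:
  assumes "AE r in lebesgue. P (r::real)" shows "AE r in lebesgue. P (t - r)"
proof -
  obtain N where N: "N \<in> null_sets lebesgue" "{r. \<not> P r} \<subseteq> N"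
    using assms by (auto simp: eventually_ae_filter)
  let ?f = "indicat_real N"
  have i: "integrable lebesgue ?f" and z: "(LINT r|lebesgue. ?f r) = 0"
    using N(1) by (auto simp: null_sets_def measure_def)
  have "integrable lebesgue (\<lambda>r. ?f (t + (-1) * r))" by (rule lebesgue_integrable_real_affine[OF i]) simp
  moreover have "(LINT r|lebesgue. ?f (t + (-1) * r)) = 0"
    using lebesgue_integral_real_affine[of "-1" ?f t] z by simp
  ultimately have "AE r in lebesgue. ?f (t + (-1) * r) = 0"
    by (subst integral_nonneg_eq_0_iff_AE[symmetric]) auto
  then show ?thesis by eventually_elim (use N(2) in \<open>auto simp: indicator_def split: if_splits\<close>)
qed

lemma AE_lebesgue_shift:
  assumes "AE x in lebesgue. P (x::real)" shows "AE t in lebesgue. P (t - r)"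
  using AE_lebesgue_reflect[OF AE_lebesgue_reflect[OF assms, of 0], of r] by simp

lemma AE_neq: "AE x in lebesgue. x \<noteq> (c::real)"
proof -
  have "{c} \<in> null_sets lebesgue" by (simp add: negligible_iff_null_sets[symmetric])
  then have "AE x in lebesgue. x \<notin> {c}" by (rule AE_not_in)
  then show ?thesis by simp
qed

lemma LINT_truncate:
  fixes g :: "real \<Rightarrow> real"
  assumes "\<tau> \<le> T"
  shows "(LINT t:{0<..<T}|lebesgue. if t \<le> \<tau> then g t else 0) = (LINT t:{0<..<\<tau>}|lebesgue. g t)"
  unfolding set_lebesgue_integral_def
  by (rule lebesgue_cong_AE(3)) (use AE_neq[of \<tau>] in eventually_elim, use assms in \<open>auto simp: indicator_def\<close>)

lemma continuous_Ioo_integrable: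
  fixes f :: "real \<Rightarrow> real"
  assumes "continuous_on {a..b} f" shows "set_integrable lebesgue {a<..<b} f"
  using set_integrable_subset[OF absolutely_integrable_continuous_real[OF assms], of "{a<..<b}"]
    by (simp add: subset_eq)

lemma continuous_Ioo_L2:
  assumes "continuous_on {0..T} (a::real \<Rightarrow> real)" shows "a \<in> L2 {0<..<T}"
  unfolding L2_def mem_Collect_eq
proof
  show "set_integrable lebesgue {0<..<T} (\<lambda>x. (a x)\<^sup>2)" by (intro continuous_Ioo_integrable continuous_intros assms)
  show "set_borel_measurable lebesgue {0<..<T} a"
    using continuous_Ioo_integrable[OF assms] unfolding set_borel_measurable_def set_integrable_def
    by (rule borel_measurable_integrable)
qed

lemma L2_Ioo_integrable: "a \<in> L2 {0<..<T} \<Longrightarrow> set_integrable lebesgue {0<..<T} a"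
  using L2_integrable_mult[OF _ L2_const_Ioo[of 1]] by simp

lemma Linf_L2: "d \<in> Linf T \<Longrightarrow> d \<in> L2 {0<..<T}"
  unfolding Linf_def using L2_bounded[of 0 T d] by blast

lemma LINT_Ioo_integral:
  fixes f :: "real \<Rightarrow> real"
  assumes "continuous_on {a..b} f" shows "(LINT r:{a<..<b}|lebesgue. f r) = integral {a..b} f"
  using set_lebesgue_integral_eq_integral(2)[OF continuous_Ioo_integrable[OF assms]]
  by (simp add: integral_open_interval_real)

lemma LINT_FTC:
  fixes f :: "real \<Rightarrow> real"
  assumes "a \<le> b" "\<And>t. t \<in> {a..b} \<Longrightarrow> (F has_real_derivative f t) (at t within {a..b})" "continuous_on {a..b} f"
  shows "(LINT r:{a<..<b}|lebesgue. f r) = F b - F a"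
proof -
  have "(f has_integral (F b - F a)) {a..b}"
    using assms by (intro fundamental_theorem_of_calculus) (auto simp: has_real_derivative_iff_has_vector_derivative)
  then show ?thesis using LINT_Ioo_integral[OF assms(3)] by (simp add: integral_unique)
qed

text \<open>
  The square of the difference is continuous and nonnegative and has vanishing integral.  This lets values
  at single times, such as initial and final data, be read off from identities that hold for almost every
  time.
\<close>

lemma continuous_AE_eq:
  fixes f g :: "real \<Rightarrow> real"
  assumes "a < b" and f: "continuous_on {a..b} f" and g: "continuous_on {a..b} g"
    and ae: "AE t in lebesgue. t \<in> {a<..<b} \<longrightarrow> f t = g t" and t: "t \<in> {a..b}"
  shows "f t = g t"
proof -
  have c: "continuous_on {a..b} (\<lambda>t. (f t - g t)\<^sup>2)" by (intro continuous_intros f g)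
  have "(LINT r:{a<..<b}|lebesgue. (f r - g r)\<^sup>2) = (LINT r:{a<..<b}|lebesgue. 0)"
    by (rule set_lebesgue_cong_AE(3)) (use ae in \<open>auto elim!: eventually_mono\<close>)
  then have "integral {a..b} (\<lambda>t. (f t - g t)\<^sup>2) = 0" using LINT_Ioo_integral[OF c] by simp
  then show ?thesis using integral_eq_0_iff[OF c \<open>a < b\<close>] t by simp
qed

lemma LINT_Ioo_bound:
  fixes g :: "real \<Rightarrow> real"
  assumes "AE r in lebesgue. r \<in> {0<..<t} \<longrightarrow> \<bar>g r\<bar> \<le> C" "0 \<le> C" "0 \<le> t"
  shows "\<bar>LINT r:{0<..<t}|lebesgue. g r\<bar> \<le> C * t"
proof (cases "set_integrable lebesgue {0<..<t} g")
  case True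
  have C: "set_integrable lebesgue {0<..<t} (\<lambda>r. C)"
    by (rule continuous_Ioo_integrable) (rule continuous_on_const)
  have "\<bar>LINT r:{0<..<t}|lebesgue. g r\<bar> \<le> (LINT r:{0<..<t}|lebesgue. \<bar>g r\<bar>)"
    using set_integral_norm_bound[OF True] by simp
  also have "\<dots> \<le> (LINT r:{0<..<t}|lebesgue. C)"
    by (rule set_integral_mono_AE) (use True C assms in \<open>auto simp: set_integrable_abs\<close>)
  also have "\<dots> = C * t" using LINT_FTC[of 0 t "\<lambda>r. C * r" "\<lambda>r. C"] assms(3)
    by (auto intro!: derivative_eq_intros)
  finally show ?thesis .
next
  case False
  then show ?thesis using assms by (simp add: set_integrable_def set_lebesgue_integral_def not_integrable_integral_eq)
qed

text \<open>
  The two ways of writing the solution operator $\int_0^t e^{-l(t-r)}g(r)\,dr$ of $y'=-ly+g$, $y(0)=0$.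
\<close>

lemma LINT_exp_reflect:
  "(LINT r:{0<..<t}|lebesgue. exp (- l * r) * g (t - r)) = exp (- l * t) * (LINT r:{0<..<t}|lebesgue. exp (l * r) * (g r :: real))"
proof -
  have "(LINT r:{0<..<t}|lebesgue. exp (- l * r) * g (t - r)) = (LINT r:{0<..<t}|lebesgue. exp (- l * (t - r)) * g r)"
    using LINT_reflect(1)[of t "\<lambda>r. exp (- l * (t - r)) * g r"] by simp
  also have "\<dots> = (LINT r:{0<..<t}|lebesgue. exp (- l * t) * (exp (l * r) * g r))"
    by (simp add: right_diff_distrib exp_diff exp_minus field_simps)
  finally show ?thesis by simp
qed

text \<open>
  The square $(0,t)^2$ is cut along its diagonal, a null set, into two triangles; Fubini's theorem evaluates
  the integral of $a(x)b(y)$ over each of them.  This is integration by parts for two primitives that vanish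
  at the origin.
\<close>

lemma LINT_triangle_parts:
  fixes a b :: "real \<Rightarrow> real"
  assumes a: "set_integrable lebesgue {0<..<t} a" and b: "set_integrable lebesgue {0<..<t} b"
  shows "set_integrable lebesgue {0<..<t} (\<lambda>x. a x * (LINT y:{0<..<x}|lebesgue. b y))"
    and "set_integrable lebesgue {0<..<t} (\<lambda>x. b x * (LINT y:{0<..<x}|lebesgue. a y))"
    and "(LINT x:{0<..<t}|lebesgue. a x * (LINT y:{0<..<x}|lebesgue. b y)) +
       (LINT x:{0<..<t}|lebesgue. b x * (LINT y:{0<..<x}|lebesgue. a y)) =
       (LINT x:{0<..<t}|lebesgue. a x) * (LINT x:{0<..<t}|lebesgue. b x)"
proof -
  define A B where "A x = indicator {0<..<t} x * a x" and "B x = indicator {0<..<t} x * b x" for x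
  have A: "integrable lebesgue A" and B: "integrable lebesgue B"
    using a b unfolding A_def B_def set_integrable_def by simp_all
  let ?L = "\<lambda>p::real\<times>real. if snd p < fst p then 1 else (0::real)"
  let ?R = "\<lambda>p::real\<times>real. if fst p < snd p then 1 else (0::real)"
  have "open {p::real\<times>real. snd p < fst p}" "open {p::real\<times>real. fst p < snd p}"
    by (intro open_Collect_less continuous_intros)+
  then have o: "{p::real\<times>real. snd p < fst p} \<in> sets lebesgue" "{p::real\<times>real. fst p < snd p} \<in> sets lebesgue"
    by (auto intro: lborelD)
  have "?L = indicator {p. snd p < fst p}" "?R = indicator {p. fst p < snd p}"
    by (auto simp: indicator_def)
  then have mes: "?L \<in> borel_measurable lebesgue" "?R \<in> borel_measurable lebesgue"
    using o by (metis borel_measurable_indicator)+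
  have AB: "integrable lebesgue (\<lambda>p. A (fst p) * B (snd p))" by (rule lebesgue_integrable_tensor[OF A B])
  have L: "integrable lebesgue (\<lambda>p. A (fst p) * B (snd p) * ?L p)"
    by (rule Bochner_Integration.integrable_bound[OF AB]) (use AB mes in \<open>auto intro!: borel_measurable_times AE_I2 dest: borel_measurable_integrable\<close>)
  have R: "integrable lebesgue (\<lambda>p. A (fst p) * B (snd p) * ?R p)"
    by (rule Bochner_Integration.integrable_bound[OF AB]) (use AB mes in \<open>auto intro!: borel_measurable_times AE_I2 dest: borel_measurable_integrable\<close>)
  have eqL: "(LINT y|lebesgue. A (fst (x, y)) * B (snd (x, y)) * ?L (x, y)) =
      indicator {0<..<t} x *\<^sub>R (a x * (LINT y:{0<..<x}|lebesgue. b y))" for x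
  proof -
    have "(\<lambda>y. A (fst (x, y)) * B (snd (x, y)) * ?L (x, y)) = (\<lambda>y. A x * (indicator {0<..<x} y *\<^sub>R b y))"
      by (auto simp: A_def B_def indicator_def)
    then show ?thesis by (simp add: A_def set_lebesgue_integral_def)
  qed
  have eqR: "(LINT x|lebesgue. A (fst (x, y)) * B (snd (x, y)) * ?R (x, y)) =
      indicator {0<..<t} y *\<^sub>R (b y * (LINT x:{0<..<y}|lebesgue. a x))" for y
  proof -
    have "(\<lambda>x. A (fst (x, y)) * B (snd (x, y)) * ?R (x, y)) = (\<lambda>x. B y * (indicator {0<..<y} x *\<^sub>R a x))"
      by (auto simp: A_def B_def indicator_def)
    then show ?thesis by (simp add: B_def set_lebesgue_integral_def)
  qed
  show "set_integrable lebesgue {0<..<t} (\<lambda>x. a x * (LINT y:{0<..<x}|lebesgue. b y))"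
    using lebesgue_Fubini(2)[OF L] unfolding eqL set_integrable_def .
  show "set_integrable lebesgue {0<..<t} (\<lambda>x. b x * (LINT y:{0<..<x}|lebesgue. a y))"
    using lebesgue_Fubini_swap(2)[OF R] unfolding eqR set_integrable_def .
  have "AE p in lebesgue. fst p \<noteq> snd (p::real\<times>real)"
  proof -
    have "{p::real\<times>real. (1, -1) \<bullet> p = 0} \<in> null_sets lebesgue"
      by (subst negligible_iff_null_sets[symmetric], rule negligible_hyperplane) (simp add: zero_prod_def)
    then have "AE p in lebesgue. p \<notin> {p::real\<times>real. (1, -1) \<bullet> p = 0}" by (rule AE_not_in)
    then show ?thesis by eventually_elim (auto simp: inner_prod_def)
  qed
  then have ae: "AE p in lebesgue. A (fst p) * B (snd p) * ?L p + A (fst p) * B (snd p) * ?R p = A (fst p) * B (snd p)"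
    by eventually_elim auto
  have "(LINT x:{0<..<t}|lebesgue. a x * (LINT y:{0<..<x}|lebesgue. b y)) +
       (LINT x:{0<..<t}|lebesgue. b x * (LINT y:{0<..<x}|lebesgue. a y)) =
       (LINT p|lebesgue. A (fst p) * B (snd p) * ?L p) + (LINT p|lebesgue. A (fst p) * B (snd p) * ?R p)"
    using lebesgue_Fubini(3)[OF L] lebesgue_Fubini_swap(3)[OF R] unfolding eqL eqR set_lebesgue_integral_def by simp
  also have "\<dots> = (LINT p|lebesgue. A (fst p) * B (snd p) * ?L p + A (fst p) * B (snd p) * ?R p)"
    using L R by (rule Bochner_Integration.integral_add[symmetric])
  also have "\<dots> = (LINT p|lebesgue. A (fst p) * B (snd p))" by (rule lebesgue_cong_AE(3)[OF ae])
  also have "\<dots> = (LINT x|lebesgue. LINT y|lebesgue. A x * B y)" using lebesgue_Fubini(3)[OF AB] by simp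
  also have "\<dots> = (LINT x:{0<..<t}|lebesgue. a x) * (LINT x:{0<..<t}|lebesgue. b x)"
    by (simp add: A_def B_def set_lebesgue_integral_def)
  finally show "(LINT x:{0<..<t}|lebesgue. a x * (LINT y:{0<..<x}|lebesgue. b y)) +
       (LINT x:{0<..<t}|lebesgue. b x * (LINT y:{0<..<x}|lebesgue. a y)) =
       (LINT x:{0<..<t}|lebesgue. a x) * (LINT x:{0<..<t}|lebesgue. b x)" .
qed

text \<open>
  Absolute continuity on \<open>[0,T]\<close> together with the density: \<open>A\<close> is the continuous representative of an
  element of $W^{1,1}(0,T)$ and \<open>a\<close> its derivative.
\<close>

definition primitive :: "real \<Rightarrow> (real \<Rightarrow> real) \<Rightarrow> (real \<Rightarrow> real) \<Rightarrow> bool" where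
  "primitive T A a \<longleftrightarrow> set_integrable lebesgue {0<..<T} a \<and>
     (\<forall>t\<in>{0..T}. A t = A 0 + (LINT r:{0<..<t}|lebesgue. a r))"

lemma primitive_integrable: "primitive T A a \<Longrightarrow> set_integrable lebesgue {0<..<T} a"
  unfolding primitive_def by blast

lemma primitive_eq: "primitive T A a \<Longrightarrow> t \<in> {0..T} \<Longrightarrow> A t = A 0 + (LINT r:{0<..<t}|lebesgue. a r)"
  unfolding primitive_def by blast

lemma primitive_sub: "primitive T A a \<Longrightarrow> t \<le> T \<Longrightarrow> primitive t A a"
  unfolding primitive_def using set_integrable_Ioo_sub[of 0 T a 0 t] atLeastatMost_subset_iff[of 0 t 0 T] by blast

lemma primitive_cong: "primitive T A a \<Longrightarrow> (\<And>t. t \<in> {0..T} \<Longrightarrow> A t = A' t) \<Longrightarrow>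
   AE t in lebesgue. t \<in> {0<..<T} \<longrightarrow> a t = a' t \<Longrightarrow> primitive T A' a'"
  unfolding primitive_def
proof (elim conjE, intro conjI ballI)
  assume A: "\<And>t. t \<in> {0..T} \<Longrightarrow> A t = A' t" and ae: "AE t in lebesgue. t \<in> {0<..<T} \<longrightarrow> a t = a' t"
    and i: "set_integrable lebesgue {0<..<T} a" and p: "\<forall>t\<in>{0..T}. A t = A 0 + (LINT r:{0<..<t}|lebesgue. a r)"
  show "set_integrable lebesgue {0<..<T} a'" using set_lebesgue_cong_AE(2)[OF ae] i by blast
  fix t assume t: "t \<in> {0..T}"
  have "(LINT r:{0<..<t}|lebesgue. a r) = (LINT r:{0<..<t}|lebesgue. a' r)"
    by (rule set_lebesgue_cong_AE(3)) (use ae t in \<open>auto elim: eventually_mono\<close>)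
  then show "A' t = A' 0 + (LINT r:{0<..<t}|lebesgue. a' r)" using A[OF t] A[of 0] bspec[OF p t] t by simp
qed

lemma primitive_parts:
  assumes A: "primitive T A a" and B: "primitive T B b" and "0 \<le> T"
  shows "set_integrable lebesgue {0<..<T} (\<lambda>r. a r * B r)" "set_integrable lebesgue {0<..<T} (\<lambda>r. A r * b r)"
    and "A T * B T - A 0 * B 0 = (LINT r:{0<..<T}|lebesgue. a r * B r) + (LINT r:{0<..<T}|lebesgue. A r * b r)"
proof -
  have a: "set_integrable lebesgue {0<..<T} a" and b: "set_integrable lebesgue {0<..<T} b"
    and At: "A t = A 0 + (LINT r:{0<..<t}|lebesgue. a r)" and Bt: "B t = B 0 + (LINT r:{0<..<t}|lebesgue. b r)"
    if "t \<in> {0..T}" for t using A B that unfolding primitive_def by blast+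
  note ab = a[of T] b[of T]
  have T: "T \<in> {0..T}" using \<open>0 \<le> T\<close> by simp
  note a = a[OF T] and b = b[OF T]
  note tri = LINT_triangle_parts[OF a b]
  have "a r * B r = B 0 * a r + a r * (LINT y:{0<..<r}|lebesgue. b y)" if "r \<in> {0<..<T}" for r
    by (subst Bt) (use that in \<open>auto simp: algebra_simps\<close>)
  then have e1: "AE r in lebesgue. r \<in> {0<..<T} \<longrightarrow> a r * B r = B 0 * a r + a r * (LINT y:{0<..<r}|lebesgue. b y)"
    by blast
  have "A r * b r = A 0 * b r + b r * (LINT y:{0<..<r}|lebesgue. a y)" if "r \<in> {0<..<T}" for r
    by (subst At) (use that in \<open>auto simp: algebra_simps\<close>)
  then have e2: "AE r in lebesgue. r \<in> {0<..<T} \<longrightarrow> A r * b r = A 0 * b r + b r * (LINT y:{0<..<r}|lebesgue. a y)"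
    by blast
  show "set_integrable lebesgue {0<..<T} (\<lambda>r. a r * B r)"
    unfolding set_lebesgue_cong_AE(2)[OF e1] using a tri(1) by (intro set_integral_add set_integrable_mult_right) auto
  show "set_integrable lebesgue {0<..<T} (\<lambda>r. A r * b r)"
    unfolding set_lebesgue_cong_AE(2)[OF e2] using b tri(2) by (intro set_integral_add set_integrable_mult_right) auto
  have i1: "(LINT r:{0<..<T}|lebesgue. a r * B r) = B 0 * (LINT r:{0<..<T}|lebesgue. a r) + (LINT x:{0<..<T}|lebesgue. a x * (LINT y:{0<..<x}|lebesgue. b y))"
    unfolding set_lebesgue_cong_AE(3)[OF e1] using a tri(1) by (subst set_integral_add) auto
  have i2: "(LINT r:{0<..<T}|lebesgue. A r * b r) = A 0 * (LINT r:{0<..<T}|lebesgue. b r) + (LINT x:{0<..<T}|lebesgue. b x * (LINT y:{0<..<x}|lebesgue. a y))"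
    unfolding set_lebesgue_cong_AE(3)[OF e2] using b tri(2) by (subst set_integral_add) auto
  show "A T * B T - A 0 * B 0 = (LINT r:{0<..<T}|lebesgue. a r * B r) + (LINT r:{0<..<T}|lebesgue. A r * b r)"
  proof -
    let ?a = "LINT r:{0<..<T}|lebesgue. a r" and ?b = "LINT r:{0<..<T}|lebesgue. b r"
    have "A T * B T - A 0 * B 0 = B 0 * ?a + A 0 * ?b + ?a * ?b"
      unfolding At[OF T] Bt[OF T] by (simp add: distrib_left distrib_right)
    then show ?thesis using tri(3) i1 i2
      by linarith
  qed
qed

lemma primitive_mult:
  assumes A: "primitive T A a" and B: "primitive T B b"
  shows "primitive T (\<lambda>t. A t * B t) (\<lambda>t. a t * B t + A t * b t)"
proof (cases "0 \<le> T")
  case True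
  have i: "set_integrable lebesgue {0<..<t} (\<lambda>r. a r * B r)" "set_integrable lebesgue {0<..<t} (\<lambda>r. A r * b r)"
    and e: "A t * B t - A 0 * B 0 = (LINT r:{0<..<t}|lebesgue. a r * B r) + (LINT r:{0<..<t}|lebesgue. A r * b r)"
    if "t \<in> {0..T}" for t
    using primitive_parts[OF primitive_sub[OF A] primitive_sub[OF B], of t] that by auto
  show ?thesis unfolding primitive_def
  proof (intro conjI ballI)
    show "set_integrable lebesgue {0<..<T} (\<lambda>t. a t * B t + A t * b t)"
      using i[of T] True by (intro set_integral_add) auto
    fix t assume t: "t \<in> {0..T}"
    show "A t * B t = A 0 * B 0 + (LINT r:{0<..<t}|lebesgue. a r * B r + A r * b r)"
      using e[OF t] set_integral_add(2)[OF i[OF t]] by simp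
  qed
qed (use assms in \<open>auto simp: primitive_def set_integrable_def\<close>)

text \<open>
  A primitive is bounded and measurable; integrability of the product is read off from integration by parts.
\<close>

lemma integrable_mult_primitive:
  assumes g: "set_integrable lebesgue {0<..<T} g" and B: "primitive T B b" and T: "0 \<le> T"
  shows "set_integrable lebesgue {0<..<T} (\<lambda>t. g t * B t)"
proof -
  have "primitive T (\<lambda>t. LINT r:{0<..<t}|lebesgue. g r) g"
    using g by (simp add: primitive_def set_lebesgue_integral_def)
  from primitive_parts(1)[OF this B T] show ?thesis .
qed

lemma primitive_C1:
  assumes "\<And>t. t \<in> {0..T} \<Longrightarrow> (F has_real_derivative f t) (at t)" "continuous_on {0..T} f"
  shows "primitive T F f"
  unfolding primitive_def
proof (intro conjI ballI)
  show "set_integrable lebesgue {0<..<T} f" by (rule continuous_Ioo_integrable[OF assms(2)])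
  fix t assume t: "t \<in> {0..T}"
  have "(LINT r:{0<..<t}|lebesgue. f r) = F t - F 0"
    using t assms by (intro LINT_FTC) (auto intro: has_field_derivative_at_within continuous_on_subset)
  then show "F t = F 0 + (LINT r:{0<..<t}|lebesgue. f r)" by simp
qed

lemma exp_primitive: "primitive t (\<lambda>r. exp (l * r)) (\<lambda>r. l * exp (l * r))"
  by (rule primitive_C1) (auto intro!: derivative_eq_intros continuous_intros)

lemma LINT_primitive_continuous:
  fixes b :: "real \<Rightarrow> real"
  assumes b: "set_integrable lebesgue {0<..<T} b"
  shows "continuous_on {0..T} (\<lambda>t. LINT r:{0<..<t}|lebesgue. b r)"
proof -
  have "continuous_on {0..T} (\<lambda>t. integral {0..t} b)"
  proof (rule indefinite_integral_continuous_1)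
    have "b integrable_on {0<..<T}" using set_lebesgue_integral_eq_integral(1)[OF b] .
    then show "b integrable_on {0..T}" by (simp add: integrable_on_open_interval_real)
  qed
  moreover have "(LINT r:{0<..<t}|lebesgue. b r) = integral {0..t} b" if "t \<in> {0..T}" for t
    using set_lebesgue_integral_eq_integral(2)[OF set_integrable_Ioo_sub[OF b, of 0 t]] that
    by (simp add: integral_open_interval_real)
  ultimately show ?thesis by (metis (no_types, lifting) continuous_on_cong)
qed

lemma primitive_continuous:
  assumes "primitive T A a" shows "continuous_on {0..T} A"
proof -
  have "continuous_on {0..T} (\<lambda>t. A 0 + (LINT r:{0<..<t}|lebesgue. a r))"
    using assms by (intro continuous_intros LINT_primitive_continuous) (simp add: primitive_def)
  moreover have "A t = A 0 + (LINT r:{0<..<t}|lebesgue. a r)" if "t \<in> {0..T}" for t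
    using assms that unfolding primitive_def by blast
  ultimately show ?thesis by (metis (no_types, lifting) continuous_on_cong)
qed

text \<open>
  Variation of constants for $a'=-la+g$: multiplication by the integrating factor $e^{lt}$ leaves
  $(e^{lt}a)'=e^{lt}g$, which is integrated by parts.
\<close>

lemma primitive_ODE:
  assumes T: "0 \<le> T" and a: "primitive T a (\<lambda>t. - l * a t + g t)"
  shows "exp (l * T) * a T = a 0 + (LINT t:{0<..<T}|lebesgue. exp (l * t) * g t)"
proof -
  have e: "primitive T (\<lambda>t. exp (l * t)) (\<lambda>t. l * exp (l * t))"
    by (rule primitive_C1) (auto intro!: derivative_eq_intros continuous_intros)
  note p = primitive_parts[OF a e T]
  have "exp (l * T) * a T - a 0 =
      (LINT t:{0<..<T}|lebesgue. (- l * a t + g t) * exp (l * t) + a t * (l * exp (l * t)))"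
    using p by (subst set_integral_add(2)) (auto simp: mult.commute)
  also have "\<dots> = (LINT t:{0<..<T}|lebesgue. exp (l * t) * g t)"
    by (simp add: algebra_simps)
  finally show ?thesis by simp
qed

text \<open>
  The sets over which the integral of \<open>b\<close> vanishes are closed under complements and countable disjoint
  unions and contain the half-lines, hence all Borel sets.
\<close>

lemma LINT_zero_imp_AE_zero:
  fixes b :: "real \<Rightarrow> real"
  assumes b: "set_integrable lebesgue {0<..<T} b"
    and z: "\<And>t. t \<in> {0..T} \<Longrightarrow> (LINT r:{0<..<t}|lebesgue. b r) = 0"
  shows "AE t in lebesgue. t \<in> {0<..<T} \<longrightarrow> b t = 0"
proof (cases "0 \<le> T")
  case True
  define B where "B r = indicator {0<..<T} r * b r" for r
  have Bi: "integrable lebesgue B" using b by (simp add: B_def[abs_def] set_integrable_def)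
  obtain g where g: "g \<in> borel_measurable lborel" "AE p in lborel. B p = g p"
    using completion_ex_borel_measurable_real[OF borel_measurable_integrable[OF Bi]] by auto
  note Bg = AE_completion[OF g(2)]
  have gi: "integrable lborel g"
    using Bi lebesgue_cong_AE(2)[OF Bg] g(1) by (simp add: integrable_completion)
  have gA: "(LINT x:A|lborel. g x) = (LINT x:A|lebesgue. B x)" if "A \<in> sets borel" for A
  proof -
    have "(LINT x:A|lebesgue. B x) = (LINT x:A|lebesgue. g x)"
      by (rule set_lebesgue_cong_AE(3)) (use Bg in \<open>auto elim: eventually_mono\<close>)
    also have "\<dots> = (LINT x:A|lborel. g x)"
      unfolding set_lebesgue_integral_def by (rule integral_completion) (use that g(1) in auto)
    finally show ?thesis ..
  qed
  have all: "(LINT x:UNIV|lborel. g x) = 0"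
  proof -
    have "(LINT x:UNIV|lebesgue. B x) = (LINT r:{0<..<T}|lebesgue. b r)"
      by (simp add: set_lebesgue_integral_def B_def)
    then show ?thesis using gA[of UNIV] z[of T] True by simp
  qed
  have sub: "set_integrable lborel A g" if "A \<in> sets borel" for A
    using integrable_mult_indicator[OF _ gi, of A] that by (simp add: set_integrable_def)
  have zero: "(LINT x:A|lborel. g x) = 0" if A: "A \<in> sets borel" for A
  proof -
    have 1: "A \<in> sigma_sets UNIV (range (\<lambda>a::real. {..a}))"
      using A by (simp add: borel_eq_atMost)
    have 2: "Int_stable (range (\<lambda>a::real. {..a}))" by (auto simp: Int_stable_def)
    have 3: "range (\<lambda>a::real. {..a}) \<subseteq> Pow UNIV" by simp
    show ?thesis using 2 3 1
    proof (induction rule: sigma_sets_induct_disjoint)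
      case (basic A)
      then obtain a where A: "A = {..a}" by auto
      define c where "c = max 0 (min a T)"
      have c: "c \<in> {0..T}" using True by (auto simp: c_def)
      have "(LINT x:A|lebesgue. B x) = (LINT r:{0<..<c}|lebesgue. b r)"
        unfolding set_lebesgue_integral_def
        by (rule lebesgue_cong_AE(3)) (use AE_neq[of c] in eventually_elim, auto simp: A B_def c_def indicator_def)
      then show ?case using gA[of A] A z[OF c] by simp
    next
      case (compl A)
      then have As: "A \<in> sets borel" by (simp add: borel_eq_atMost)
      have "(LINT x:A \<union> (UNIV - A)|lborel. g x) = (LINT x:A|lborel. g x) + (LINT x:UNIV - A|lborel. g x)"
        by (rule set_integral_Un) (use As in \<open>auto intro!: sub\<close>)
      then show ?case using compl all by simp
    next
      case (union A)
      then have As: "A i \<in> sets borel" for i by (auto simp: borel_eq_atMost)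
      have "(LINT x:(\<Union>i. A i)|lborel. g x) = (\<Sum>i. (LINT x:(A i)|lborel. g x))"
        by (rule lebesgue_integral_countable_add)
          (use As union in \<open>auto intro!: sub simp: disjoint_family_on_def\<close>)
      then show ?case using union by simp
    qed (auto simp: set_lebesgue_integral_def)
  qed
  have "AE x in lborel. g x = 0" by (rule sigma_finite_measure.density_zero[OF sigma_finite_lborel gi]) (use zero in auto)
  from AE_completion[OF this] Bg show ?thesis by eventually_elim (auto simp: B_def)
qed (auto intro!: AE_I2)

lemma primitive_unique:
  assumes a: "primitive T A a" and b: "primitive T A b"
  shows "AE t in lebesgue. t \<in> {0<..<T} \<longrightarrow> a t = b t"
proof -
  have i: "set_integrable lebesgue {0<..<T} a" "set_integrable lebesgue {0<..<T} b"
    using primitive_integrable[OF a] primitive_integrable[OF b] by auto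
  have "AE t in lebesgue. t \<in> {0<..<T} \<longrightarrow> a t - b t = 0"
  proof (rule LINT_zero_imp_AE_zero)
    show "set_integrable lebesgue {0<..<T} (\<lambda>t. a t - b t)" using i by (rule set_integral_diff)
    fix t assume t: "t \<in> {0..T}"
    then have it: "set_integrable lebesgue {0<..<t} a" "set_integrable lebesgue {0<..<t} b"
      using i by (auto intro: set_integrable_Ioo_sub)
    have "A t = A 0 + (LINT r:{0<..<t}|lebesgue. a r)" "A t = A 0 + (LINT r:{0<..<t}|lebesgue. b r)"
      using a b t unfolding primitive_def by blast+
    then show "(LINT r:{0<..<t}|lebesgue. a r - b r) = 0"
      using set_integral_diff(2)[OF it] by simp
  qed
  then show ?thesis by simp
qed

section \<open>Weak derivatives in time\<close>

lemma test_fun_primitive: assumes "test_fun T \<psi>" shows "primitive T \<psi> (deriv \<psi>)"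
  using assms unfolding test_fun_def
  by (intro primitive_C1) (auto simp: DERIV_deriv_iff_real_differentiable intro: continuous_on_subset)

lemma test_fun_boundary: assumes "test_fun T \<psi>" shows "\<psi> 0 = 0" "\<psi> T = 0"
  using assms unfolding test_fun_def by fastforce+

lemma primitive_weak_deriv:
  assumes "primitive T A a" "0 \<le> T" shows "weak_deriv T A a"
  unfolding weak_deriv_def
proof (intro allI impI)
  fix \<psi> assume "test_fun T \<psi>"
  from primitive_parts(3)[OF assms(1) test_fun_primitive[OF this] assms(2)] test_fun_boundary[OF this]
  show "(LINT t:{0<..<T}|lebesgue. A t * deriv \<psi> t) = - (LINT t:{0<..<T}|lebesgue. a t * \<psi> t)" by simp
qed

lemma weak_deriv_cong:
  assumes "weak_deriv T a b" "AE t in lebesgue. t \<in> {0<..<T} \<longrightarrow> a t = a' t" "AE t in lebesgue. t \<in> {0<..<T} \<longrightarrow> b t = b' t"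
  shows "weak_deriv T a' b'"
  unfolding weak_deriv_def
proof (intro allI impI)
  fix \<psi> assume *: "test_fun T \<psi>"
  have "(LINT t:{0<..<T}|lebesgue. a t * deriv \<psi> t) = (LINT t:{0<..<T}|lebesgue. a' t * deriv \<psi> t)"
    by (rule set_lebesgue_cong_AE(3)) (use assms(2) in \<open>auto elim: eventually_mono\<close>)
  moreover have "(LINT t:{0<..<T}|lebesgue. b t * \<psi> t) = (LINT t:{0<..<T}|lebesgue. b' t * \<psi> t)"
    by (rule set_lebesgue_cong_AE(3)) (use assms(3) in \<open>auto elim: eventually_mono\<close>)
  ultimately show "(LINT t:{0<..<T}|lebesgue. a' t * deriv \<psi> t) = - (LINT t:{0<..<T}|lebesgue. b' t * \<psi> t)"
    using assms(1) * unfolding weak_deriv_def by simp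
qed

text \<open>
  The du Bois-Reymond argument without mollifiers.  For a weight $W$ that is positive exactly on
  $(a,b)$, and $m$ the $W$-weighted mean of \<open>c\<close> on $[a,b]$, the function $W\cdot(c-m)$ has mean zero, so
  it is the derivative of a test function supported in $[a,b]$.  Testing with it gives
  $\int W\,(c-m)^2=0$.
\<close>

lemma weak_deriv_zero_const_inner:
  assumes "0 < a" "a < b" "b < T" and c: "continuous_on {0..T} c" and w0: "weak_deriv T c (\<lambda>t. 0)"
  shows "\<exists>m. \<forall>t\<in>{a<..<b}. c t = m"
proof -
  define W where "W t = max 0 ((t - a) * (b - t))" for t
  \<comment> \<open>Clamping the argument extends \<open>c\<close> continuously to the whole line.\<close>
  define C where "C t = c (max a (min b t))" for t
  have Wc: "continuous_on A W" for A unfolding W_def by (intro continuous_intros)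
  have Cc: "continuous_on A C" for A
    unfolding C_def using assms(1-3) by (intro continuous_on_compose2[OF c] continuous_intros) auto
  have C_eq: "C t = c t" if "t \<in> {a..b}" for t using that by (simp add: C_def)
  have W_pos: "W t > 0" if "t \<in> {a<..<b}" for t using that by (simp add: W_def)
  have W_out: "W t = 0" if "t \<notin> {a<..<b}" for t
  proof -
    have "(t - a) * (b - t) \<le> 0" using that assms(2) by (auto simp: mult_le_0_iff)
    then show ?thesis by (simp add: W_def)
  qed
  have W_ge: "W t \<ge> 0" for t by (simp add: W_def)
  define m where "m = integral {a..b} (\<lambda>t. W t * C t) / integral {a..b} W"
  define \<eta> where "\<eta> t = W t * (C t - m)" for t
  have \<eta>c: "continuous_on A \<eta>" for A unfolding \<eta>_def by (intro continuous_intros Wc Cc)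
  have "integral {a..b} W \<noteq> 0"
    using integral_eq_0_iff[OF Wc \<open>a < b\<close>] W_ge W_pos[of "(a+b)/2"] \<open>a < b\<close> by fastforce
  then have \<eta>0: "integral {a..b} \<eta> = 0"
  proof -
    have "integral {a..b} \<eta> = integral {a..b} (\<lambda>t. W t * C t - m * W t)"
      unfolding \<eta>_def by (intro arg_cong[where f="integral {a..b}"]) (simp add: fun_eq_iff algebra_simps)
    also have "\<dots> = integral {a..b} (\<lambda>t. W t * C t) - m * integral {a..b} W"
      by (subst integral_diff) (auto intro!: integrable_continuous_real continuous_intros Wc Cc)
    finally show ?thesis using \<open>integral {a..b} W \<noteq> 0\<close> by (simp add: m_def)
  qed
  obtain F where F: "\<And>x. (F has_vector_derivative \<eta> x) (at x)"
    using einterval_antiderivative[of "-\<infinity>" "\<infinity>" \<eta>] \<eta>c[of UNIV]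
    by (auto simp: continuous_on_eq_continuous_at)
  then have F': "(F has_real_derivative \<eta> x) (at x)" for x
    by (simp add: has_real_derivative_iff_has_vector_derivative)
  define \<psi> where "\<psi> t = F t - F a" for t
  have \<psi>': "(\<psi> has_real_derivative \<eta> t) (at t)" for t
    unfolding \<psi>_def using F'[of t] by (auto intro!: derivative_eq_intros)
  then have d\<psi>: "deriv \<psi> = \<eta>" by (auto intro: DERIV_imp_deriv)
  have "F b - F a = integral {a..b} \<eta>"
    using fundamental_theorem_of_calculus[of a b F \<eta>] F assms(2)
    by (auto intro: integral_unique[symmetric] has_vector_derivative_at_within)
  then have Fb: "F b = F a" using \<eta>0 by simp
  have zero: "\<psi> t = 0" if t: "t \<notin> {a..b}" for t
  proof (cases "t < a")
    case True
    have "(\<eta> has_integral (F a - F t)) {t..a}"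
      using True F by (intro fundamental_theorem_of_calculus) (auto intro: has_vector_derivative_at_within)
    moreover have "(\<eta> has_integral 0) {t..a}"
      by (rule has_integral_eq[where f="\<lambda>_. 0"]) (auto simp: \<eta>_def W_out)
    ultimately have "F a - F t = 0" by (rule has_integral_unique)
    then show ?thesis by (simp add: \<psi>_def)
  next
    case False
    then have "t > b" using t by auto
    then have "(\<eta> has_integral (F t - F b)) {b..t}"
      using F by (intro fundamental_theorem_of_calculus) (auto intro: has_vector_derivative_at_within)
    moreover have "(\<eta> has_integral 0) {b..t}"
      by (rule has_integral_eq[where f="\<lambda>_. 0"]) (auto simp: \<eta>_def W_out)
    ultimately have "F t - F b = 0" by (rule has_integral_unique)
    then show ?thesis using Fb by (simp add: \<psi>_def)
  qed
  have "test_fun T \<psi>"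
    unfolding test_fun_def d\<psi> using \<psi>' zero assms(1-3) \<eta>c
    by (auto simp: real_differentiable_def)
  with w0 have "(LINT t:{0<..<T}|lebesgue. c t * \<eta> t) = 0" unfolding weak_deriv_def d\<psi>[symmetric] by simp
  also have "(LINT t:{0<..<T}|lebesgue. c t * \<eta> t) = (LINT t:{a<..<b}|lebesgue. C t * \<eta> t)"
    unfolding set_lebesgue_integral_def
    by (rule Bochner_Integration.integral_cong) (use assms in \<open>auto simp: indicator_def \<eta>_def W_out C_eq\<close>)
  also have "\<dots> = integral {a..b} (\<lambda>t. C t * \<eta> t)"
    by (rule LINT_Ioo_integral) (intro continuous_intros Cc \<eta>c)
  finally have "integral {a..b} (\<lambda>t. C t * \<eta> t) = 0" .
  then have "integral {a..b} (\<lambda>t. C t * \<eta> t - m * \<eta> t) = 0"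
    using \<eta>0 by (subst integral_diff) (auto intro!: integrable_continuous_real continuous_intros Cc \<eta>c)
  then have "integral {a..b} (\<lambda>t. W t * (C t - m)\<^sup>2) = 0"
    by (simp add: \<eta>_def power2_eq_square algebra_simps)
  then have "\<forall>t\<in>{a..b}. W t * (C t - m)\<^sup>2 = 0"
    by (subst (asm) integral_eq_0_iff) (auto intro!: continuous_intros Wc Cc mult_nonneg_nonneg simp: assms(2) W_ge)
  then have "\<forall>t\<in>{a<..<b}. c t = m" using W_pos C_eq by force
  then show ?thesis by blast
qed

text \<open>
  Two points of $(0,T)$ lie in a common compactly contained interval; the end points are reached by
  continuity.
\<close>

lemma weak_deriv_zero_const:
  assumes T: "0 < T" and c: "continuous_on {0..T} c" and w0: "weak_deriv T c (\<lambda>t. 0)" and t: "t \<in> {0..T}"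
  shows "c t = c 0"
proof -
  have inner: "c x = c (T/2)" if x: "x \<in> {0<..<T}" for x
  proof -
    define a b where "a = min x (T/2) / 2" and "b = (max x (T/2) + T) / 2"
    have "0 < a" "a < b" "b < T" "x \<in> {a<..<b}" "T/2 \<in> {a<..<b}"
      using x T unfolding a_def b_def by (auto simp: min_def max_def field_simps)
    with weak_deriv_zero_const_inner[OF _ _ _ c w0, of a b] show ?thesis by metis
  qed
  have "c x = c (T/2)" if x: "x \<in> {0..T}" for x
  proof (rule continuous_AE_eq[OF T c continuous_on_const _ x])
    show "AE t in lebesgue. t \<in> {0<..<T} \<longrightarrow> c t = c (T/2)" using inner by blast
  qed
  from this[OF t] this[of 0] T show ?thesis by simp
qed

text \<open>
  The converse of \<open>primitive_weak_deriv\<close>: the difference of \<open>a\<close> and the primitive of \<open>b\<close> has vanishing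
  weak derivative, hence is constant.
\<close>

lemma weak_deriv_primitive:
  assumes T: "0 < T" and a: "continuous_on {0..T} a" and b: "set_integrable lebesgue {0<..<T} b"
    and w: "weak_deriv T a b"
  shows "primitive T a b"
proof -
  define B where "B t = (LINT r:{0<..<t}|lebesgue. b r)" for t
  have B: "primitive T B b" unfolding primitive_def B_def using b by (simp add: set_lebesgue_integral_def)
  have Bc: "continuous_on {0..T} B" by (rule primitive_continuous[OF B])
  have wB: "weak_deriv T B b" using primitive_weak_deriv[OF B] T by simp
  have "weak_deriv T (\<lambda>t. a t - B t) (\<lambda>t. 0)"
    unfolding weak_deriv_def
  proof (intro allI impI)
    fix \<psi> assume \<psi>: "test_fun T \<psi>"
    then have dc: "continuous_on {0..T} (deriv \<psi>)" by (auto simp: test_fun_def intro: continuous_on_subset)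
    have "(LINT t:{0<..<T}|lebesgue. (a t - B t) * deriv \<psi> t) =
      (LINT t:{0<..<T}|lebesgue. a t * deriv \<psi> t) - (LINT t:{0<..<T}|lebesgue. B t * deriv \<psi> t)"
      unfolding left_diff_distrib
      by (rule set_integral_diff(2)) (intro continuous_Ioo_integrable continuous_intros a Bc dc)+
    then show "(LINT t:{0<..<T}|lebesgue. (a t - B t) * deriv \<psi> t) = - (LINT t:{0<..<T}|lebesgue. 0 * \<psi> t)"
      using w wB \<psi> unfolding weak_deriv_def by simp
  qed
  from weak_deriv_zero_const[OF T continuous_on_diff[OF a Bc] this]
  have "a t - B t = a 0 - B 0" if "t \<in> {0..T}" for t using that .
  moreover have "B 0 = 0" by (simp add: B_def set_lebesgue_integral_def)
  ultimately have "a t = a 0 + B t" if "t \<in> {0..T}" for t using that by fastforce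
  then show ?thesis using b unfolding primitive_def B_def by blast
qed

lemma weak_deriv_unique:
  assumes T: "0 < T" and w1: "weak_deriv T a b1" and w2: "weak_deriv T a b2"
    and i1: "set_integrable lebesgue {0<..<T} b1" and i2: "set_integrable lebesgue {0<..<T} b2"
  shows "AE t in lebesgue. t \<in> {0<..<T} \<longrightarrow> b1 t = b2 t"
proof -
  have i: "set_integrable lebesgue {0<..<T} (\<lambda>t. b1 t - b2 t)" using i1 i2 by (rule set_integral_diff)
  have "weak_deriv T (\<lambda>t. 0) (\<lambda>t. b1 t - b2 t)"
    unfolding weak_deriv_def
  proof (intro allI impI)
    fix \<psi> assume \<psi>: "test_fun T \<psi>"
    have m: "set_integrable lebesgue {0<..<T} (\<lambda>t. b t * \<psi> t)" if "set_integrable lebesgue {0<..<T} b" for b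
      using integrable_mult_primitive[OF that test_fun_primitive[OF \<psi>]] T by simp
    show "(LINT t:{0<..<T}|lebesgue. 0 * deriv \<psi> t) = - (LINT t:{0<..<T}|lebesgue. (b1 t - b2 t) * \<psi> t)"
      using w1 w2 \<psi> set_integral_diff(2)[OF m[OF i1] m[OF i2]] unfolding weak_deriv_def left_diff_distrib by simp
  qed
  from weak_deriv_primitive[OF T continuous_on_const i this]
  have "primitive T (\<lambda>t. 0) (\<lambda>t. b1 t - b2 t)" .
  moreover have "primitive T (\<lambda>t. 0) (\<lambda>t. 0)" by (simp add: primitive_def set_integrable_def)
  ultimately show ?thesis by (auto dest: primitive_unique)
qed

text \<open>
  Only the pairings of the continuous representative with fixed elements of $L^2$ are used below, and the
  Cauchy--Schwarz inequality makes these continuous in time.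
\<close>

lemma L2_value_atE:
  assumes "L2_value_at T u a v"
  obtains U where "\<And>t. t \<in> {0..T} \<Longrightarrow> U t \<in> L2 Dom"
    and "\<And>w. w \<in> L2 Dom \<Longrightarrow> continuous_on {0..T} (\<lambda>t. ip (U t) w)"
    and "AE t in lebesgue. t \<in> {0<..<T} \<longrightarrow> (AE x in lebesgue. x \<in> Dom \<longrightarrow> U t x = u t x)"
    and "\<And>w. ip (U a) w = ip v w"
proof -
  obtain U where U: "\<And>t. t \<in> {0..T} \<Longrightarrow> U t \<in> L2 Dom"
    and cont: "\<And>t. t \<in> {0..T} \<Longrightarrow> ((\<lambda>r. L2_norm (\<lambda>x. U r x - U t x)) \<longlongrightarrow> 0) (at t within {0..T})"
    and ae: "AE t in lebesgue. t \<in> {0<..<T} \<longrightarrow> (AE x in lebesgue. x \<in> Dom \<longrightarrow> U t x = u t x)"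
    and Ua: "AE x in lebesgue. x \<in> Dom \<longrightarrow> U a x = v x"
    using assms unfolding L2_value_at_def by blast
  have "continuous_on {0..T} (\<lambda>t. ip (U t) w)" if w: "w \<in> L2 Dom" for w
    unfolding continuous_on_def
  proof
    fix t assume t: "t \<in> {0..T}"
    have "((\<lambda>r. L2_norm (\<lambda>x. U r x - U t x) * L2_norm w) \<longlongrightarrow> 0) (at t within {0..T})"
      using tendsto_mult_right[OF cont[OF t], of "L2_norm w"] by simp
    moreover have "\<forall>\<^sub>F r in at t within {0..T}. norm (ip (U r) w - ip (U t) w) \<le> L2_norm (\<lambda>x. U r x - U t x) * L2_norm w"
      unfolding eventually_at_filter
    proof (rule always_eventually, intro allI impI)
      fix r assume "r \<in> {0..T}"
      then have "ip (U r) w - ip (U t) w = ip (\<lambda>x. U r x - U t x) w" using U t w by (simp add: ip_diff)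
      then show "norm (ip (U r) w - ip (U t) w) \<le> L2_norm (\<lambda>x. U r x - U t x) * L2_norm w"
        using ip_le_L2_norm[OF L2_diff w] U t \<open>r \<in> {0..T}\<close> by simp
    qed
    ultimately have "((\<lambda>r. ip (U r) w - ip (U t) w) \<longlongrightarrow> 0) (at t within {0..T})"
      by (rule Lim_null_comparison[rotated])
    then show "((\<lambda>t. ip (U t) w) \<longlongrightarrow> ip (U t) w) (at t within {0..T})" by (rule LIM_zero_cancel)
  qed
  with U ae ip_cong_AE[OF Ua] that show thesis by blast
qed

lemma AE_ip_cong:
  assumes "AE t in lebesgue. t \<in> I \<longrightarrow> (AE x in lebesgue. x \<in> Dom \<longrightarrow> U t x = u t x)"
  shows "AE t in lebesgue. t \<in> I \<longrightarrow> (\<forall>w. ip (U t) w = ip (u t) w)"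
  using assms by eventually_elim (use ip_cong_AE in blast)

section \<open>Eigenfunction expansions\<close>

lemma H0s_L2: "v \<in> H0s s \<Longrightarrow> v \<in> L2 Dom"
  unfolding H0s_def Hs_def by (auto intro: L2_subset)

lemma gagliardo_scale: "gagliardo s u (\<lambda>x. c * v x) = (\<lambda>p. c * gagliardo s u v p)"
  unfolding gagliardo_def by (auto simp: fun_eq_iff right_diff_distrib[symmetric] mult_ac)

lemma gagliardo_commute: "gagliardo s u v = gagliardo s v u"
  unfolding gagliardo_def by (auto simp: fun_eq_iff mult_ac)

lemma form_scale: "form s u (\<lambda>x. c * v x) = c * form s u v"
  unfolding form_def by (simp add: gagliardo_scale)

lemma form_commute: "form s u v = form s v u"
  unfolding form_def gagliardo_commute[of s u v] ..

lemma gagliardo_self_nonneg: "0 \<le> gagliardo s u u p"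
  unfolding gagliardo_def by (cases p) simp

lemma gagliardo_self_scale: "gagliardo s (\<lambda>x. c * v x) (\<lambda>x. c * v x) = (\<lambda>p. c\<^sup>2 * gagliardo s v v p)"
  by (simp add: gagliardo_scale gagliardo_commute[of s "\<lambda>x. c * v x"] power2_eq_square mult.assoc)

lemma H0s_scale: "v \<in> H0s s \<Longrightarrow> (\<lambda>x. c * v x) \<in> H0s s"
  unfolding H0s_def Hs_def mem_Collect_eq gagliardo_self_scale by (auto intro: L2_scale elim: eventually_mono)

lemma Hs_norm_scale: "(Hs_norm s (\<lambda>x. c * v x))\<^sup>2 = c\<^sup>2 * (Hs_norm s v)\<^sup>2"
proof -
  have nn: "0 \<le> (LINT x|lebesgue. (w x)\<^sup>2) + (LINT p|lebesgue. gagliardo s w w p)" for w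
    by (intro add_nonneg_nonneg Bochner_Integration.integral_nonneg) (auto simp: gagliardo_self_nonneg)
  show ?thesis unfolding Hs_norm_def real_sqrt_pow2[OF nn]
    by (simp add: gagliardo_self_scale power_mult_distrib algebra_simps)
qed

lemma C_frac_nonneg: "0 < s \<Longrightarrow> s < 1 \<Longrightarrow> 0 \<le> C_frac s"
  unfolding C_frac_def by (intro divide_nonneg_nonneg mult_nonneg_nonneg less_imp_le[OF Gamma_real_pos]) auto

lemma form_self_nonneg: "0 < s \<Longrightarrow> s < 1 \<Longrightarrow> 0 \<le> form s u u"
  unfolding form_def using C_frac_nonneg[of s]
  by (intro mult_nonneg_nonneg Bochner_Integration.integral_nonneg) (auto simp: gagliardo_self_nonneg)

locale spectral =
  fixes s :: real and lam :: "nat \<Rightarrow> real" and \<phi> :: "nat \<Rightarrow> real \<Rightarrow> real"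
  assumes s: "0 < s" "s < 1" and eigen: "eigensystem s lam \<phi>"
begin

text \<open>
  The weak eigenvalue equation is available for every \<open>v\<close> in the form domain; the symmetry of the form puts
  the eigenfunction in the second slot, where the test functions of the evolution equation stand.
\<close>

lemma phi_H0s: "\<phi> k \<in> H0s s"
  and form_phi: "v \<in> H0s s \<Longrightarrow> form s v (\<phi> k) = lam k * ip v (\<phi> k)"
  and ortho: "ip (\<phi> j) (\<phi> k) = (if j = k then 1 else 0)"
proof -
  have f: "frac_lap s (\<phi> k) (\<lambda>x. lam k * \<phi> k x)" using eigen by (simp add: eigensystem_def)
  then show "\<phi> k \<in> H0s s" by (simp add: frac_lap_def)
  show "form s v (\<phi> k) = lam k * ip v (\<phi> k)" if "v \<in> H0s s"
    using f that unfolding frac_lap_def by (simp add: form_commute[of s v] ip_scale ip_commute[of v])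
  show "ip (\<phi> j) (\<phi> k) = (if j = k then 1 else 0)" using eigen by (simp add: eigensystem_def)
qed

lemma phi_L2: "\<phi> k \<in> L2 Dom"
  using phi_H0s by (rule H0s_L2)

text \<open>
  An eigenvalue is the value of the nonnegative form at a normalized eigenfunction.
\<close>

lemma lam_nonneg: "0 \<le> lam k"
  using form_phi[OF phi_H0s[of k], of k] form_self_nonneg[OF s, of "\<phi> k"] ortho[of k k] by simp

text \<open>
  The residual of the \<open>N\<close>-th partial sum is orthogonal to the first \<open>N\<close> eigenfunctions, which removes the
  cross terms from its norm.
\<close>

lemma residual:
  assumes g: "g \<in> L2 Dom"
  defines "r N \<equiv> \<lambda>x. g x - (\<Sum>k<N. ip g (\<phi> k) * \<phi> k x)"
  shows "r N \<in> L2 Dom" "b \<in> L2 Dom \<Longrightarrow> ip (r N) b = ip g b - (\<Sum>k<N. ip g (\<phi> k) * ip b (\<phi> k))"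
    and "ip (r N) (r N) = ip g g - (\<Sum>k<N. (ip g (\<phi> k))\<^sup>2)"
proof -
  have S: "(\<lambda>x. \<Sum>k<N. ip g (\<phi> k) * \<phi> k x) \<in> L2 Dom" by (intro L2_sum phi_L2)
  show r: "r N \<in> L2 Dom" unfolding r_def by (rule L2_diff[OF g S])
  show *: "ip (r N) b = ip g b - (\<Sum>k<N. ip g (\<phi> k) * ip b (\<phi> k))" if b: "b \<in> L2 Dom" for b
    unfolding r_def by (simp add: ip_diff[OF g S b] ip_sum[OF phi_L2 b] ip_commute[of _ b])
  have 0: "ip (\<phi> j) (r N) = 0" if "j < N" for j
  proof -
    have "(\<Sum>k<N. ip g (\<phi> k) * ip (\<phi> j) (\<phi> k)) = (\<Sum>k<N. if k = j then ip g (\<phi> j) else 0)"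
      by (rule sum.cong) (auto simp: ortho)
    also have "\<dots> = ip g (\<phi> j)" using that by simp
    finally show ?thesis using *[OF phi_L2, of j] by (simp add: ip_commute)
  qed
  have "ip (r N) (r N) = ip g (r N) - (\<Sum>k<N. ip g (\<phi> k) * ip (r N) (\<phi> k))" by (rule *[OF r])
  also have "\<dots> = ip (r N) g" using 0 by (simp add: ip_commute)
  also have "\<dots> = ip g g - (\<Sum>k<N. (ip g (\<phi> k))\<^sup>2)" using *[OF g] by (simp add: power2_eq_square)
  finally show "ip (r N) (r N) = ip g g - (\<Sum>k<N. (ip g (\<phi> k))\<^sup>2)" .
qed

lemma Bessel: "g \<in> L2 Dom \<Longrightarrow> (\<Sum>k<N. (ip g (\<phi> k))\<^sup>2) \<le> ip g g"
  using residual(3)[of g N] ip_self_nonneg[of "\<lambda>x. g x - (\<Sum>k<N. ip g (\<phi> k) * \<phi> k x)"] by linarith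

lemma Parseval:
  assumes g: "g \<in> L2 Dom" and b: "b \<in> L2 Dom"
  shows "(\<lambda>k. ip g (\<phi> k) * ip b (\<phi> k)) sums ip g b"
proof -
  let ?r = "\<lambda>N x. g x - (\<Sum>k<N. ip g (\<phi> k) * \<phi> k x)"
  have "(\<lambda>N. L2_norm (?r N)) \<longlonglongrightarrow> 0" using eigen g by (simp add: eigensystem_def)
  then have "(\<lambda>N. L2_norm (?r N) * L2_norm b) \<longlonglongrightarrow> 0" using tendsto_mult_right[of _ 0 _ "L2_norm b"] by simp
  then have "(\<lambda>N. ip (?r N) b) \<longlonglongrightarrow> 0"
    by (rule Lim_null_comparison[rotated]) (simp add: ip_le_L2_norm[OF residual(1)[OF g] b])
  then have "(\<lambda>N. ip g b - ip (?r N) b) \<longlonglongrightarrow> ip g b - 0" by (intro tendsto_intros)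
  then show ?thesis by (simp add: sums_def residual(2)[OF g b])
qed

lemma summable_coeff_square: "g \<in> L2 Dom \<Longrightarrow> summable (\<lambda>k. (ip g (\<phi> k))\<^sup>2)"
  using Parseval[of g g] by (simp add: power2_eq_square sums_iff)

lemma ip_orthonormal_sum:
  assumes "finite I"
  shows "ip (\<lambda>x. \<Sum>k\<in>I. c k * \<phi> k x) (\<lambda>x. \<Sum>k\<in>I. c k * \<phi> k x) = (\<Sum>k\<in>I. (c k)\<^sup>2)"
proof -
  let ?S = "\<lambda>x. \<Sum>k\<in>I. c k * \<phi> k x"
  have S: "?S \<in> L2 Dom" by (intro L2_sum phi_L2)
  have c: "ip ?S (\<phi> j) = c j" if "j \<in> I" for j
  proof -
    have "ip ?S (\<phi> j) = (\<Sum>k\<in>I. if k = j then c j else 0)"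
      unfolding ip_sum[OF phi_L2 phi_L2] by (rule sum.cong) (auto simp: ortho)
    then show ?thesis using that assms by simp
  qed
  have "ip ?S ?S = (\<Sum>k\<in>I. c k * ip (\<phi> k) ?S)" by (rule ip_sum[OF phi_L2 S])
  also have "\<dots> = (\<Sum>k\<in>I. (c k)\<^sup>2)"
    by (rule sum.cong) (auto simp: ip_commute[of _ ?S] c power2_eq_square)
  finally show ?thesis .
qed

lemma mode_sum_L2Q:
  assumes "finite I" "\<And>k. k \<in> I \<Longrightarrow> continuous_on {0..T} (a k)"
  shows "(\<lambda>t x. \<Sum>k\<in>I. c k * a k t * \<phi> k x) \<in> L2Q T Dom"
  by (rule L2Q_sum[OF assms(1)], rule L2Q_tensor[OF _ phi_L2], rule continuous_Ioo_L2)
     (use assms(2) in \<open>auto intro: continuous_intros\<close>)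

text \<open>
  By Fubini's theorem and orthonormality in space, the squared norm is
  $\int_0^T\sum_k c_k^2\,a_k(t)^2\,dt$.
\<close>

lemma mode_sum_norm:
  assumes T: "0 \<le> T" and I: "finite I" and a: "\<And>k. k \<in> I \<Longrightarrow> continuous_on {0..T} (a k)"
    and C: "\<And>k t. k \<in> I \<Longrightarrow> t \<in> {0..T} \<Longrightarrow> \<bar>a k t\<bar> \<le> C"
  shows "(LINT p|lebesgue. (indicator {0<..<T} (fst p) * indicator Dom (snd p) * (\<Sum>k\<in>I. c k * a k (fst p) * \<phi> k (snd p)))\<^sup>2)
    \<le> C\<^sup>2 * T * (\<Sum>k\<in>I. (c k)\<^sup>2)"
proof -
  let ?u = "\<lambda>t x. \<Sum>k\<in>I. c k * a k t * \<phi> k x"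
  let ?F = "\<lambda>p. (indicator {0<..<T} (fst p) * indicator Dom (snd p) * ?u (fst p) (snd p))\<^sup>2"
  have "integrable lebesgue ?F" using mode_sum_L2Q[OF I a, of "\<lambda>k. k" c] unfolding L2Q_iff by simp
  from lebesgue_Fubini(3)[OF this]
  have "integral\<^sup>L lebesgue ?F = (LINT t|lebesgue. LINT x|lebesgue. ?F (t, x))" ..
  also have "\<dots> = (LINT t:{0<..<T}|lebesgue. ip (?u t) (?u t))"
    unfolding set_lebesgue_integral_def ip_def
  proof (rule Bochner_Integration.integral_cong[OF refl])
    fix t :: real
    have "(\<lambda>x. ?F (t, x)) = (\<lambda>x. indicator {0<..<T} t * (indicator Dom x *\<^sub>R (?u t x * ?u t x)))"
      by (auto simp: indicator_def power2_eq_square)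
    then show "(LINT x|lebesgue. ?F (t, x)) = indicat_real {0<..<T} t *\<^sub>R (LINT x|lebesgue. indicat_real Dom x *\<^sub>R (?u t x * ?u t x))"
      by simp
  qed
  also have "\<dots> = (LINT t:{0<..<T}|lebesgue. (\<Sum>k\<in>I. (c k * a k t)\<^sup>2))"
    by (simp only: ip_orthonormal_sum[OF I])
  also have "\<dots> \<le> C\<^sup>2 * (\<Sum>k\<in>I. (c k)\<^sup>2) * T"
  proof -
    have "(\<Sum>k\<in>I. (c k * a k t)\<^sup>2) \<le> C\<^sup>2 * (\<Sum>k\<in>I. (c k)\<^sup>2)" if t: "t \<in> {0..T}" for t
      unfolding sum_distrib_left
    proof (rule sum_mono)
      fix k assume k: "k \<in> I"
      have "(a k t)\<^sup>2 \<le> C\<^sup>2" using power_mono[OF C[OF k t], of 2] by simp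
      then show "(c k * a k t)\<^sup>2 \<le> C\<^sup>2 * (c k)\<^sup>2" unfolding power_mult_distrib
        by (subst mult.commute) (rule mult_right_mono, auto)
    qed
    then have "AE t in lebesgue. t \<in> {0<..<T} \<longrightarrow> \<bar>\<Sum>k\<in>I. (c k * a k t)\<^sup>2\<bar> \<le> C\<^sup>2 * (\<Sum>k\<in>I. (c k)\<^sup>2)"
      by (auto simp: abs_of_nonneg sum_nonneg)
    from LINT_Ioo_bound[OF this] T show ?thesis by (simp add: sum_nonneg)
  qed
  finally show ?thesis by (simp add: mult_ac)
qed

text \<open>
  Bounded time factors keep a square-summable sequence of coefficients square-summable, uniformly in time, so
  the partial sums form a Cauchy sequence in $L^2((0,T)\times(-1,1))$.  Of the convergence in norm only the
  pairing with products $\psi(t)v(x)$ is retained.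
\<close>

lemma mode_series:
  assumes T: "0 \<le> T" and c: "summable (\<lambda>k. (c k)\<^sup>2)"
    and a: "\<And>k. continuous_on {0..T} (a k)" and C: "\<And>k t. t \<in> {0..T} \<Longrightarrow> \<bar>a k t\<bar> \<le> C"
  shows "\<exists>g\<in>L2Q T Dom. \<forall>\<psi>\<in>L2 {0<..<T}. \<forall>v\<in>L2 Dom.
      (\<lambda>N. LINT t:{0<..<T}|lebesgue. \<psi> t * ip (\<lambda>x. \<Sum>k<N. c k * a k t * \<phi> k x) v) \<longlonglongrightarrow>
      (LINT t:{0<..<T}|lebesgue. \<psi> t * ip (g t) v)"
proof -
  define S where "S N t x = (\<Sum>k<N. c k * a k t * \<phi> k x)" for N :: nat and t x
  define r where "r v p = indicator {0<..<T} (fst p) * indicator Dom (snd p) * (v (fst p) (snd p) :: real)" for v p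
  have SQ: "S N \<in> L2Q T Dom" for N
    unfolding S_def by (rule mode_sum_L2Q) (auto intro: a)
  have rm: "r v \<in> borel_measurable lebesgue" and ri: "integrable lebesgue (\<lambda>p. (r v p)\<^sup>2)" if "v \<in> L2Q T Dom" for v
    using that unfolding L2Q_iff r_def by simp_all
  have sdiff: "(LINT p|lebesgue. (r (S m) p - r (S n) p)\<^sup>2) \<le> C\<^sup>2 * T * (\<Sum>k\<in>{n..<m}. (c k)\<^sup>2)" if "n \<le> m" for m n
  proof -
    have "S m t x - S n t x = (\<Sum>k\<in>{n..<m}. c k * a k t * \<phi> k x)" for t x
      unfolding S_def using that by (simp add: sum_diff lessThan_atLeast0 sum_diff_nat_ivl)
    then have "r (S m) p - r (S n) p = indicator {0<..<T} (fst p) * indicator Dom (snd p) * (\<Sum>k\<in>{n..<m}. c k * a k (fst p) * \<phi> k (snd p))" for p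
      unfolding r_def by (simp flip: right_diff_distrib)
    then show ?thesis
      using mode_sum_norm[OF T _ a C, of "{n..<m}" c] by simp
  qed
  obtain G where G: "G \<in> borel_measurable lebesgue" "integrable lebesgue (\<lambda>p. (G p)\<^sup>2)"
    and Gl: "(\<lambda>n. LINT p|lebesgue. (G p - r (S n) p)\<^sup>2) \<longlonglongrightarrow> 0"
  proof (rule Riesz_Fischer_L2[where g = "\<lambda>n. r (S n)" and M = lebesgue])
    show "r (S n) \<in> borel_measurable lebesgue" "integrable lebesgue (\<lambda>p. (r (S n) p)\<^sup>2)" for n
      by (rule rm[OF SQ], rule ri[OF SQ])
    fix e :: real assume e: "e > 0"
    define e' where "e' = e / (C\<^sup>2 * T + 1)"
    have pos: "C\<^sup>2 * T + 1 > 0" using T by (simp add: add_nonneg_pos)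
    then have e': "e' > 0" using e by (simp add: e'_def)
    obtain N where N: "\<And>m n. m \<ge> N \<Longrightarrow> norm (\<Sum>k\<in>{m..<n}. (c k)\<^sup>2) < e'"
      using e' c unfolding summable_Cauchy by metis
    have le: "(LINT p|lebesgue. (r (S m) p - r (S n) p)\<^sup>2) \<le> e" if "N \<le> n" "n \<le> m" for m n
    proof -
      have "(LINT p|lebesgue. (r (S m) p - r (S n) p)\<^sup>2) \<le> C\<^sup>2 * T * (\<Sum>k\<in>{n..<m}. (c k)\<^sup>2)" by (rule sdiff[OF that(2)])
      also have "\<dots> \<le> (C\<^sup>2 * T + 1) * e'"
        by (rule mult_mono) (use N[OF that(1), of m] T in \<open>auto simp: sum_nonneg\<close>)
      also have "\<dots> = e" using pos by (simp add: e'_def)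
      finally show ?thesis .
    qed
    have "(LINT p|lebesgue. (r (S m) p - r (S n) p)\<^sup>2) \<le> e" if "N \<le> n" "N \<le> m" for m n
    proof (cases "n \<le> m")
      case True then show ?thesis using le that by blast
    next
      case False
      then have "(LINT p|lebesgue. (r (S n) p - r (S m) p)\<^sup>2) \<le> e" using le that by simp
      then show ?thesis by (simp only: power2_commute)
    qed
    then show "\<exists>N. \<forall>m\<ge>N. \<forall>n\<ge>N. (LINT p|lebesgue. (r (S m) p - r (S n) p)\<^sup>2) \<le> e" by blast
  qed
  define g where "g t x = G (t, x)" for t x
  have gQ: "g \<in> L2Q T Dom"
  proof -
    have "open ({0<..<T} \<times> Dom)" by (intro open_Times) auto
    then have meas: "{0<..<T} \<times> Dom \<in> sets lebesgue" by (metis borel_open sets_completionI_sets sets_lborel)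
    then have ind: "(\<lambda>p. indicat_real ({0<..<T} \<times> Dom) p) \<in> borel_measurable lebesgue"
      by (rule borel_measurable_indicator)
    have eq: "indicator {0<..<T} (fst p) * indicator Dom (snd p) * g (fst p) (snd p) = indicator ({0<..<T} \<times> Dom) p * G p"
      "(indicator {0<..<T} (fst p) * indicator Dom (snd p) * g (fst p) (snd p))\<^sup>2 = indicator ({0<..<T} \<times> Dom) p *\<^sub>R (G p)\<^sup>2" for p
      by (auto simp: g_def indicator_def mem_Times_iff)
    have "integrable lebesgue (\<lambda>p. indicator ({0<..<T} \<times> Dom) p *\<^sub>R (G p)\<^sup>2)"
      by (rule integrable_mult_indicator[OF meas G(2)])
    then have "integrable lebesgue (\<lambda>p. (indicator {0<..<T} (fst p) * indicator Dom (snd p) * g (fst p) (snd p))\<^sup>2)"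
      unfolding eq(2) .
    moreover have "(\<lambda>p. indicator {0<..<T} (fst p) * indicator Dom (snd p) * g (fst p) (snd p)) \<in> borel_measurable lebesgue"
      unfolding eq(1) by (rule borel_measurable_times[OF ind G(1)])
    ultimately show ?thesis unfolding L2Q_iff by blast
  qed
  have weak: "(\<lambda>N. LINT t:{0<..<T}|lebesgue. \<psi> t * ip (S N t) v) \<longlonglongrightarrow> (LINT t:{0<..<T}|lebesgue. \<psi> t * ip (g t) v)"
    if \<psi>: "\<psi> \<in> L2 {0<..<T}" and v: "v \<in> L2 Dom" for \<psi> v
  proof -
    let ?w = "\<lambda>t x. \<psi> t * v x"
    have wQ: "?w \<in> L2Q T Dom" by (rule L2Q_tensor[OF \<psi> v])
    have pair: "(LINT t:{0<..<T}|lebesgue. \<psi> t * ip (h t) v) = (LINT p|lebesgue. r h p * r ?w p)"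
      if h: "h \<in> L2Q T Dom" for h
    proof -
      have i: "integrable lebesgue (\<lambda>p. r h p * r ?w p)"
        by (rule integrable_mult_of_squares[OF rm[OF h] rm[OF wQ] ri[OF h] ri[OF wQ]])
      have "(LINT p|lebesgue. r h p * r ?w p) = (LINT t|lebesgue. LINT x|lebesgue. r h (t, x) * r ?w (t, x))"
        using lebesgue_Fubini(3)[OF i] ..
      also have "\<dots> = (LINT t:{0<..<T}|lebesgue. \<psi> t * ip (h t) v)"
        unfolding set_lebesgue_integral_def ip_def
      proof (rule Bochner_Integration.integral_cong[OF refl])
        fix t :: real
        have "(\<lambda>x. r h (t, x) * r ?w (t, x)) = (\<lambda>x. indicator {0<..<T} t * \<psi> t * (indicator Dom x *\<^sub>R (h t x * v x)))"
          by (auto simp: indicator_def r_def)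
        then show "(LINT x|lebesgue. r h (t, x) * r ?w (t, x)) = indicat_real {0<..<T} t *\<^sub>R (\<psi> t * (LINT x|lebesgue. indicat_real Dom x *\<^sub>R (h t x * v x)))"
          by simp
      qed
      finally show ?thesis ..
    qed
    let ?W = "LINT p|lebesgue. (r ?w p)\<^sup>2"
    have cs: "\<bar>(LINT p|lebesgue. r g p * r ?w p) - (LINT p|lebesgue. r (S N) p * r ?w p)\<bar> \<le>
      sqrt (LINT p|lebesgue. (G p - r (S N) p)\<^sup>2) * sqrt ?W" for N
    proof -
      have mD: "(\<lambda>p. G p - r (S N) p) \<in> borel_measurable lebesgue"
        using G(1) rm[OF SQ, of N] by (rule borel_measurable_diff)
      have iD: "integrable lebesgue (\<lambda>p. (G p - r (S N) p)\<^sup>2)"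
        using integrable_square_lincomb[OF G(1) rm[OF SQ] G(2) ri[OF SQ], of "-1" N] by simp
      have "(LINT p|lebesgue. r g p * r ?w p) - (LINT p|lebesgue. r (S N) p * r ?w p) =
        (LINT p|lebesgue. r g p * r ?w p - r (S N) p * r ?w p)"
        by (rule Bochner_Integration.integral_diff[symmetric])
          (intro integrable_mult_of_squares rm ri SQ gQ wQ)+
      also have "\<dots> = (LINT p|lebesgue. (G p - r (S N) p) * r ?w p)"
        by (rule Bochner_Integration.integral_cong) (auto simp: r_def g_def indicator_def algebra_simps)
      finally have "\<bar>(LINT p|lebesgue. r g p * r ?w p) - (LINT p|lebesgue. r (S N) p * r ?w p)\<bar> =
        sqrt ((LINT p|lebesgue. (G p - r (S N) p) * r ?w p)\<^sup>2)" by simp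
      also have "\<dots> \<le> sqrt ((LINT p|lebesgue. (G p - r (S N) p)\<^sup>2) * ?W)"
        by (rule real_sqrt_le_mono) (rule integral_Cauchy_Schwarz[OF mD rm[OF wQ] iD ri[OF wQ]])
      finally show ?thesis by (simp add: real_sqrt_mult)
    qed
    have "(\<lambda>N. sqrt (LINT p|lebesgue. (G p - r (S N) p)\<^sup>2) * sqrt ?W) \<longlonglongrightarrow> sqrt 0 * sqrt ?W"
      by (intro tendsto_intros Gl)
    then have z: "(\<lambda>N. sqrt (LINT p|lebesgue. (G p - r (S N) p)\<^sup>2) * sqrt ?W) \<longlonglongrightarrow> 0" by simp
    have "(\<lambda>N. (LINT p|lebesgue. r g p * r ?w p) - (LINT p|lebesgue. r (S N) p * r ?w p)) \<longlonglongrightarrow> 0"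
      by (rule Lim_null_comparison[OF always_eventually[OF allI] z]) (unfold real_norm_def, rule cs)
    from tendsto_diff[OF tendsto_const[of "LINT p|lebesgue. r g p * r ?w p"] this]
    have "(\<lambda>N. LINT p|lebesgue. r (S N) p * r ?w p) \<longlonglongrightarrow> (LINT p|lebesgue. r g p * r ?w p)" by simp
    then show ?thesis by (simp add: pair[OF SQ] pair[OF gQ])
  qed
  show ?thesis using gQ weak unfolding S_def[abs_def] by blast
qed

section \<open>Modal equations and the moments of a null control\<close>

text \<open>
  These are the test functions that isolate a single mode.
\<close>

lemma tensor_L2H0s:
  assumes \<psi>: "continuous_on {0..T} \<psi>"
  shows "(\<lambda>t x. \<psi> t * \<phi> k x) \<in> L2H0s T s"
  unfolding L2H0s_def mem_Collect_eq
proof (intro conjI)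
  let ?a = "\<lambda>t. indicator {0<..<T} t * \<psi> t"
  have am: "?a \<in> borel_measurable lebesgue"
    using continuous_Ioo_integrable[OF \<psi>] by (auto simp: set_integrable_def dest: borel_measurable_integrable)
  have "\<phi> k \<in> borel_measurable lebesgue"
    using phi_H0s[of k] by (auto simp: H0s_def Hs_def L2_def set_borel_measurable_def)
  from borel_measurable_times[OF lebesgue_measurable_fst[OF am] lebesgue_measurable_snd[OF this]]
  have "(\<lambda>p. ?a (fst p) * \<phi> k (snd p)) \<in> borel_measurable lebesgue" .
  moreover have "(\<lambda>p. indicator ({0<..<T} \<times> UNIV) p *\<^sub>R (case p of (t, x) \<Rightarrow> \<psi> t * \<phi> k x)) = (\<lambda>p. ?a (fst p) * \<phi> k (snd p))"
    by (auto simp: indicator_def)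
  ultimately show "set_borel_measurable lebesgue ({0<..<T} \<times> UNIV) (\<lambda>(t, x). \<psi> t * \<phi> k x)"
    by (simp add: set_borel_measurable_def)
  show "AE t in lebesgue. t \<in> {0<..<T} \<longrightarrow> (\<lambda>x. \<psi> t * \<phi> k x) \<in> H0s s"
    using H0s_scale[OF phi_H0s] by simp
  have "set_integrable lebesgue {0<..<T} (\<lambda>t. (\<psi> t)\<^sup>2)"
    by (intro continuous_Ioo_integrable continuous_intros \<psi>)
  then show "set_integrable lebesgue {0<..<T} (\<lambda>t. (Hs_norm s (\<lambda>x. \<psi> t * \<phi> k x))\<^sup>2)"
    by (simp add: Hs_norm_scale)
qed

text \<open>
  Testing the weak formulation with $\psi(t)\varphi_k(x)$ turns the form into $\lambda_k$ times the
  coefficient and eliminates the derivative in $H^{-s}$, which leaves a scalar equation in the weak sense.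
  The coefficients of the continuous representative are continuous in time, so this equation determines
  them as primitives and the initial values carry over.
\<close>

lemma finite_energy_modes:
  assumes T: "0 < T" and sol: "finite_energy_solution T s u F u0"
    and F: "\<And>k. set_integrable lebesgue {0<..<T} (\<lambda>t. F t (\<phi> k))"
  obtains U where "\<And>t. t \<in> {0..T} \<Longrightarrow> U t \<in> L2 Dom"
    and "\<And>w. w \<in> L2 Dom \<Longrightarrow> continuous_on {0..T} (\<lambda>t. ip (U t) w)"
    and "AE t in lebesgue. t \<in> {0<..<T} \<longrightarrow> (\<forall>w. ip (U t) w = ip (u t) w)"
    and "\<And>k. primitive T (\<lambda>t. ip (U t) (\<phi> k)) (\<lambda>t. - lam k * ip (U t) (\<phi> k) + F t (\<phi> k))"
    and "\<And>w. ip (U 0) w = ip u0 w"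
proof -
  have FH: "F \<in> L2Hminus T s" and uH: "u \<in> L2H0s T s" and v0: "L2_value_at T u 0 u0"
    using sol by (auto simp: finite_energy_solution_def)
  obtain G where G: "Hminus_deriv T s u G" and eq: "\<And>w. w \<in> L2H0s T s \<Longrightarrow>
      (LINT t:{0<..<T}|lebesgue. G t (w t)) + (LINT t:{0<..<T}|lebesgue. form s (u t) (w t))
             = (LINT t:{0<..<T}|lebesgue. F t (w t))"
    using sol by (auto simp: finite_energy_solution_def)
  obtain U where U: "\<And>t. t \<in> {0..T} \<Longrightarrow> U t \<in> L2 Dom"
    and Uc: "\<And>w. w \<in> L2 Dom \<Longrightarrow> continuous_on {0..T} (\<lambda>t. ip (U t) w)"
    and Uae: "AE t in lebesgue. t \<in> {0<..<T} \<longrightarrow> (AE x in lebesgue. x \<in> Dom \<longrightarrow> U t x = u t x)"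
    and U0: "\<And>w. ip (U 0) w = ip u0 w"
    by (rule L2_value_atE[OF v0]) blast
  note Uu = AE_ip_cong[OF Uae]
  have GH: "G \<in> L2Hminus T s" using G by (simp add: Hminus_deriv_def)
  have homog: "AE t in lebesgue. t \<in> {0<..<T} \<longrightarrow> (\<forall>c. K t (\<lambda>x. c * \<phi> k x) = c * K t (\<phi> k))"
    if "K \<in> L2Hminus T s" for K k
  proof -
    have "AE t in lebesgue. t \<in> {0<..<T} \<longrightarrow> K t \<in> Hminus s" using that by (simp add: L2Hminus_def)
    then show ?thesis by eventually_elim (use phi_H0s in \<open>auto simp: Hminus_def\<close>)
  qed
  have u_H0s: "AE t in lebesgue. t \<in> {0<..<T} \<longrightarrow> u t \<in> H0s s" using uH by (simp add: L2H0s_def)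
  have prim: "primitive T (\<lambda>t. ip (U t) (\<phi> k)) (\<lambda>t. - lam k * ip (U t) (\<phi> k) + F t (\<phi> k))" for k
  proof (rule weak_deriv_primitive[OF T Uc[OF phi_L2]])
    have Ui: "set_integrable lebesgue {0<..<T} (\<lambda>t. ip (U t) (\<phi> k))"
      by (rule continuous_Ioo_integrable[OF Uc[OF phi_L2]])
    show "set_integrable lebesgue {0<..<T} (\<lambda>t. - lam k * ip (U t) (\<phi> k) + F t (\<phi> k))"
      using Ui F by (intro set_integral_add set_integrable_mult_right) auto
    show "weak_deriv T (\<lambda>t. ip (U t) (\<phi> k)) (\<lambda>t. - lam k * ip (U t) (\<phi> k) + F t (\<phi> k))"
      unfolding weak_deriv_def
    proof (intro allI impI)
      fix \<psi> assume \<psi>: "test_fun T \<psi>"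
      note \<psi>p = test_fun_primitive[OF \<psi>]
      have mult_int: "set_integrable lebesgue {0<..<T} (\<lambda>t. g t * \<psi> t)" if "set_integrable lebesgue {0<..<T} g" for g
        using integrable_mult_primitive[OF that \<psi>p] T by simp
      have wH: "(\<lambda>t x. \<psi> t * \<phi> k x) \<in> L2H0s T s"
        by (rule tensor_L2H0s[OF primitive_continuous[OF \<psi>p]])
      have 1: "(LINT t:{0<..<T}|lebesgue. G t (\<lambda>x. \<psi> t * \<phi> k x)) = (LINT t:{0<..<T}|lebesgue. G t (\<phi> k) * \<psi> t)"
        by (rule set_lebesgue_cong_AE(3)) (use homog[OF GH, of k] in eventually_elim, simp)
      have 2: "(LINT t:{0<..<T}|lebesgue. F t (\<lambda>x. \<psi> t * \<phi> k x)) = (LINT t:{0<..<T}|lebesgue. F t (\<phi> k) * \<psi> t)"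
        by (rule set_lebesgue_cong_AE(3)) (use homog[OF FH, of k] in eventually_elim, simp)
      have 3: "(LINT t:{0<..<T}|lebesgue. form s (u t) (\<lambda>x. \<psi> t * \<phi> k x)) = (LINT t:{0<..<T}|lebesgue. lam k * (ip (U t) (\<phi> k) * \<psi> t))"
        by (rule set_lebesgue_cong_AE(3)) (use u_H0s Uu in eventually_elim, simp add: form_scale form_phi)
      have 4: "(LINT t:{0<..<T}|lebesgue. ip (U t) (\<phi> k) * deriv \<psi> t) = (LINT t:{0<..<T}|lebesgue. pivot (u t) (\<phi> k) * deriv \<psi> t)"
        by (rule set_lebesgue_cong_AE(3)) (use Uu in eventually_elim, simp add: pivot_def)
      have 5: "(LINT t:{0<..<T}|lebesgue. pivot (u t) (\<phi> k) * deriv \<psi> t) = - (LINT t:{0<..<T}|lebesgue. G t (\<phi> k) * \<psi> t)"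
        using G \<psi> phi_H0s[of k] unfolding Hminus_deriv_def weak_deriv_def by blast
      have "(LINT t:{0<..<T}|lebesgue. (- lam k * ip (U t) (\<phi> k) + F t (\<phi> k)) * \<psi> t) =
        (LINT t:{0<..<T}|lebesgue. F t (\<phi> k) * \<psi> t - lam k * (ip (U t) (\<phi> k) * \<psi> t))"
        by (simp add: algebra_simps)
      also have "\<dots> = (LINT t:{0<..<T}|lebesgue. F t (\<phi> k) * \<psi> t) - (LINT t:{0<..<T}|lebesgue. lam k * (ip (U t) (\<phi> k) * \<psi> t))"
        by (intro set_integral_diff set_integrable_mult_right mult_int F Ui)
      finally show "(LINT t:{0<..<T}|lebesgue. ip (U t) (\<phi> k) * deriv \<psi> t) =
        - (LINT t:{0<..<T}|lebesgue. (- lam k * ip (U t) (\<phi> k) + F t (\<phi> k)) * \<psi> t)"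
        using eq[OF wH] unfolding 1 2 3 4 5 by simp
    qed
  qed
  show thesis by (rule that[OF U Uc Uu prim U0])
qed

end

lemma zero_outside_L2Q:
  assumes h: "h \<in> L2Q \<tau> \<omega>" and \<omega>: "\<omega> \<subseteq> Dom"
  shows "zero_outside \<omega> h \<in> L2Q \<tau> Dom"
proof -
  have "(\<lambda>p. indicator {0<..<\<tau>} (fst p) * indicator Dom (snd p) * zero_outside \<omega> h (fst p) (snd p)) =
    (\<lambda>p. indicator {0<..<\<tau>} (fst p) * indicator \<omega> (snd p) * h (fst p) (snd p))"
    using \<omega> by (auto simp: zero_outside_def indicator_def fun_eq_iff)
  moreover have "(\<lambda>p. (indicator {0<..<\<tau>} (fst p) * indicator Dom (snd p) * zero_outside \<omega> h (fst p) (snd p))\<^sup>2) =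
    (\<lambda>p. (indicator {0<..<\<tau>} (fst p) * indicator \<omega> (snd p) * h (fst p) (snd p))\<^sup>2)"
    using \<omega> by (auto simp: zero_outside_def indicator_def fun_eq_iff)
  ultimately show ?thesis using h unfolding L2Q_iff by simp
qed

context spectral begin

text \<open>
  After time reversal the controlled solution satisfies the modal equation with initial value
  $(\varphi_n,\varphi_k)$ and forcing $(h(\tau-t),\varphi_k)$.  Null controllability says that it vanishes at
  time $\tau$, so variation of constants expresses the integral of the forcing against
  $e^{\lambda_k t}$ through the initial value.
\<close>

lemma null_control_moments:
  assumes \<tau>: "0 < \<tau>" and \<omega>: "\<omega> \<subseteq> Dom" and nc: "null_control \<tau> s \<omega> (\<phi> n) h"
  shows "(LINT t:{0<..<\<tau>}|lebesgue. exp (- lam k * t) * ip (zero_outside \<omega> h t) (\<phi> k)) =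
    (if k = n then - exp (- lam k * \<tau>) else 0)"
proof -
  let ?h = "zero_outside \<omega> h"
  have hQ: "?h \<in> L2Q \<tau> Dom" using nc \<omega> by (auto simp: null_control_def intro: zero_outside_L2Q)
  obtain p where p: "finite_energy_solution \<tau> s (\<lambda>t. p (\<tau> - t)) (\<lambda>t. pivot (?h (\<tau> - t))) (\<phi> n)"
    and p0: "L2_value_at \<tau> p 0 (\<lambda>x. 0)"
    using nc by (auto simp: null_control_def backward_solution_def)
  have Hi: "set_integrable lebesgue {0<..<\<tau>} (\<lambda>t. pivot (?h (\<tau> - t)) (\<phi> k))" for k
    unfolding pivot_def using LINT_reflect(2)[of \<tau> "\<lambda>t. ip (?h t) (\<phi> k)"] L2Q_ip_integrable[OF hQ phi_L2] by simp
  obtain U where Uc: "\<And>w. w \<in> L2 Dom \<Longrightarrow> continuous_on {0..\<tau>} (\<lambda>t. ip (U t) w)"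
    and Up: "AE t in lebesgue. t \<in> {0<..<\<tau>} \<longrightarrow> (\<forall>w. ip (U t) w = ip (p (\<tau> - t)) w)"
    and prim: "\<And>k. primitive \<tau> (\<lambda>t. ip (U t) (\<phi> k)) (\<lambda>t. - lam k * ip (U t) (\<phi> k) + pivot (?h (\<tau> - t)) (\<phi> k))"
    and U0: "\<And>w. ip (U 0) w = ip (\<phi> n) w"
    by (rule finite_energy_modes[OF \<tau> p Hi]) blast
  obtain P where Pc: "\<And>w. w \<in> L2 Dom \<Longrightarrow> continuous_on {0..\<tau>} (\<lambda>t. ip (P t) w)"
    and Pae: "AE t in lebesgue. t \<in> {0<..<\<tau>} \<longrightarrow> (AE x in lebesgue. x \<in> Dom \<longrightarrow> P t x = p t x)"
    and P0: "\<And>w. ip (P 0) w = ip (\<lambda>x. 0) w"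
    by (rule L2_value_atE[OF p0]) blast
  have "AE t in lebesgue. (\<tau> - t) \<in> {0<..<\<tau>} \<longrightarrow> (\<forall>w. ip (P (\<tau> - t)) w = ip (p (\<tau> - t)) w)"
    by (rule AE_lebesgue_reflect[OF AE_ip_cong[OF Pae]])
  with Up have ae: "AE t in lebesgue. t \<in> {0<..<\<tau>} \<longrightarrow> ip (U t) (\<phi> k) = ip (P (\<tau> - t)) (\<phi> k)"
    by eventually_elim auto
  have "continuous_on {0..\<tau>} (\<lambda>t. ip (P (\<tau> - t)) (\<phi> k))"
    by (rule continuous_on_compose2[OF Pc[OF phi_L2]]) (auto intro!: continuous_intros)
  \<comment> \<open>Both representatives are continuous, so the almost everywhere identity holds at the end point.\<close>
  from continuous_AE_eq[OF \<tau> Uc[OF phi_L2] this ae, of \<tau>]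
  have U\<tau>: "ip (U \<tau>) (\<phi> k) = 0" using \<tau> P0 by simp
  have "0 = ip (\<phi> n) (\<phi> k) + (LINT t:{0<..<\<tau>}|lebesgue. exp (lam k * t) * ip (?h (\<tau> - t)) (\<phi> k))"
    using primitive_ODE[OF _ prim[of k]] \<tau> U\<tau> U0 by (simp add: pivot_def)
  also have "(LINT t:{0<..<\<tau>}|lebesgue. exp (lam k * t) * ip (?h (\<tau> - t)) (\<phi> k)) =
     (LINT t:{0<..<\<tau>}|lebesgue. exp (lam k * (\<tau> - t)) * ip (?h t) (\<phi> k))"
    using LINT_reflect(1)[of \<tau> "\<lambda>t. exp (lam k * (\<tau> - t)) * ip (?h t) (\<phi> k)"] by simp
  also have "\<dots> = (LINT t:{0<..<\<tau>}|lebesgue. exp (lam k * \<tau>) * (exp (- lam k * t) * ip (?h t) (\<phi> k)))"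
    by (simp add: right_diff_distrib exp_diff exp_minus field_simps)
  also have "\<dots> = exp (lam k * \<tau>) * (LINT t:{0<..<\<tau>}|lebesgue. exp (- lam k * t) * ip (?h t) (\<phi> k))" by simp
  finally have "(LINT t:{0<..<\<tau>}|lebesgue. exp (- lam k * t) * ip (?h t) (\<phi> k)) = - ip (\<phi> n) (\<phi> k) / exp (lam k * \<tau>)"
    by (simp add: field_simps)
  then show ?thesis by (auto simp: ortho exp_minus field_simps)
qed

end

section \<open>The forward problem with a separated source\<close>

locale heat_source = spectral +
  fixes T :: real and \<sigma> f :: "real \<Rightarrow> real" and u :: "real \<Rightarrow> real \<Rightarrow> real"
  assumes T: "0 < T" and sigma: "\<sigma> \<in> W1inf T" and f: "f \<in> L2 Dom"
    and sol: "finite_energy_solution T s u (\<lambda>t. pivot (\<lambda>x. f x * \<sigma> t)) (\<lambda>x. 0)"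
begin

abbreviation d :: "real \<Rightarrow> real" where "d \<equiv> wderiv T \<sigma>"

lemma d_Linf: "d \<in> Linf T" and d_weak: "weak_deriv T \<sigma> d"
proof -
  have "\<exists>d. d \<in> Linf T \<and> weak_deriv T \<sigma> d" using sigma by (auto simp: W1inf_def)
  then have "d \<in> Linf T \<and> weak_deriv T \<sigma> d" unfolding wderiv_def by (rule someI_ex)
  then show "d \<in> Linf T" "weak_deriv T \<sigma> d" by auto
qed

lemma sigma_continuous: "continuous_on {0..T} \<sigma>"
  using sigma by (simp add: W1inf_def)

lemma sigma_Linf: "\<sigma> \<in> Linf T"
proof -
  have "compact (\<sigma> ` {0..T})" by (rule compact_continuous_image[OF sigma_continuous compact_Icc])
  then have "bounded (\<sigma> ` {0..T})" by (rule compact_imp_bounded)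
  then obtain C where "\<forall>t\<in>{0..T}. \<bar>\<sigma> t\<bar> \<le> C" by (auto simp: bounded_iff)
  then have "AE t in lebesgue. t \<in> {0<..<T} \<longrightarrow> \<bar>\<sigma> t\<bar> \<le> C" by auto
  moreover have "set_borel_measurable lebesgue {0<..<T} \<sigma>"
    using continuous_Ioo_L2[OF sigma_continuous] by (simp add: L2_def)
  ultimately show ?thesis by (auto simp: Linf_def)
qed

lemma sigma_primitive: "primitive T \<sigma> d"
  by (rule weak_deriv_primitive[OF T sigma_continuous L2_Ioo_integrable[OF Linf_L2[OF d_Linf]] d_weak])

text \<open>
  The solution of $y'=-\lambda_k y+\sigma$ with $y(0)=0$: the coefficient of the solution for a source with
  unit coefficient.
\<close>

definition response :: "nat \<Rightarrow> real \<Rightarrow> real" where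
  "response k t = (LINT r:{0<..<t}|lebesgue. exp (- lam k * r) * \<sigma> (t - r))"

text \<open>
  The derivative of the response, in the form that arises by differentiating the convolution.  Here, in
  contrast to $\sigma-\lambda_k y$, a bound uniform in \<open>k\<close> is visible.
\<close>

definition rate :: "nat \<Rightarrow> real \<Rightarrow> real" where
  "rate k t = \<sigma> 0 * exp (- lam k * t) + (LINT r:{0<..<t}|lebesgue. exp (- lam k * r) * d (t - r))"

text \<open>
  Integration by parts moves the derivative from \<open>\<sigma>\<close> to the exponential.
\<close>

lemma rate_eq:
  assumes t: "t \<in> {0..T}" shows "rate k t = \<sigma> t - lam k * response k t"
proof -
  let ?l = "lam k"
  have "\<sigma> t * exp (?l * t) - \<sigma> 0 * exp (?l * 0) =
    (LINT r:{0<..<t}|lebesgue. d r * exp (?l * r)) + (LINT r:{0<..<t}|lebesgue. \<sigma> r * (?l * exp (?l * r)))"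
    by (rule primitive_parts(3)[OF primitive_sub[OF sigma_primitive] exp_primitive]) (use t in auto)
  also have "\<dots> = (LINT r:{0<..<t}|lebesgue. exp (?l * r) * d r) + ?l * (LINT r:{0<..<t}|lebesgue. exp (?l * r) * \<sigma> r)"
    by (simp only: mult.commute[of "d _"] mult.commute[of "\<sigma> _"] mult.assoc set_integral_mult_right)
  finally have *: "(LINT r:{0<..<t}|lebesgue. exp (?l * r) * d r) =
      \<sigma> t * exp (?l * t) - \<sigma> 0 - ?l * (LINT r:{0<..<t}|lebesgue. exp (?l * r) * \<sigma> r)" by simp
  have e: "exp (- ?l * t) * exp (?l * t) = 1" by (simp add: exp_add[symmetric])
  have "rate k t = \<sigma> 0 * exp (- ?l * t) + exp (- ?l * t) * (\<sigma> t * exp (?l * t) - \<sigma> 0 - ?l * (LINT r:{0<..<t}|lebesgue. exp (?l * r) * \<sigma> r))"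
    unfolding rate_def LINT_exp_reflect * ..
  also have "\<dots> = \<sigma> t * (exp (- ?l * t) * exp (?l * t)) - ?l * (exp (- ?l * t) * (LINT r:{0<..<t}|lebesgue. exp (?l * r) * \<sigma> r))"
    by (simp add: algebra_simps)
  also have "\<dots> = \<sigma> t - ?l * response k t" unfolding e response_def LINT_exp_reflect by simp
  finally show ?thesis .
qed

lemma response_zero: "response k 0 = 0"
  by (simp add: response_def set_lebesgue_integral_def)

lemma response_primitive: "primitive T (response k) (rate k)"
proof -
  let ?l = "lam k"
  define S where "S t = (LINT r:{0<..<t}|lebesgue. exp (?l * r) * \<sigma> r)" for t
  have S: "primitive T S (\<lambda>r. exp (?l * r) * \<sigma> r)"
    unfolding primitive_def S_def
    by (simp add: set_lebesgue_integral_def continuous_Ioo_integrable continuous_intros sigma_continuous)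
  have KS: "response k t = exp (- ?l * t) * S t" for t unfolding response_def S_def by (rule LINT_exp_reflect)
  show ?thesis
  proof (rule primitive_cong[OF primitive_mult[OF exp_primitive[of T "- ?l"] S]])
    show "exp (- ?l * t) * S t = response k t" for t by (simp add: KS)
    have e: "exp (- ?l * t) * exp (?l * t) = 1" for t by (simp add: exp_add[symmetric])
    have "- ?l * exp (- ?l * t) * S t + exp (- ?l * t) * (exp (?l * t) * \<sigma> t) = rate k t" if "t \<in> {0<..<T}" for t
    proof -
      have "exp (- ?l * t) * (exp (?l * t) * \<sigma> t) = \<sigma> t" using e[of t] by (metis mult.assoc mult_1)
      then show ?thesis using rate_eq[of t k] that by (simp add: KS)
    qed
    then show "AE t in lebesgue. t \<in> {0<..<T} \<longrightarrow> - ?l * exp (- ?l * t) * S t + exp (- ?l * t) * (exp (?l * t) * \<sigma> t) = rate k t"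
      by blast
  qed
qed

lemma rate_continuous: "continuous_on {0..T} (rate k)"
proof -
  have "continuous_on {0..T} (\<lambda>t. \<sigma> t - lam k * response k t)"
    by (intro continuous_intros sigma_continuous primitive_continuous[OF response_primitive])
  then show ?thesis by (rule continuous_on_cong[THEN iffD1, rotated -1]) (simp_all add: rate_eq)
qed

text \<open>
  Uniformity in \<open>k\<close> comes from $0\le e^{-\lambda_k r}\le 1$ and the boundedness of $\sigma'$.
\<close>

lemma rate_bound:
  obtains C where "0 \<le> C" "\<And>k t. t \<in> {0..T} \<Longrightarrow> \<bar>rate k t\<bar> \<le> C" "\<And>k t. t \<in> {0..T} \<Longrightarrow> \<bar>response k t\<bar> \<le> C"
proof -
  obtain D where "AE t in lebesgue. t \<in> {0<..<T} \<longrightarrow> \<bar>d t\<bar> \<le> D"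
    using d_Linf by (auto simp: Linf_def)
  then have D: "AE t in lebesgue. t \<in> {0<..<T} \<longrightarrow> \<bar>d t\<bar> \<le> \<bar>D\<bar>" by eventually_elim auto
  define M where "M = \<bar>\<sigma> 0\<bar> + \<bar>D\<bar> * T"
  have M: "0 \<le> M" using T by (simp add: M_def)
  have e: "\<bar>exp (- lam k * r)\<bar> \<le> 1" if "0 \<le> r" for k r using that lam_nonneg[of k] by simp
  have rate: "\<bar>rate k t\<bar> \<le> M" if t: "t \<in> {0..T}" for k t
  proof -
    have "AE r in lebesgue. t - r \<in> {0<..<T} \<longrightarrow> \<bar>d (t - r)\<bar> \<le> \<bar>D\<bar>" by (rule AE_lebesgue_reflect[OF D])
    then have "AE r in lebesgue. r \<in> {0<..<t} \<longrightarrow> \<bar>exp (- lam k * r) * d (t - r)\<bar> \<le> \<bar>D\<bar>"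
    proof eventually_elim
      case (elim r)
      show ?case
      proof
        assume r: "r \<in> {0<..<t}"
        have "\<bar>exp (- lam k * r)\<bar> * \<bar>d (t - r)\<bar> \<le> 1 * \<bar>D\<bar>"
          by (rule mult_mono) (use e[of r k] elim r t in auto)
        then show "\<bar>exp (- lam k * r) * d (t - r)\<bar> \<le> \<bar>D\<bar>" by (simp add: abs_mult)
      qed
    qed
    then have "\<bar>LINT r:{0<..<t}|lebesgue. exp (- lam k * r) * d (t - r)\<bar> \<le> \<bar>D\<bar> * t"
      by (rule LINT_Ioo_bound) (use t in auto)
    also have "\<dots> \<le> \<bar>D\<bar> * T" using t by (intro mult_left_mono) auto
    finally have 1: "\<bar>LINT r:{0<..<t}|lebesgue. exp (- lam k * r) * d (t - r)\<bar> \<le> \<bar>D\<bar> * T" .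
    have "\<bar>\<sigma> 0\<bar> * \<bar>exp (- lam k * t)\<bar> \<le> \<bar>\<sigma> 0\<bar> * 1" by (rule mult_left_mono) (use e[of t k] t in auto)
    then have "\<bar>\<sigma> 0 * exp (- lam k * t)\<bar> \<le> \<bar>\<sigma> 0\<bar>" by (simp add: abs_mult)
    with 1 show ?thesis unfolding rate_def M_def by linarith
  qed
  have response: "\<bar>response k t\<bar> \<le> M * T" if t: "t \<in> {0..T}" for k t
  proof -
    have "\<bar>LINT r:{0<..<t}|lebesgue. rate k r\<bar> \<le> M * t"
      by (rule LINT_Ioo_bound) (use rate t M in auto)
    also have "\<dots> \<le> M * T" using t M by (intro mult_left_mono) auto
    finally show ?thesis using primitive_eq[OF response_primitive t, of k] response_zero by simp
  qed
  show thesis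
  proof (rule that[of "max M (M * T)"])
    show "0 \<le> max M (M * T)" using M by simp
    show "\<bar>rate k t\<bar> \<le> max M (M * T)" if "t \<in> {0..T}" for k t using rate[OF that, of k] by simp
    show "\<bar>response k t\<bar> \<le> max M (M * T)" if "t \<in> {0..T}" for k t using response[OF that, of k] by simp
  qed
qed

lemma forward_modes:
  obtains U where "\<And>t. t \<in> {0..T} \<Longrightarrow> U t \<in> L2 Dom"
    and "AE t in lebesgue. t \<in> {0<..<T} \<longrightarrow> (\<forall>w. ip (U t) w = ip (u t) w)"
    and "\<And>k t. t \<in> {0..T} \<Longrightarrow> ip (U t) (\<phi> k) = ip f (\<phi> k) * response k t"
    and "\<And>w. w \<in> L2 Dom \<Longrightarrow> continuous_on {0..T} (\<lambda>t. ip (U t) w)"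
proof -
  have F: "pivot (\<lambda>x. f x * \<sigma> t) (\<phi> k) = \<sigma> t * ip f (\<phi> k)" for t k
    using ip_scale[of "\<sigma> t" f "\<phi> k"] by (simp add: pivot_def mult.commute)
  have Fi: "set_integrable lebesgue {0<..<T} (\<lambda>t. pivot (\<lambda>x. f x * \<sigma> t) (\<phi> k))" for k
    unfolding F by (intro continuous_Ioo_integrable continuous_intros sigma_continuous)
  obtain U where U: "\<And>t. t \<in> {0..T} \<Longrightarrow> U t \<in> L2 Dom"
    and Uc: "\<And>w. w \<in> L2 Dom \<Longrightarrow> continuous_on {0..T} (\<lambda>t. ip (U t) w)"
    and Uu: "AE t in lebesgue. t \<in> {0<..<T} \<longrightarrow> (\<forall>w. ip (U t) w = ip (u t) w)"
    and prim: "\<And>k. primitive T (\<lambda>t. ip (U t) (\<phi> k)) (\<lambda>t. - lam k * ip (U t) (\<phi> k) + pivot (\<lambda>x. f x * \<sigma> t) (\<phi> k))"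
    and U0: "\<And>w. ip (U 0) w = ip (\<lambda>x. 0) w"
    by (rule finite_energy_modes[OF T sol Fi]) blast
  have "ip (U t) (\<phi> k) = ip f (\<phi> k) * response k t" if t: "t \<in> {0..T}" for k t
  proof -
    let ?l = "lam k"
    have "exp (?l * t) * ip (U t) (\<phi> k) = (LINT r:{0<..<t}|lebesgue. exp (?l * r) * (\<sigma> r * ip f (\<phi> k)))"
      using primitive_ODE[OF _ primitive_sub[OF prim[of k]], of t] t U0 by (simp add: F)
    also have "\<dots> = ip f (\<phi> k) * (LINT r:{0<..<t}|lebesgue. exp (?l * r) * \<sigma> r)"
      by (simp add: mult_ac flip: set_integral_mult_right)
    finally have "exp (- ?l * t) * (exp (?l * t) * ip (U t) (\<phi> k)) = ip f (\<phi> k) * response k t"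
      unfolding response_def LINT_exp_reflect by simp
    then show ?thesis by (simp add: mult.assoc[symmetric] exp_add[symmetric])
  qed
  with U Uu Uc that show thesis by blast
qed

text \<open>
  The candidate is the series of the modal derivatives.  For each direction \<open>v\<close> the partial sums of
  $(u(t),v)$ and of its candidate derivative are related by integration by parts against a test function;
  the left-hand sides converge by Parseval's identity and dominated convergence, the right-hand sides by
  \<open>mode_series\<close>.
\<close>

lemma time_derivative_exists: "\<exists>g. L2_deriv T u g"
proof -
  define c where "c k = ip f (\<phi> k)" for k
  obtain C where C: "0 \<le> C" "\<And>k t. t \<in> {0..T} \<Longrightarrow> \<bar>rate k t\<bar> \<le> C" "\<And>k t. t \<in> {0..T} \<Longrightarrow> \<bar>response k t\<bar> \<le> C"
    by (rule rate_bound) blast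
  obtain U where U: "\<And>t. t \<in> {0..T} \<Longrightarrow> U t \<in> L2 Dom"
    and Uu: "AE t in lebesgue. t \<in> {0<..<T} \<longrightarrow> (\<forall>w. ip (U t) w = ip (u t) w)"
    and Uk: "\<And>k t. t \<in> {0..T} \<Longrightarrow> ip (U t) (\<phi> k) = c k * response k t"
    and Uc: "\<And>w. w \<in> L2 Dom \<Longrightarrow> continuous_on {0..T} (\<lambda>t. ip (U t) w)"
    unfolding c_def by (rule forward_modes) blast
  define S where "S N t x = (\<Sum>k<N. c k * rate k t * \<phi> k x)" for N :: nat and t x
  have "summable (\<lambda>k. (c k)\<^sup>2)" unfolding c_def by (rule summable_coeff_square[OF f])
  obtain g where gQ: "g \<in> L2Q T Dom"
    and lim: "\<forall>\<psi>\<in>L2 {0<..<T}. \<forall>v\<in>L2 Dom.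
      (\<lambda>N. LINT t:{0<..<T}|lebesgue. \<psi> t * ip (\<lambda>x. \<Sum>k<N. c k * rate k t * \<phi> k x) v) \<longlonglongrightarrow>
      (LINT t:{0<..<T}|lebesgue. \<psi> t * ip (g t) v)"
    using mode_series[where a="rate", OF less_imp_le[OF T] \<open>summable _\<close> rate_continuous C(2)] by blast
  note weak = lim[rule_format, folded S_def]
  have "weak_deriv T (\<lambda>t. ip (u t) v) (\<lambda>t. ip (g t) v)" if v: "v \<in> L2 Dom" for v
  proof (rule weak_deriv_cong[where a="\<lambda>t. ip (U t) v" and b="\<lambda>t. ip (g t) v"])
    show "AE t in lebesgue. t \<in> {0<..<T} \<longrightarrow> ip (U t) v = ip (u t) v" using Uu by eventually_elim auto
    show "weak_deriv T (\<lambda>t. ip (U t) v) (\<lambda>t. ip (g t) v)"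
      unfolding weak_deriv_def
    proof (intro allI impI)
      fix \<psi> assume \<psi>: "test_fun T \<psi>"
      have \<psi>c: "continuous_on {0..T} \<psi>" by (rule primitive_continuous[OF test_fun_primitive[OF \<psi>]])
      have dc: "continuous_on {0..T} (deriv \<psi>)" using \<psi> by (auto simp: test_fun_def intro: continuous_on_subset)
      define b where "b k = ip v (\<phi> k)" for k
      let ?A = "\<lambda>N t. \<Sum>k<N. (c k * response k t) * b k"
      let ?B = "\<lambda>N t. \<Sum>k<N. (c k * rate k t) * b k"
      have Ac: "continuous_on {0..T} (?A N)" for N
        by (intro continuous_intros primitive_continuous[OF response_primitive])
      have AB: "(LINT t:{0<..<T}|lebesgue. ?A N t * deriv \<psi> t) = - (LINT t:{0<..<T}|lebesgue. \<psi> t * ip (S N t) v)" for N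
      proof -
        have "primitive T (?A N) (?B N)"
          unfolding primitive_def
        proof (intro conjI ballI)
          show "set_integrable lebesgue {0<..<T} (?B N)"
            by (intro continuous_Ioo_integrable continuous_intros rate_continuous)
          fix t assume t: "t \<in> {0..T}"
          have i: "set_integrable lebesgue {0<..<t} (\<lambda>t. (c k * rate k t) * b k)" for k
            using set_integrable_Ioo_sub[OF primitive_integrable[OF response_primitive], of 0 t k] t by auto
          have "(LINT r:{0<..<t}|lebesgue. ?B N r) = (\<Sum>k<N. LINT r:{0<..<t}|lebesgue. (c k * rate k r) * b k)"
            using i by (intro set_LINT_sum)
          also have "\<dots> = ?A N t"
            using primitive_eq[OF response_primitive t] by (intro sum.cong) (auto simp: response_zero)
          finally show "?A N t = ?A N 0 + (LINT r:{0<..<t}|lebesgue. ?B N r)" by (simp add: response_zero)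
        qed
        then have "weak_deriv T (?A N) (?B N)" using T by (intro primitive_weak_deriv) auto
        moreover have "ip (S N t) v = ?B N t" for t
          unfolding S_def b_def by (subst ip_sum[OF phi_L2 v]) (simp add: ip_commute)
        ultimately show ?thesis using \<psi> unfolding weak_deriv_def by (simp add: mult.commute)
      qed
      have lim1: "(\<lambda>N. LINT t:{0<..<T}|lebesgue. ?A N t * deriv \<psi> t) \<longlonglongrightarrow> (LINT t:{0<..<T}|lebesgue. ip (U t) v * deriv \<psi> t)"
        unfolding set_lebesgue_integral_def
      proof (rule integral_dominated_convergence[where w="\<lambda>t. indicator {0<..<T} t *\<^sub>R ((C\<^sup>2 * ip f f + ip v v) * \<bar>deriv \<psi> t\<bar>)"])
        show "(\<lambda>t. indicat_real {0<..<T} t *\<^sub>R (ip (U t) v * deriv \<psi> t)) \<in> borel_measurable lebesgue"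
          by (rule borel_measurable_integrable[OF continuous_Ioo_integrable[unfolded set_integrable_def]]) (intro continuous_intros Uc v dc)
        show "(\<lambda>t. indicat_real {0<..<T} t *\<^sub>R (?A N t * deriv \<psi> t)) \<in> borel_measurable lebesgue" for N
          by (rule borel_measurable_integrable[OF continuous_Ioo_integrable[unfolded set_integrable_def]]) (intro continuous_intros Ac dc primitive_continuous[OF response_primitive])
        show "integrable lebesgue (\<lambda>t. indicator {0<..<T} t *\<^sub>R ((C\<^sup>2 * ip f f + ip v v) * \<bar>deriv \<psi> t\<bar>))"
          by (rule continuous_Ioo_integrable[unfolded set_integrable_def]) (intro continuous_intros dc)
        have s: "(\<lambda>N. ?A N t) \<longlonglongrightarrow> ip (U t) v" if "t \<in> {0..T}" for t
          using Parseval[OF U[OF that] v] unfolding sums_def Uk[OF that] b_def .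
        show "AE t in lebesgue. (\<lambda>N. indicat_real {0<..<T} t *\<^sub>R (?A N t * deriv \<psi> t)) \<longlonglongrightarrow> indicat_real {0<..<T} t *\<^sub>R (ip (U t) v * deriv \<psi> t)"
          by (rule AE_I2) (use s in \<open>auto simp: indicator_def intro!: tendsto_intros\<close>)
        have bd: "\<bar>?A N t\<bar> \<le> C\<^sup>2 * ip f f + ip v v" if t: "t \<in> {0..T}" for N t
        proof -
          have "\<bar>?A N t\<bar> \<le> (\<Sum>k<N. \<bar>(c k * response k t) * b k\<bar>)" by (rule sum_abs)
          also have "\<dots> \<le> (\<Sum>k<N. C\<^sup>2 * (c k)\<^sup>2 + (b k)\<^sup>2)"
          proof (rule sum_mono)
            fix k
            have "(response k t)\<^sup>2 \<le> C\<^sup>2" using power_mono[OF C(3)[OF t, of k], of 2] by simp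
            then have "(c k * response k t)\<^sup>2 \<le> C\<^sup>2 * (c k)\<^sup>2" unfolding power_mult_distrib
              by (subst mult.commute) (rule mult_right_mono, auto)
            moreover have "\<bar>(c k * response k t) * b k\<bar> \<le> (c k * response k t)\<^sup>2 + (b k)\<^sup>2" by (rule abs_mult_le_squares)
            ultimately show "\<bar>(c k * response k t) * b k\<bar> \<le> C\<^sup>2 * (c k)\<^sup>2 + (b k)\<^sup>2" by linarith
          qed
          also have "\<dots> = C\<^sup>2 * (\<Sum>k<N. (c k)\<^sup>2) + (\<Sum>k<N. (b k)\<^sup>2)" by (simp add: sum.distrib sum_distrib_left)
          also have "\<dots> \<le> C\<^sup>2 * ip f f + ip v v"
            unfolding c_def b_def by (intro add_mono mult_left_mono Bessel f v) auto
          finally show ?thesis .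
        qed
        show "AE t in lebesgue. norm (indicat_real {0<..<T} t *\<^sub>R (?A N t * deriv \<psi> t)) \<le> indicator {0<..<T} t *\<^sub>R ((C\<^sup>2 * ip f f + ip v v) * \<bar>deriv \<psi> t\<bar>)" for N
        proof (rule AE_I2)
          fix t
          show "norm (indicat_real {0<..<T} t *\<^sub>R (?A N t * deriv \<psi> t)) \<le> indicator {0<..<T} t *\<^sub>R ((C\<^sup>2 * ip f f + ip v v) * \<bar>deriv \<psi> t\<bar>)"
          proof (cases "t \<in> {0<..<T}")
            case True
            then have "\<bar>?A N t\<bar> * \<bar>deriv \<psi> t\<bar> \<le> (C\<^sup>2 * ip f f + ip v v) * \<bar>deriv \<psi> t\<bar>"
              by (intro mult_right_mono bd) auto
            then show ?thesis using True by (simp add: abs_mult)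
          qed simp
        qed
      qed
      have "(\<lambda>N. - (LINT t:{0<..<T}|lebesgue. \<psi> t * ip (S N t) v)) \<longlonglongrightarrow> - (LINT t:{0<..<T}|lebesgue. \<psi> t * ip (g t) v)"
        by (intro tendsto_minus weak continuous_Ioo_L2 \<psi>c v)
      from LIMSEQ_unique[OF lim1[unfolded AB] this]
      show "(LINT t:{0<..<T}|lebesgue. ip (U t) v * deriv \<psi> t) = - (LINT t:{0<..<T}|lebesgue. ip (g t) v * \<psi> t)"
        by (simp add: mult.commute)
    qed
  qed simp
  with gQ show ?thesis unfolding L2_deriv_def by blast
qed

lemma dt_u: "L2_deriv T u (dt T u)"
  unfolding dt_def by (rule someI_ex[OF time_derivative_exists])

text \<open>
  Weak derivatives are unique, so the statement holds for any choice of the time derivative; countably many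
  exceptional null sets are discarded at once.
\<close>

lemma dt_u_modes: "AE t in lebesgue. t \<in> {0<..<T} \<longrightarrow> (\<forall>k. ip (dt T u t) (\<phi> k) = ip f (\<phi> k) * rate k t)"
proof -
  obtain U where Uu: "AE t in lebesgue. t \<in> {0<..<T} \<longrightarrow> (\<forall>w. ip (U t) w = ip (u t) w)"
    and Uk: "\<And>k t. t \<in> {0..T} \<Longrightarrow> ip (U t) (\<phi> k) = ip f (\<phi> k) * response k t"
    and Uc: "\<And>w. w \<in> L2 Dom \<Longrightarrow> continuous_on {0..T} (\<lambda>t. ip (U t) w)"
    by (rule forward_modes) blast
  have gQ: "dt T u \<in> L2Q T Dom" and w: "\<And>v. v \<in> L2 Dom \<Longrightarrow> weak_deriv T (\<lambda>t. ip (u t) v) (\<lambda>t. ip (dt T u t) v)"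
    using dt_u by (auto simp: L2_deriv_def)
  have "AE t in lebesgue. t \<in> {0<..<T} \<longrightarrow> ip (dt T u t) (\<phi> k) = ip f (\<phi> k) * rate k t" for k
  proof (rule primitive_unique[where A="\<lambda>t. ip f (\<phi> k) * response k t"])
    have "AE t in lebesgue. t \<in> {0<..<T} \<longrightarrow> ip (u t) (\<phi> k) = ip (U t) (\<phi> k)"
      using Uu by eventually_elim auto
    from weak_deriv_cong[OF w[OF phi_L2] this]
    have "weak_deriv T (\<lambda>t. ip (U t) (\<phi> k)) (\<lambda>t. ip (dt T u t) (\<phi> k))" by simp
    from weak_deriv_primitive[OF T Uc[OF phi_L2] L2Q_ip_integrable[OF gQ phi_L2] this]
    show "primitive T (\<lambda>t. ip f (\<phi> k) * response k t) (\<lambda>t. ip (dt T u t) (\<phi> k))"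
      by (rule primitive_cong) (auto simp: Uk)
    show "primitive T (\<lambda>t. ip f (\<phi> k) * response k t) (\<lambda>t. ip f (\<phi> k) * rate k t)"
      unfolding primitive_def
    proof (intro conjI ballI)
      show "set_integrable lebesgue {0<..<T} (\<lambda>t. ip f (\<phi> k) * rate k t)"
        using primitive_integrable[OF response_primitive] by simp
      fix t assume t: "t \<in> {0..T}"
      show "ip f (\<phi> k) * response k t = ip f (\<phi> k) * response k 0 + (LINT r:{0<..<t}|lebesgue. ip f (\<phi> k) * rate k r)"
        using primitive_eq[OF response_primitive t, of k] by (simp add: response_zero)
    qed
  qed
  then have "AE t in lebesgue. \<forall>k. t \<in> {0<..<T} \<longrightarrow> ip (dt T u t) (\<phi> k) = ip f (\<phi> k) * rate k t"
    unfolding AE_all_countable by blast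
  then show ?thesis by eventually_elim auto
qed

end

section \<open>Extension by zero and the Volterra equation\<close>

lemma zero_after_L2Q:
  assumes w: "w \<in> L2Q \<tau> X" and \<tau>: "\<tau> \<le> T"
  shows "zero_after \<tau> w \<in> L2Q T X"
proof -
  have ae: "AE p in lebesgue. indicator {0<..<\<tau>} (fst p) * indicator X (snd p) * w (fst p) (snd p) =
    indicator {0<..<T} (fst p) * indicator X (snd p) * zero_after \<tau> w (fst p) (snd p)"
    using AE_lebesgue_fst[OF AE_neq[of \<tau>]] by eventually_elim (use \<tau> in \<open>auto simp: indicator_def zero_after_def\<close>)
  then have ae2: "AE p in lebesgue. (indicator {0<..<\<tau>} (fst p) * indicator X (snd p) * w (fst p) (snd p))\<^sup>2 =
    (indicator {0<..<T} (fst p) * indicator X (snd p) * zero_after \<tau> w (fst p) (snd p))\<^sup>2"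
    by eventually_elim (simp only:)
  show ?thesis using w lebesgue_cong_AE(1)[OF ae] lebesgue_cong_AE(2)[OF ae2] unfolding L2Q_iff by blast
qed

lemma dt_L2_deriv: "\<theta> \<in> H1L2 T \<Longrightarrow> L2_deriv T \<theta> (dt T \<theta>)"
  unfolding dt_def H1L2_def using someI_ex[of "L2_deriv T \<theta>"] by simp

text \<open>
  The boundary term at \<open>\<tau>\<close> in the integration by parts on $(0,\tau)$ vanishes because \<open>\<theta>\<close> does; the one
  at the origin vanishes because the test function does.
\<close>

lemma zero_after_derivative:
  assumes \<tau>: "0 < \<tau>" "\<tau> \<le> T" and \<theta>: "\<theta> \<in> H1L2 \<tau>" and end0: "L2_value_at \<tau> \<theta> \<tau> (\<lambda>x. 0)"
  shows "L2_deriv T (zero_after \<tau> \<theta>) (zero_after \<tau> (dt \<tau> \<theta>))"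
proof -
  have gQ: "dt \<tau> \<theta> \<in> L2Q \<tau> Dom" and w: "\<And>v. v \<in> L2 Dom \<Longrightarrow> weak_deriv \<tau> (\<lambda>t. ip (\<theta> t) v) (\<lambda>t. ip (dt \<tau> \<theta> t) v)"
    using dt_L2_deriv[OF \<theta>] by (auto simp: L2_deriv_def)
  obtain P where Pc: "\<And>w. w \<in> L2 Dom \<Longrightarrow> continuous_on {0..\<tau>} (\<lambda>t. ip (P t) w)"
    and Pae: "AE t in lebesgue. t \<in> {0<..<\<tau>} \<longrightarrow> (AE x in lebesgue. x \<in> Dom \<longrightarrow> P t x = \<theta> t x)"
    and P0: "\<And>w. ip (P \<tau>) w = ip (\<lambda>x. 0) w"
    by (rule L2_value_atE[OF end0]) blast
  have "weak_deriv T (\<lambda>t. ip (zero_after \<tau> \<theta> t) v) (\<lambda>t. ip (zero_after \<tau> (dt \<tau> \<theta>) t) v)" if v: "v \<in> L2 Dom" for v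
    unfolding weak_deriv_def
  proof (intro allI impI)
    fix \<psi> assume \<psi>: "test_fun T \<psi>"
    have P\<theta>: "AE t in lebesgue. t \<in> {0<..<\<tau>} \<longrightarrow> ip (\<theta> t) v = ip (P t) v"
      using AE_ip_cong[OF Pae] by eventually_elim auto
    have "weak_deriv \<tau> (\<lambda>t. ip (P t) v) (\<lambda>t. ip (dt \<tau> \<theta> t) v)"
      by (rule weak_deriv_cong[OF w[OF v] P\<theta>]) simp
    from weak_deriv_primitive[OF \<tau>(1) Pc[OF v] L2Q_ip_integrable[OF gQ v] this]
    have prim: "primitive \<tau> (\<lambda>t. ip (P t) v) (\<lambda>t. ip (dt \<tau> \<theta> t) v)" .
    have "0 = (LINT t:{0<..<\<tau>}|lebesgue. ip (dt \<tau> \<theta> t) v * \<psi> t) + (LINT t:{0<..<\<tau>}|lebesgue. ip (P t) v * deriv \<psi> t)"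
      using primitive_parts(3)[OF prim primitive_sub[OF test_fun_primitive[OF \<psi>] \<tau>(2)]] \<tau> P0 test_fun_boundary(1)[OF \<psi>] by simp
    moreover have "(LINT t:{0<..<\<tau>}|lebesgue. ip (P t) v * deriv \<psi> t) = (LINT t:{0<..<\<tau>}|lebesgue. ip (\<theta> t) v * deriv \<psi> t)"
      by (rule set_lebesgue_cong_AE(3)) (use P\<theta> in eventually_elim, auto)
    moreover have "ip (zero_after \<tau> \<theta> t) v * deriv \<psi> t = (if t \<le> \<tau> then ip (\<theta> t) v * deriv \<psi> t else 0)"
      "ip (zero_after \<tau> (dt \<tau> \<theta>) t) v * \<psi> t = (if t \<le> \<tau> then ip (dt \<tau> \<theta> t) v * \<psi> t else 0)" for t
      by (auto simp: zero_after_def)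
    ultimately show "(LINT t:{0<..<T}|lebesgue. ip (zero_after \<tau> \<theta> t) v * deriv \<psi> t) =
       - (LINT t:{0<..<T}|lebesgue. ip (zero_after \<tau> (dt \<tau> \<theta>) t) v * \<psi> t)"
      by (simp only: LINT_truncate[OF \<tau>(2)])
  qed
  then show ?thesis using zero_after_L2Q[OF gQ \<tau>(2)] by (simp add: L2_deriv_def)
qed

text \<open>
  The derivative on the long interval is only determined almost everywhere; what matters is that its
  coefficients agree with those of the derivative on the short interval, extended by zero.
\<close>

lemma dt_zero_after:
  assumes \<tau>: "0 < \<tau>" "\<tau> \<le> T" and \<theta>: "\<theta> \<in> H1L2 \<tau>" and end0: "L2_value_at \<tau> \<theta> \<tau> (\<lambda>x. 0)"
  shows "dt T (zero_after \<tau> \<theta>) \<in> L2Q T Dom"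
    and "v \<in> L2 Dom \<Longrightarrow> AE t in lebesgue. t \<in> {0<..<T} \<longrightarrow>
       ip (dt T (zero_after \<tau> \<theta>) t) v = (if t \<le> \<tau> then ip (dt \<tau> \<theta> t) v else 0)"
proof -
  note d = zero_after_derivative[OF assms]
  have "L2_deriv T (zero_after \<tau> \<theta>) (dt T (zero_after \<tau> \<theta>))"
    unfolding dt_def[of T] by (rule someI[of "L2_deriv T (zero_after \<tau> \<theta>)", OF d])
  then have Q: "dt T (zero_after \<tau> \<theta>) \<in> L2Q T Dom"
    and w: "\<And>v. v \<in> L2 Dom \<Longrightarrow> weak_deriv T (\<lambda>t. ip (zero_after \<tau> \<theta> t) v) (\<lambda>t. ip (dt T (zero_after \<tau> \<theta>) t) v)"
    by (auto simp: L2_deriv_def)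
  show "dt T (zero_after \<tau> \<theta>) \<in> L2Q T Dom" by (rule Q)
  assume v: "v \<in> L2 Dom"
  have z: "zero_after \<tau> (dt \<tau> \<theta>) \<in> L2Q T Dom"
    and wz: "weak_deriv T (\<lambda>t. ip (zero_after \<tau> \<theta> t) v) (\<lambda>t. ip (zero_after \<tau> (dt \<tau> \<theta>) t) v)"
    using d v by (auto simp: L2_deriv_def)
  have "AE t in lebesgue. t \<in> {0<..<T} \<longrightarrow> ip (dt T (zero_after \<tau> \<theta>) t) v = ip (zero_after \<tau> (dt \<tau> \<theta>) t) v"
    by (rule weak_deriv_unique[OF _ w[OF v] wz L2Q_ip_integrable[OF Q v] L2Q_ip_integrable[OF z v]]) (use \<tau> in simp)
  then show "AE t in lebesgue. t \<in> {0<..<T} \<longrightarrow>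
       ip (dt T (zero_after \<tau> \<theta>) t) v = (if t \<le> \<tau> then ip (dt \<tau> \<theta> t) v else 0)"
    by eventually_elim (auto simp: zero_after_def)
qed

text \<open>
  Both sides are iterated integrals of $\Theta(t)E(r)g(t-r)$ over the triangle $0<r<t<\tau$.
\<close>

lemma convolution_Fubini:
  fixes g E \<Theta> :: "real \<Rightarrow> real"
  assumes \<tau>: "\<tau> \<le> T" and g: "g \<in> Linf T"
    and \<Theta>: "set_integrable lebesgue {0<..<\<tau>} \<Theta>" and E: "set_integrable lebesgue {0<..<\<tau>} E"
  shows "set_integrable lebesgue {0<..<\<tau>} (\<lambda>t. (LINT r:{0<..<t}|lebesgue. E r * g (t - r)) * \<Theta> t)"
    and "set_integrable lebesgue {0<..<\<tau>} (\<lambda>r. E r * (LINT t:{r<..<\<tau>}|lebesgue. g (t - r) * \<Theta> t))"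
    and "(LINT t:{0<..<\<tau>}|lebesgue. (LINT r:{0<..<t}|lebesgue. E r * g (t - r)) * \<Theta> t) =
         (LINT r:{0<..<\<tau>}|lebesgue. E r * (LINT t:{r<..<\<tau>}|lebesgue. g (t - r) * \<Theta> t))"
proof -
  obtain C where gm: "set_borel_measurable lebesgue {0<..<T} g" and C: "AE t in lebesgue. t \<in> {0<..<T} \<longrightarrow> \<bar>g t\<bar> \<le> C"
    using g by (auto simp: Linf_def)
  obtain g' where g': "g' \<in> borel_measurable lborel" "AE x in lborel. indicator {0<..<T} x *\<^sub>R g x = g' x"
    using completion_ex_borel_measurable_real[OF gm[unfolded set_borel_measurable_def]] by auto
  \<comment> \<open>Truncation makes the Borel representative bounded everywhere, so that $G(t-r)$ is bounded and
    measurable in the plane; cutting off to $(0,T)$ restricts the integrand to the triangle.\<close>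
  define G where "G x = indicator {0<..<T} x * max (- \<bar>C\<bar>) (min \<bar>C\<bar> (g' x))" for x
  have Gm: "G \<in> borel_measurable borel" unfolding G_def using g'(1) by simp
  have Gb: "\<bar>G x\<bar> \<le> \<bar>C\<bar>" for x by (auto simp: G_def indicator_def)
  have Gg: "AE x in lebesgue. G x = indicator {0<..<T} x * g x"
    using AE_completion[OF g'(2)] C by eventually_elim (auto simp: G_def indicator_def)
  let ?A = "\<lambda>t. indicator {0<..<\<tau>} t *\<^sub>R \<Theta> t" and ?B = "\<lambda>r. indicator {0<..<\<tau>} r *\<^sub>R E r"
  let ?F = "\<lambda>p. ?A (fst p) * ?B (snd p) * G (fst p - snd p)"
  have AB: "integrable lebesgue (\<lambda>p. ?A (fst p) * ?B (snd p))"
    by (rule lebesgue_integrable_tensor) (use \<Theta> E in \<open>simp_all only: set_integrable_def\<close>)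
  have "(\<lambda>p::real\<times>real. fst p - snd p) \<in> borel_measurable borel"
    by (intro borel_measurable_continuous_onI continuous_intros)
  from measurable_compose[OF this Gm]
  have GM: "(\<lambda>p::real\<times>real. G (fst p - snd p)) \<in> borel_measurable lebesgue"
    by (intro measurable_completion) simp
  have F: "integrable lebesgue ?F"
  proof (rule Bochner_Integration.integrable_bound)
    show "integrable lebesgue (\<lambda>p. \<bar>C\<bar> * (?A (fst p) * ?B (snd p)))" using AB by (rule integrable_mult_right)
    show "?F \<in> borel_measurable lebesgue" using borel_measurable_integrable[OF AB] GM by (rule borel_measurable_times)
    show "AE p in lebesgue. norm (?F p) \<le> norm (\<bar>C\<bar> * (?A (fst p) * ?B (snd p)))"
    proof (rule AE_I2)
      fix p
      have "\<bar>?A (fst p) * ?B (snd p)\<bar> * \<bar>G (fst p - snd p)\<bar> \<le> \<bar>?A (fst p) * ?B (snd p)\<bar> * \<bar>C\<bar>"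
        by (rule mult_left_mono[OF Gb]) simp
      then show "norm (?F p) \<le> norm (\<bar>C\<bar> * (?A (fst p) * ?B (snd p)))" by (simp only: real_norm_def abs_mult abs_idempotent mult_ac)
    qed
  qed
  have in1: "(LINT r|lebesgue. ?F (t, r)) = indicator {0<..<\<tau>} t *\<^sub>R ((LINT r:{0<..<t}|lebesgue. E r * g (t - r)) * \<Theta> t)" for t
  proof -
    have "(LINT r|lebesgue. ?F (t, r)) = (LINT r|lebesgue. indicator {0<..<\<tau>} t * \<Theta> t * (indicator {0<..<t} r *\<^sub>R (E r * g (t - r))))"
      by (rule lebesgue_cong_AE(3))
        (use AE_lebesgue_reflect[OF Gg, of t] in eventually_elim, use \<tau> in \<open>auto simp: indicator_def\<close>)
    then show ?thesis by (simp add: set_lebesgue_integral_def)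
  qed
  have in2: "(LINT t|lebesgue. ?F (t, r)) = indicator {0<..<\<tau>} r *\<^sub>R (E r * (LINT t:{r<..<\<tau>}|lebesgue. g (t - r) * \<Theta> t))" for r
  proof -
    have "(LINT t|lebesgue. ?F (t, r)) = (LINT t|lebesgue. indicator {0<..<\<tau>} r * E r * (indicator {r<..<\<tau>} t *\<^sub>R (g (t - r) * \<Theta> t)))"
      by (rule lebesgue_cong_AE(3))
        (use AE_lebesgue_shift[OF Gg, of r] in eventually_elim, use \<tau> in \<open>auto simp: indicator_def\<close>)
    then show ?thesis by (simp add: set_lebesgue_integral_def)
  qed
  show "set_integrable lebesgue {0<..<\<tau>} (\<lambda>t. (LINT r:{0<..<t}|lebesgue. E r * g (t - r)) * \<Theta> t)"
    using lebesgue_Fubini(2)[OF F] unfolding in1 set_integrable_def .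
  show "set_integrable lebesgue {0<..<\<tau>} (\<lambda>r. E r * (LINT t:{r<..<\<tau>}|lebesgue. g (t - r) * \<Theta> t))"
    using lebesgue_Fubini_swap(2)[OF F] unfolding in2 set_integrable_def .
  show "(LINT t:{0<..<\<tau>}|lebesgue. (LINT r:{0<..<t}|lebesgue. E r * g (t - r)) * \<Theta> t) =
         (LINT r:{0<..<\<tau>}|lebesgue. E r * (LINT t:{r<..<\<tau>}|lebesgue. g (t - r) * \<Theta> t))"
    using lebesgue_Fubini(3)[OF F] lebesgue_Fubini_swap(3)[OF F] unfolding in1 in2 set_lebesgue_integral_def by simp
qed

lemma L2_shift:
  assumes a: "a \<in> L2 {0<..<T}" and r: "0 < r" and \<tau>: "\<tau> \<le> T"
  shows "(\<lambda>t. indicator {r<..} t * a (t - r)) \<in> L2 {0<..<\<tau>}"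
proof -
  let ?f = "\<lambda>x. indicator {0<..<T} x * a x"
  have i: "integrable lebesgue ?f" using L2_Ioo_integrable[OF a] by (simp add: set_integrable_def)
  have i2: "integrable lebesgue (\<lambda>x. (?f x)\<^sup>2)" using a by (simp only: L2_iff)
  have "(\<lambda>t. ?f (- r + 1 * t)) \<in> borel_measurable lebesgue"
    by (rule borel_measurable_integrable[OF lebesgue_integrable_real_affine[OF i]]) simp
  then have m: "(\<lambda>t. indicat_real {0<..<\<tau>} t * ?f (- r + 1 * t)) \<in> borel_measurable lebesgue"
    by (intro borel_measurable_times[OF borel_measurable_indicator]) simp
  have "integrable lebesgue (\<lambda>t. (?f (- r + 1 * t))\<^sup>2)"
    by (rule lebesgue_integrable_real_affine[OF i2]) simp
  then have int: "integrable lebesgue (\<lambda>t. indicator {0<..<\<tau>} t *\<^sub>R (?f (- r + 1 * t))\<^sup>2)"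
    by (rule integrable_mult_indicator[rotated]) simp
  have eq: "indicat_real {0<..<\<tau>} t * ?f (- r + 1 * t) = indicator {0<..<\<tau>} t * (indicator {r<..} t * a (t - r))"
     "indicator {0<..<\<tau>} t *\<^sub>R (?f (- r + 1 * t))\<^sup>2 = (indicator {0<..<\<tau>} t * (indicator {r<..} t * a (t - r)))\<^sup>2" for t
    using r \<tau> by (auto simp: indicator_def)
  show ?thesis using m int unfolding L2_iff eq by blast
qed

text \<open>
  Fubini's theorem in space and time: pairing with \<open>e\<close> commutes with the integral over the time variable.
\<close>

lemma ip_Volterra:
  fixes \<theta> \<theta>' :: "real \<Rightarrow> real \<Rightarrow> real"
  assumes \<theta>: "\<theta> \<in> L2Q \<tau> Dom" and \<theta>': "\<theta>' \<in> L2Q \<tau> Dom" and \<sigma>: "\<sigma> \<in> L2 {0<..<T}" and d: "d \<in> L2 {0<..<T}"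
    and r: "0 < r" and \<tau>: "\<tau> \<le> T" and e: "e \<in> L2 Dom"
  shows "set_integrable lebesgue Dom (\<lambda>x. (LINT t:{r<..<\<tau>}|lebesgue. \<sigma> (t - r) * \<theta> t x + d (t - r) * \<theta>' t x) * e x)"
    and "ip (\<lambda>x. LINT t:{r<..<\<tau>}|lebesgue. \<sigma> (t - r) * \<theta> t x + d (t - r) * \<theta>' t x) e =
      (LINT t:{r<..<\<tau>}|lebesgue. \<sigma> (t - r) * ip (\<theta> t) e) + (LINT t:{r<..<\<tau>}|lebesgue. d (t - r) * ip (\<theta>' t) e)"
proof -
  define I where "I a w p = indicator {0<..<\<tau>} (fst p) * (indicator Dom (snd p) * (w (fst p) (snd p) * ((indicator {r<..} (fst p) * a (fst p - r)) * e (snd p))))"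
    for a :: "real \<Rightarrow> real" and w :: "real \<Rightarrow> real \<Rightarrow> real" and p :: "real \<times> real"
  have I: "integrable lebesgue (I a w)" if "a \<in> L2 {0<..<T}" "w \<in> L2Q \<tau> Dom" for a w
    unfolding I_def by (rule L2Q_product(1)[OF that(2) L2Q_tensor[OF L2_shift[OF that(1) r \<tau>] e]])
  have inx: "(LINT x|lebesgue. I a w (t, x)) = indicator {r<..<\<tau>} t *\<^sub>R (a (t - r) * ip (w t) e)" for a w t
  proof -
    have "I a w (t, x) = indicator {r<..<\<tau>} t * a (t - r) * (indicator Dom x *\<^sub>R (w t x * e x))" for x
      using r by (auto simp: I_def indicator_def)
    then show ?thesis by (simp add: ip_def set_lebesgue_integral_def)
  qed
  note I1 = I[OF \<sigma> \<theta>] and I2 = I[OF d \<theta>']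
  have S: "integrable lebesgue (\<lambda>p. I \<sigma> \<theta> p + I d \<theta>' p)" using I1 I2 by (rule Bochner_Integration.integrable_add)
  have int: "(LINT t|lebesgue. I \<sigma> \<theta> (t, x) + I d \<theta>' (t, x)) =
     indicator Dom x *\<^sub>R ((LINT t:{r<..<\<tau>}|lebesgue. \<sigma> (t - r) * \<theta> t x + d (t - r) * \<theta>' t x) * e x)" for x
  proof -
    have "I \<sigma> \<theta> (t, x) + I d \<theta>' (t, x) = indicator Dom x * e x * (indicator {r<..<\<tau>} t *\<^sub>R (\<sigma> (t - r) * \<theta> t x + d (t - r) * \<theta>' t x))" for t
      using r by (auto simp: I_def indicator_def algebra_simps)
    then show ?thesis by (simp add: set_lebesgue_integral_def)
  qed
  show "set_integrable lebesgue Dom (\<lambda>x. (LINT t:{r<..<\<tau>}|lebesgue. \<sigma> (t - r) * \<theta> t x + d (t - r) * \<theta>' t x) * e x)"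
    using lebesgue_Fubini_swap(2)[OF S] unfolding int set_integrable_def .
  have "ip (\<lambda>x. LINT t:{r<..<\<tau>}|lebesgue. \<sigma> (t - r) * \<theta> t x + d (t - r) * \<theta>' t x) e =
    (LINT x|lebesgue. LINT t|lebesgue. I \<sigma> \<theta> (t, x) + I d \<theta>' (t, x))"
    unfolding int ip_def set_lebesgue_integral_def ..
  also have "\<dots> = (LINT p|lebesgue. I \<sigma> \<theta> p + I d \<theta>' p)" by (rule lebesgue_Fubini_swap(3)[OF S])
  also have "\<dots> = (LINT p|lebesgue. I \<sigma> \<theta> p) + (LINT p|lebesgue. I d \<theta>' p)" using I1 I2 by (rule Bochner_Integration.integral_add)
  also have "\<dots> = (LINT t:{r<..<\<tau>}|lebesgue. \<sigma> (t - r) * ip (\<theta> t) e) + (LINT t:{r<..<\<tau>}|lebesgue. d (t - r) * ip (\<theta>' t) e)"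
    using lebesgue_Fubini(3)[OF I1] lebesgue_Fubini(3)[OF I2] unfolding inx set_lebesgue_integral_def by simp
  finally show "ip (\<lambda>x. LINT t:{r<..<\<tau>}|lebesgue. \<sigma> (t - r) * \<theta> t x + d (t - r) * \<theta>' t x) e =
      (LINT t:{r<..<\<tau>}|lebesgue. \<sigma> (t - r) * ip (\<theta> t) e) + (LINT t:{r<..<\<tau>}|lebesgue. d (t - r) * ip (\<theta>' t) e)" .
qed

section \<open>The pairing of the solution with the Volterra solution\<close>

context heat_source begin

text \<open>
  The adjoint relation between the convolution and the Volterra operator, in the direction of a single mode
  restricted to \<open>\<omega>\<close>: on the left stand the coefficients of the solution and its time derivative paired
  with \<open>\<theta>\<close> and its time derivative, on the right those of the free evolution paired with the control.
\<close>

lemma Volterra_moment: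
  fixes \<theta> h :: "real \<Rightarrow> real \<Rightarrow> real" and k :: nat
  assumes \<tau>: "0 < \<tau>" "\<tau> \<le> T" and \<omega>: "\<omega> \<in> sets lebesgue"
    and V: "volterra_solution \<tau> \<sigma> d (zero_outside \<omega> h) \<theta>"
  defines "e \<equiv> \<lambda>x. indicator \<omega> x * \<phi> k x"
  shows "set_integrable lebesgue {0<..<\<tau>} (\<lambda>t. response k t * ip (\<theta> t) e + rate k t * ip (dt \<tau> \<theta> t) e)"
    and "(LINT t:{0<..<\<tau>}|lebesgue. response k t * ip (\<theta> t) e + rate k t * ip (dt \<tau> \<theta> t) e) =
      (LINT r:{0<..<\<tau>}|lebesgue. exp (- lam k * r) * ip (zero_outside \<omega> h r) (\<phi> k))"
proof -
  let ?\<theta>' = "dt \<tau> \<theta>" and ?E = "\<lambda>r. exp (- lam k * r)"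
  have eL: "e \<in> L2 Dom" unfolding e_def by (rule L2_indicator[OF phi_L2 \<omega>])
  have H1: "\<theta> \<in> H1L2 \<tau>" using V by (simp add: volterra_solution_def)
  then have \<theta>Q: "\<theta> \<in> L2Q \<tau> Dom" by (simp add: H1L2_def)
  have \<theta>'Q: "?\<theta>' \<in> L2Q \<tau> Dom" using dt_L2_deriv[OF H1] by (simp add: L2_deriv_def)
  note i = L2Q_ip_integrable[OF \<theta>Q eL] and i' = L2Q_ip_integrable[OF \<theta>'Q eL]
  have Ei: "set_integrable lebesgue {0<..<\<tau>} ?E" by (intro continuous_Ioo_integrable continuous_intros)
  note c1 = convolution_Fubini[OF \<tau>(2) sigma_Linf i Ei, folded response_def]
  note c2 = convolution_Fubini[OF \<tau>(2) d_Linf i' Ei]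
  have ex: "set_integrable lebesgue {0<..<\<tau>} (\<lambda>r. ?E r * (\<sigma> 0 * ip (?\<theta>' r) e))"
    using integrable_mult_primitive[OF set_integrable_mult_right[OF i', of "\<sigma> 0"] exp_primitive[of \<tau> "- lam k"]] \<tau>
    by (simp add: mult.commute)
  let ?c1 = "\<lambda>r. LINT t:{r<..<\<tau>}|lebesgue. \<sigma> (t - r) * ip (\<theta> t) e"
  let ?c2 = "\<lambda>r. LINT t:{r<..<\<tau>}|lebesgue. d (t - r) * ip (?\<theta>' t) e"
  let ?q = "\<lambda>t. LINT r:{0<..<t}|lebesgue. ?E r * d (t - r)"
  have split: "response k t * ip (\<theta> t) e + rate k t * ip (?\<theta>' t) e =
     response k t * ip (\<theta> t) e + (?E t * (\<sigma> 0 * ip (?\<theta>' t) e) + ?q t * ip (?\<theta>' t) e)" for t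
    by (simp add: rate_def algebra_simps)
  show "set_integrable lebesgue {0<..<\<tau>} (\<lambda>t. response k t * ip (\<theta> t) e + rate k t * ip (?\<theta>' t) e)"
    unfolding split by (intro set_integral_add c1 c2 ex)
  have "(LINT t:{0<..<\<tau>}|lebesgue. response k t * ip (\<theta> t) e + rate k t * ip (?\<theta>' t) e) =
    (LINT t:{0<..<\<tau>}|lebesgue. response k t * ip (\<theta> t) e) + ((LINT t:{0<..<\<tau>}|lebesgue. ?E t * (\<sigma> 0 * ip (?\<theta>' t) e)) +
     (LINT t:{0<..<\<tau>}|lebesgue. ?q t * ip (?\<theta>' t) e))"
    unfolding split set_integral_add(2)[OF c1(1) set_integral_add(1)[OF ex c2(1)]] set_integral_add(2)[OF ex c2(1)] ..
  also have "\<dots> = (LINT r:{0<..<\<tau>}|lebesgue. ?E r * ?c1 r) + ((LINT r:{0<..<\<tau>}|lebesgue. ?E r * (\<sigma> 0 * ip (?\<theta>' r) e)) +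
     (LINT r:{0<..<\<tau>}|lebesgue. ?E r * ?c2 r))"
    unfolding c1(3) c2(3) ..
  also have "\<dots> = (LINT r:{0<..<\<tau>}|lebesgue. ?E r * ?c1 r + (?E r * (\<sigma> 0 * ip (?\<theta>' r) e) + ?E r * ?c2 r))"
    unfolding set_integral_add(2)[OF c1(2) set_integral_add(1)[OF ex c2(2)]] set_integral_add(2)[OF ex c2(2)] ..
  also have "\<dots> = (LINT r:{0<..<\<tau>}|lebesgue. ?E r * ip (zero_outside \<omega> h r) (\<phi> k))"
  proof (rule set_lebesgue_cong_AE(3))
    have "AE r in lebesgue. r \<in> {0<..<\<tau>} \<longrightarrow> (AE x in lebesgue. x \<in> Dom \<longrightarrow>
        zero_outside \<omega> h r x = \<sigma> 0 * ?\<theta>' r x + (LINT t:{r<..<\<tau>}|lebesgue. \<sigma> (t - r) * \<theta> t x + d (t - r) * ?\<theta>' t x))"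
      using V by (simp add: volterra_solution_def)
    with L2Q_sections[OF \<theta>'Q]
    show "AE r in lebesgue. r \<in> {0<..<\<tau>} \<longrightarrow> ?E r * ?c1 r + (?E r * (\<sigma> 0 * ip (?\<theta>' r) e) + ?E r * ?c2 r) =
       ?E r * ip (zero_outside \<omega> h r) (\<phi> k)"
    proof eventually_elim
      case (elim r)
      show ?case
      proof
        assume r: "r \<in> {0<..<\<tau>}"
        let ?V = "\<lambda>x. LINT t:{r<..<\<tau>}|lebesgue. \<sigma> (t - r) * \<theta> t x + d (t - r) * ?\<theta>' t x"
        have t': "?\<theta>' r \<in> L2 Dom" and eq: "AE x in lebesgue. x \<in> Dom \<longrightarrow> zero_outside \<omega> h r x = \<sigma> 0 * ?\<theta>' r x + ?V x"
          using elim r by auto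
        note iv = ip_Volterra[OF \<theta>Q \<theta>'Q continuous_Ioo_L2[OF sigma_continuous] Linf_L2[OF d_Linf] _ \<tau>(2) eL, of r]
        have "zero_outside \<omega> h r x * \<phi> k x = zero_outside \<omega> h r x * e x" for x
          by (simp add: zero_outside_def e_def)
        then have "ip (zero_outside \<omega> h r) (\<phi> k) = ip (zero_outside \<omega> h r) e" by (simp only: ip_def)
        also have "\<dots> = ip (\<lambda>x. \<sigma> 0 * ?\<theta>' r x + ?V x) e" by (rule ip_cong_AE[OF eq])
        also have "\<dots> = (LINT x:Dom|lebesgue. \<sigma> 0 * (?\<theta>' r x * e x) + ?V x * e x)"
          by (simp add: ip_def algebra_simps)
        also have "\<dots> = (LINT x:Dom|lebesgue. \<sigma> 0 * (?\<theta>' r x * e x)) + (LINT x:Dom|lebesgue. ?V x * e x)"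
          by (rule set_integral_add(2)[OF set_integrable_mult_right[OF L2_integrable_mult[OF t' eL]] iv(1)]) (use r in auto)
        also have "\<dots> = \<sigma> 0 * ip (?\<theta>' r) e + ip ?V e" by (simp add: ip_def)
        also have "ip ?V e = ?c1 r + ?c2 r" by (rule iv(2)) (use r in auto)
        finally show "?E r * ?c1 r + (?E r * (\<sigma> 0 * ip (?\<theta>' r) e) + ?E r * ?c2 r) = ?E r * ip (zero_outside \<omega> h r) (\<phi> k)"
          by (simp add: algebra_simps)
      qed
    qed
  qed
  finally show "(LINT t:{0<..<\<tau>}|lebesgue. response k t * ip (\<theta> t) e + rate k t * ip (?\<theta>' t) e) =
    (LINT r:{0<..<\<tau>}|lebesgue. ?E r * ip (zero_outside \<omega> h r) (\<phi> k))" .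
qed

text \<open>
  For almost every time the inner integral is a sum over the modes by Parseval's identity, applied to \<open>u\<close>
  and its derivative on one side and to the restrictions of \<open>\<theta>\<close> and its derivative to \<open>\<omega>\<close> on the other.
  The partial sums are dominated by Bessel's inequality, so the integral in time may be taken termwise; by
  \<open>Volterra_moment\<close> and \<open>null_control_moments\<close> all terms except the \<open>n\<close>-th vanish.
\<close>

lemma pairing_value:
  fixes \<theta> h :: "real \<Rightarrow> real \<Rightarrow> real" and n :: nat
  assumes \<tau>: "0 < \<tau>" "\<tau> \<le> T" and \<omega>: "\<omega> \<subseteq> Dom" "\<omega> \<in> sets lebesgue"
    and nc: "null_control \<tau> s \<omega> (\<phi> n) h"
    and V: "volterra_solution \<tau> \<sigma> d (zero_outside \<omega> h) \<theta>"
  shows "H1_pairing T \<omega> u (zero_after \<tau> \<theta>) = - ip f (\<phi> n) * exp (- lam n * \<tau>)"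
proof -
  define c where "c k = ip f (\<phi> k)" for k
  define e where "e k x = indicator \<omega> x * \<phi> k x" for k x
  define cut where "cut w x = indicator \<omega> x * w x" for w :: "real \<Rightarrow> real" and x
  define \<theta>1 D g where "\<theta>1 = zero_after \<tau> \<theta>" and "D = dt T \<theta>1" and "g = dt T u"
  define inner where "inner t = (LINT x:\<omega>|lebesgue. u t x * \<theta>1 t x + g t x * D t x)" for t
  define mode where "mode k t = (if t \<le> \<tau> then c k * (response k t * ip (\<theta> t) (e k) + rate k t * ip (dt \<tau> \<theta> t) (e k)) else 0)" for k t
  obtain C where C: "0 \<le> C" "\<And>k t. t \<in> {0..T} \<Longrightarrow> \<bar>rate k t\<bar> \<le> C" "\<And>k t. t \<in> {0..T} \<Longrightarrow> \<bar>response k t\<bar> \<le> C"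
    by (rule rate_bound) blast
  have H1: "\<theta> \<in> H1L2 \<tau>" and end0: "L2_value_at \<tau> \<theta> \<tau> (\<lambda>x. 0)" using V by (auto simp: volterra_solution_def)
  have eL: "e k \<in> L2 Dom" for k unfolding e_def by (rule L2_indicator[OF phi_L2 \<omega>(2)])
  have \<theta>1Q: "\<theta>1 \<in> L2Q T Dom" unfolding \<theta>1_def using H1 \<tau> by (intro zero_after_L2Q) (auto simp: H1L2_def)
  have DQ: "D \<in> L2Q T Dom" unfolding D_def \<theta>1_def by (rule dt_zero_after(1)[OF \<tau> H1 end0])
  have gQ: "g \<in> L2Q T Dom" using dt_u by (simp add: g_def L2_deriv_def)
  have D_eq: "AE t in lebesgue. \<forall>k. t \<in> {0<..<T} \<longrightarrow> ip (D t) (e k) = (if t \<le> \<tau> then ip (dt \<tau> \<theta> t) (e k) else 0)"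
    unfolding AE_all_countable D_def \<theta>1_def using dt_zero_after(2)[OF \<tau> H1 end0 eL] by blast
  obtain U where Uu: "AE t in lebesgue. t \<in> {0<..<T} \<longrightarrow> (\<forall>w. ip (U t) w = ip (u t) w)"
    and Uk: "\<And>k t. t \<in> {0..T} \<Longrightarrow> ip (U t) (\<phi> k) = ip f (\<phi> k) * response k t"
    by (rule forward_modes) blast
  have u_H0s: "AE t in lebesgue. t \<in> {0<..<T} \<longrightarrow> u t \<in> H0s s"
    using sol by (simp add: finite_energy_solution_def L2H0s_def)
  define w where "w t = 2 * (C\<^sup>2 * ip f f) + (ip (\<theta>1 t) (\<theta>1 t) + ip (D t) (D t))" for t
  have key: "AE t in lebesgue. t \<in> {0<..<T} \<longrightarrow>
     (\<lambda>k. mode k t) sums inner t \<and> (\<forall>N. \<bar>\<Sum>k<N. mode k t\<bar> \<le> w t)"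
    using Uu u_H0s dt_u_modes D_eq L2Q_sections[OF \<theta>1Q] L2Q_sections[OF DQ] L2Q_sections[OF gQ]
  proof eventually_elim
    case (elim t)
    show ?case
    proof
      assume t: "t \<in> {0<..<T}"
      have L: "u t \<in> L2 Dom" "g t \<in> L2 Dom" "\<theta>1 t \<in> L2 Dom" "D t \<in> L2 Dom"
        using elim t H0s_L2 by auto
      have cutL: "cut (\<theta>1 t) \<in> L2 Dom" "cut (D t) \<in> L2 Dom"
        unfolding cut_def by (intro L2_indicator L \<omega>(2))+
      have uk: "ip (u t) (\<phi> k) = c k * response k t" for k
        using elim(1) Uk[of t k] t by (simp add: c_def)
      have gk: "ip (g t) (\<phi> k) = c k * rate k t" for k
        using elim(3) t by (simp add: c_def g_def)
      have sw: "ip (cut w) (\<phi> k) = ip w (e k)" for w k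
        unfolding cut_def e_def by (rule ip_indicator_swap)
      have mode_eq: "mode k t = (c k * response k t) * ip (cut (\<theta>1 t)) (\<phi> k) + (c k * rate k t) * ip (cut (D t)) (\<phi> k)" for k
        using elim(4) t unfolding sw by (simp add: mode_def \<theta>1_def zero_after_def algebra_simps)
      have "inner t = (LINT x:\<omega>|lebesgue. u t x * \<theta>1 t x) + (LINT x:\<omega>|lebesgue. g t x * D t x)"
        unfolding inner_def by (intro set_integral_add L2_integrable_mult L2_subset[OF _ \<omega>] L)
      also have "\<dots> = ip (u t) (cut (\<theta>1 t)) + ip (g t) (cut (D t))"
        unfolding cut_def by (simp add: LINT_subset_ip[OF \<omega>(1)])
      finally have "(\<lambda>k. mode k t) sums inner t"
        using sums_add[OF Parseval[OF L(1) cutL(1)] Parseval[OF L(2) cutL(2)]]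
        unfolding mode_eq uk gk by simp
      moreover have "\<bar>\<Sum>k<N. mode k t\<bar> \<le> w t" for N
      proof -
        have b: "\<bar>(c k * a) * y\<bar> \<le> C\<^sup>2 * (c k)\<^sup>2 + y\<^sup>2" if "\<bar>a\<bar> \<le> C" for a y k
        proof -
          have "a\<^sup>2 \<le> C\<^sup>2" using power_mono[OF that, of 2] by simp
          then have "(c k * a)\<^sup>2 \<le> C\<^sup>2 * (c k)\<^sup>2" unfolding power_mult_distrib
            by (subst mult.commute) (rule mult_right_mono, auto)
          with abs_mult_le_squares[of "c k * a" y] show ?thesis by linarith
        qed
        have "\<bar>\<Sum>k<N. mode k t\<bar> \<le> (\<Sum>k<N. \<bar>mode k t\<bar>)" by (rule sum_abs)
        also have "\<dots> \<le> (\<Sum>k<N. 2 * C\<^sup>2 * (c k)\<^sup>2 + ((ip (cut (\<theta>1 t)) (\<phi> k))\<^sup>2 + (ip (cut (D t)) (\<phi> k))\<^sup>2))"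
        proof (rule sum_mono)
          fix k
          have "\<bar>response k t\<bar> \<le> C" "\<bar>rate k t\<bar> \<le> C" using C t by auto
          from b[OF this(1), of k "ip (cut (\<theta>1 t)) (\<phi> k)"] b[OF this(2), of k "ip (cut (D t)) (\<phi> k)"]
          show "\<bar>mode k t\<bar> \<le> 2 * C\<^sup>2 * (c k)\<^sup>2 + ((ip (cut (\<theta>1 t)) (\<phi> k))\<^sup>2 + (ip (cut (D t)) (\<phi> k))\<^sup>2)"
            unfolding mode_eq by linarith
        qed
        also have "\<dots> = 2 * (C\<^sup>2 * (\<Sum>k<N. (c k)\<^sup>2)) + ((\<Sum>k<N. (ip (cut (\<theta>1 t)) (\<phi> k))\<^sup>2) + (\<Sum>k<N. (ip (cut (D t)) (\<phi> k))\<^sup>2))"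
          by (simp add: sum.distrib sum_distrib_left mult.assoc)
        also have "\<dots> \<le> 2 * (C\<^sup>2 * ip f f) + (ip (cut (\<theta>1 t)) (cut (\<theta>1 t)) + ip (cut (D t)) (cut (D t)))"
          unfolding c_def by (intro add_mono mult_left_mono Bessel f cutL) auto
        also have "\<dots> \<le> w t"
          unfolding w_def cut_def by (intro add_mono ip_indicator_le L \<omega>(2)) auto
        finally show ?thesis .
      qed
      ultimately show "(\<lambda>k. mode k t) sums inner t \<and> (\<forall>N. \<bar>\<Sum>k<N. mode k t\<bar> \<le> w t)" by blast
    qed
  qed
  have vm: "set_integrable lebesgue {0<..<\<tau>} (\<lambda>t. response k t * ip (\<theta> t) (e k) + rate k t * ip (dt \<tau> \<theta> t) (e k))"
    "(LINT t:{0<..<\<tau>}|lebesgue. response k t * ip (\<theta> t) (e k) + rate k t * ip (dt \<tau> \<theta> t) (e k)) = (if k = n then - exp (- lam k * \<tau>) else 0)" for k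
    using Volterra_moment[OF \<tau> \<omega>(2) V, of k] null_control_moments[OF \<tau>(1) \<omega>(1) nc, of k]
    unfolding e_def by simp_all
  have mode_int: "set_integrable lebesgue {0<..<T} (mode k)" for k
  proof -
    have "AE t in lebesgue. indicator {0<..<T} t *\<^sub>R mode k t =
      indicator {0<..<\<tau>} t *\<^sub>R (c k * (response k t * ip (\<theta> t) (e k) + rate k t * ip (dt \<tau> \<theta> t) (e k)))"
      using AE_neq[of \<tau>] by eventually_elim (use \<tau> in \<open>auto simp: mode_def indicator_def\<close>)
    from lebesgue_cong_AE(2)[OF this] set_integrable_mult_right[OF vm(1), of "c k" k]
    show ?thesis unfolding set_integrable_def by blast
  qed
  have mode_val: "(LINT t:{0<..<T}|lebesgue. mode k t) = (if k = n then - c k * exp (- lam k * \<tau>) else 0)" for k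
    unfolding mode_def LINT_truncate[OF \<tau>(2)] set_integral_mult_right vm(2) by simp
  let ?s = "\<lambda>N t. indicator {0<..<T} t *\<^sub>R (\<Sum>k<N. mode k t)"
  have sm: "?s N \<in> borel_measurable lebesgue" for N
    unfolding scaleR_sum_right using mode_int unfolding set_integrable_def
    by (intro borel_measurable_sum borel_measurable_integrable)
  have lim: "AE t in lebesgue. (\<lambda>N. ?s N t) \<longlonglongrightarrow> indicator {0<..<T} t *\<^sub>R inner t"
    using key by eventually_elim (auto simp: sums_def indicator_def)
  \<comment> \<open>\<open>u\<close> is only known to be square integrable in space for almost every time, so measurability of the
    inner integral is obtained from the partial sums instead of Fubini's theorem.\<close>
  have im: "(\<lambda>t. indicator {0<..<T} t *\<^sub>R inner t) \<in> borel_measurable lebesgue"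
  proof -
    have l: "(\<lambda>t. lim (\<lambda>N. ?s N t)) \<in> borel_measurable lebesgue"
      by (rule borel_measurable_lim_metric) (rule sm)
    have "AE t in lebesgue. lim (\<lambda>N. ?s N t) = indicator {0<..<T} t *\<^sub>R inner t"
      using lim by eventually_elim (rule limI)
    from lebesgue_cong_AE(1)[OF this] l show ?thesis by blast
  qed
  have "(\<lambda>N. LINT t|lebesgue. ?s N t) \<longlonglongrightarrow> (LINT t|lebesgue. indicator {0<..<T} t *\<^sub>R inner t)"
  proof (rule integral_dominated_convergence[OF im sm _ lim])
    have "set_integrable lebesgue {0<..<T} w"
      unfolding w_def[abs_def] ip_def
      by (intro set_integral_add L2Q_product(2) \<theta>1Q DQ continuous_Ioo_integrable continuous_on_const)
    then show "integrable lebesgue (\<lambda>t. indicator {0<..<T} t *\<^sub>R w t)" by (simp add: set_integrable_def)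
    show "AE t in lebesgue. norm (?s N t) \<le> indicator {0<..<T} t *\<^sub>R w t" for N
      using key by eventually_elim (auto simp: indicator_def)
  qed
  then have "(\<lambda>N. LINT t:{0<..<T}|lebesgue. \<Sum>k<N. mode k t) \<longlonglongrightarrow> (LINT t:{0<..<T}|lebesgue. inner t)"
    by (simp only: set_lebesgue_integral_def)
  then have "(\<lambda>k. if k = n then - c k * exp (- lam k * \<tau>) else 0) sums (LINT t:{0<..<T}|lebesgue. inner t)"
    unfolding sums_def set_LINT_sum[OF mode_int] mode_val .
  moreover have "(\<lambda>k. if k = n then - c k * exp (- lam k * \<tau>) else 0) sums (- c n * exp (- lam n * \<tau>))"
    by (rule sums_single)
  ultimately have "(LINT t:{0<..<T}|lebesgue. inner t) = - c n * exp (- lam n * \<tau>)" by (rule sums_unique2)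
  then show ?thesis unfolding H1_pairing_def inner_def \<theta>1_def D_def g_def c_def .
qed

end

theorem theorem3p1:
  fixes T s :: real and \<omega> :: "real set" and \<sigma> f :: "real \<Rightarrow> real"
    and u :: "real \<Rightarrow> real \<Rightarrow> real"
    and lam :: "nat \<Rightarrow> real" and \<phi> :: "nat \<Rightarrow> real \<Rightarrow> real" and n :: nat
    and h \<theta> :: "real \<Rightarrow> real \<Rightarrow> real \<Rightarrow> real"
  assumes "T > 0" and "1 / 2 < s" and "s < 1"
    and "\<omega> \<subseteq> Dom" and "\<omega> \<in> sets lebesgue" and "interior \<omega> \<noteq> {}"
    and "\<sigma> \<in> W1inf T" and "\<sigma> T \<noteq> 0"
    and "f \<in> L2 Dom"
    and "finite_energy_solution T s u (\<lambda>t. pivot (\<lambda>x. f x * \<sigma> t)) (\<lambda>x. 0)"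
    and "eigensystem s lam \<phi>"
    and "\<And>\<tau>. 0 < \<tau> \<Longrightarrow> \<tau> \<le> T \<Longrightarrow> null_control \<tau> s \<omega> (\<phi> n) (h \<tau>)"
    and "\<And>\<tau>. 0 < \<tau> \<Longrightarrow> \<tau> \<le> T \<Longrightarrow>
           volterra_solution \<tau> \<sigma> (wderiv T \<sigma>) (zero_outside \<omega> (h \<tau>)) (\<theta> \<tau>)"
  shows "ip f (\<phi> n) = 1 / \<sigma> T *
    (- \<sigma> 0 * H1_pairing T \<omega> u (zero_after T (\<theta> T))
     - (LINT \<tau>:{0<..<T}|lebesgue. wderiv T \<sigma> (T - \<tau>) * H1_pairing T \<omega> u (zero_after \<tau> (\<theta> \<tau>)))
     - lam n * (LINT \<tau>:{0<..<T}|lebesgue. \<sigma> (T - \<tau>) * H1_pairing T \<omega> u (zero_after \<tau> (\<theta> \<tau>))))"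
proof -
  interpret heat_source s lam \<phi> T \<sigma> f u
    by unfold_locales (use assms in auto)
  let ?c = "ip f (\<phi> n)" and ?E = "\<lambda>t. exp (- lam n * t)"
  have P: "H1_pairing T \<omega> u (zero_after \<tau> (\<theta> \<tau>)) = - ?c * ?E \<tau>" if "0 < \<tau>" "\<tau> \<le> T" for \<tau>
    by (rule pairing_value[OF that assms(4,5) assms(12,13)[OF that]])
  have int: "(LINT \<tau>:{0<..<T}|lebesgue. q (T - \<tau>) * H1_pairing T \<omega> u (zero_after \<tau> (\<theta> \<tau>))) =
    - ?c * (LINT \<tau>:{0<..<T}|lebesgue. ?E \<tau> * q (T - \<tau>))" for q :: "real \<Rightarrow> real"
  proof -
    have "(LINT \<tau>:{0<..<T}|lebesgue. q (T - \<tau>) * H1_pairing T \<omega> u (zero_after \<tau> (\<theta> \<tau>))) =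
      (LINT \<tau>:{0<..<T}|lebesgue. - ?c * (?E \<tau> * q (T - \<tau>)))"
      by (rule set_lebesgue_integral_cong) (auto simp: P)
    then show ?thesis by (simp only: set_integral_mult_right)
  qed
  have "- \<sigma> 0 * H1_pairing T \<omega> u (zero_after T (\<theta> T))
     - (LINT \<tau>:{0<..<T}|lebesgue. wderiv T \<sigma> (T - \<tau>) * H1_pairing T \<omega> u (zero_after \<tau> (\<theta> \<tau>)))
     - lam n * (LINT \<tau>:{0<..<T}|lebesgue. \<sigma> (T - \<tau>) * H1_pairing T \<omega> u (zero_after \<tau> (\<theta> \<tau>))) =
    ?c * (rate n T + lam n * response n T)"
    unfolding int P[OF T order_refl] rate_def response_def by (simp add: algebra_simps)
  also have "\<dots> = ?c * \<sigma> T" using rate_eq[of T n] T by simp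
  finally show ?thesis using assms(8) by simp
qed

end
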